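(* Let $\Omega\subset\mathbb{R}^3$ be a simply connected bounded domain whose $C^\infty$ boundary $\partial\Omega$ has a finite number of 2-dimensional connected components. Let $M>0$ (not necessarily small) and $\hat\rho>0$ be given constants, and suppose $(\rho_0,u_0)$ satisfy $$u_0\in H^3,\quad (\rho_0,P(\rho_0))\in H^3,\qquad 0\le\rho_0\le\hat\rho,\quad \|\nabla u_0\|_{L^2}^2\le M,$$ the boundary conditions $u_0\cdot n=0$, $\operatorname{curl}u_0\times n=0$ on $\partial\Omega$, the compatibility condition $$-\mu\Delta u_0-\nabla\big((\lambda(\rho_0)+\mu)\operatorname{div}u_0\big)+\nabla P(\rho_0)=\rho_0 g\quad\text{for some } g\in L^2,$$ and $C_0\le\varepsilon$, where $\varepsilon=\varepsilon(\mu,\lambda,\gamma,a,\hat\rho,\Omega,M)>0$ is the smallness constant described in the context. Assume further that there exists some point $x_0\in\Omega$ such that $\rho_0(x_0)=0$. Then the unique global classical solution $(\rho,u)$ to problem (NS) (see context) satisfies the following: for any $\tilde r>3$ there exist positive constants $\hat C_1$ and $\hat C_2$ depending only on $\mu,\lambda,\gamma,a,\hat\rho,M,\bar\rho_0,\Omega$ and $\tilde r$ such that for any $t>0$, $$\|\nabla\rho(\cdot,t)\|_{L^{\tilde r}}\ge\hat C_1e^{\hat C_2t}.$$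
   Context: Problem (NS): the barotropic compressible Navier-Stokes system, for density $\rho=\rho(x,t)\ge0$ and velocity $u=(u^1,u^2,u^3)(x,t)$, $$\rho_t+\operatorname{div}(\rho u)=0,\qquad (\rho u)_t+\operatorname{div}(\rho u\otimes u)-\mu\Delta u-\nabla((\lambda+\mu)\operatorname{div}u)+\nabla P(\rho)=0,$$ with $P(\rho)=a\rho^\gamma$ ($a>0$, $\gamma>1$), $\mu>0$ constant, $\lambda=\lambda(\rho)=b\rho^\beta$ with $b>0$ constant and $\beta\in[1,\gamma+1]$; initial conditions $\rho(x,0)=\rho_0(x)$, $\rho u(x,0)=\rho_0u_0(x)$, $x\in\Omega$; and slip boundary conditions $u\cdot n=0$, $\operatorname{curl}u\times n=0$ on $\partial\Omega$, where $n$ is the unit outward normal and $\operatorname{curl}u=\nabla\times u$. Dependence of a constant on $\lambda$ means dependence on $b,\beta$. $\Omega$ simply connected means its first Betti number vanishes, i.e. any simple closed curve in $\Omega$ can be contracted to a point in $\Omega$. $L^q,W^{k,q},H^k$ denote the usual Lebesgue and Sobolev spaces over $\Omega$. $\bar f=\frac1{|\Omega|}\int_\Omega f\,dx$; $\bar\rho_0$ is the mean of $\rho_0$ (equal to the mean $\bar\rho$ of $\rho(\cdot,t)$ for all $t$). $\dot u=u_t+u\cdot\nabla u$. The initial energy is $C_0=\int_\Omega(\frac12\rho_0|u_0|^2+G(\rho_0))dx$ with $G(\rho)=\rho\int_{\bar\rho}^{\rho}\frac{P(s)-P(\bar\rho)}{s^2}ds$, $\bar\rho=\bar\rho_0$ (with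 $G(0)$ understood as the limit $\rho\to0^+$). Constant $\varepsilon$ and the solution: $\varepsilon>0$ is the constant, depending only on $\mu,\lambda,\gamma,a,\hat\rho,\Omega,M$, of the paper's global existence theorem, which asserts that, for data as in the first part of the claim (without the assumption on $x_0$) with $C_0\le\varepsilon$, problem (NS) has a unique global classical solution $(\rho,u)$ on $\Omega\times(0,\infty)$ with $0\le\rho\le2\hat\rho$ and, for all $0<\tau<T<\infty$: $(\rho,P)\in C([0,T];H^3)$; $u\in C([0,T];H^3)\cap L^2(0,T;H^4)\cap L^\infty(\tau,T;H^4)$; $u_t\in L^\infty(0,T;H^1)\cap L^2(0,T;H^2)\cap L^\infty(\tau,T;H^2)\cap H^1(\tau,T;H^1)$; $\sqrt\rho u_t\in L^\infty(0,T;L^2)$; and, for all $0<T<\infty$, $\tilde C(T)\inf_\Omega\rho_0\le\rho\le2\hat\rho$ on $\Omega\times[0,T]$ with some $\tilde C(T)>0$ depending only on $T,\mu,\lambda,\gamma,a,\hat\rho,\Omega,M$. Moreover, for any $r\in[1,\infty)$, $p\in[1,6]$ there are $C,\tilde\eta>0$ depending only on $\mu,\lambda,\gamma,a,\hat\rho,M,\bar\rho_0,\Omega,r,p$ with $\|\rho-\bar\rho_0\|_{L^r}+\|u\|_{W^{1,p}}+\|\sqrt\rho\dot u\|_{L^2}^2\le Ce^{-\tilde\eta t}$.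
   Formalization: The formal theorem additionally assumes that the mean of the initial density is positive, i.e. that the initial density is not identically zero; for zero initial density and velocity the solution is zero and the claimed lower bound fails. *)

theory Defs
  imports "HOL-Analysis.Analysis"
begin

section \<open>Classical derivatives\<close>

text \<open>\<open>C_k_on k f S\<close> is meant for open \<open>S\<close>.\<close>

primrec C_k_on ::
  "nat \<Rightarrow> ('a::euclidean_space \<Rightarrow> 'b::real_normed_vector) \<Rightarrow> 'a set \<Rightarrow> bool" where
  "C_k_on 0 f S \<longleftrightarrow> continuous_on S f"
| "C_k_on (Suc k) f S \<longleftrightarrow>
     f differentiable_on S \<and> (\<forall>e\<in>Basis. C_k_on k (\<lambda>x. frechet_derivative f (at x) e) S)"

definition smooth_on :: "'a set \<Rightarrow> ('a::euclidean_space \<Rightarrow> 'b::real_normed_vector) \<Rightarrow> bool" where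
  "smooth_on S f \<longleftrightarrow> (\<forall>k. C_k_on k f S)"

definition pd :: "3 \<Rightarrow> (real^3 \<Rightarrow> 'b::real_normed_vector) \<Rightarrow> real^3 \<Rightarrow> 'b" where
  "pd i f x = frechet_derivative f (at x) (axis i 1)"

definition grad :: "(real^3 \<Rightarrow> real) \<Rightarrow> real^3 \<Rightarrow> real^3" where
  "grad f x = (\<chi> i. pd i f x)"

definition dvg :: "(real^3 \<Rightarrow> real^3) \<Rightarrow> real^3 \<Rightarrow> real" where
  "dvg v x = (\<Sum>i\<in>UNIV. pd i v x $ i)"

definition curl :: "(real^3 \<Rightarrow> real^3) \<Rightarrow> real^3 \<Rightarrow> real^3" where
  "curl v x = vector [pd 2 v x $ 3 - pd 3 v x $ 2,
                      pd 3 v x $ 1 - pd 1 v x $ 3,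
                      pd 1 v x $ 2 - pd 2 v x $ 1]"

definition laplace :: "(real^3 \<Rightarrow> 'b::real_normed_vector) \<Rightarrow> real^3 \<Rightarrow> 'b" where
  "laplace v x = (\<Sum>j\<in>UNIV. pd j (pd j v) x)"

text \<open>Functions of time and space take the time argument first, so that \<open>f t\<close> is the spatial
  function at time \<open>t\<close>.\<close>

definition dt :: "(real \<Rightarrow> 'a \<Rightarrow> 'b::real_normed_vector) \<Rightarrow> real \<Rightarrow> 'a \<Rightarrow> 'b" where
  "dt f t x = vector_derivative (\<lambda>s. f s x) (at t)"

definition material_derivative ::
  "(real \<Rightarrow> real^3 \<Rightarrow> real^3) \<Rightarrow> real \<Rightarrow> real^3 \<Rightarrow> real^3" where
  "material_derivative u t x = dt u t x + (\<Sum>j\<in>UNIV. (u t x $ j) *\<^sub>R pd j (u t) x)"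


section \<open>Lebesgue and Sobolev spaces\<close>

definition test_function :: "'a set \<Rightarrow> ('a::euclidean_space \<Rightarrow> real) \<Rightarrow> bool" where
  "test_function S \<phi> \<longleftrightarrow> smooth_on UNIV \<phi> \<and>
     compact (closure {x. \<phi> x \<noteq> 0}) \<and> closure {x. \<phi> x \<noteq> 0} \<subseteq> S"

text \<open>Multi-indices are elements of \<open>nat^3\<close>; \<open>axis i m\<close> is \<open>m\<close> derivatives in direction \<open>i\<close>.\<close>

definition mi_order :: "nat^3 \<Rightarrow> nat" where
  "mi_order \<alpha> = (\<Sum>i\<in>UNIV. \<alpha> $ i)"

definition mi_pd :: "nat^3 \<Rightarrow> (real^3 \<Rightarrow> 'b::real_normed_vector) \<Rightarrow> real^3 \<Rightarrow> 'b" where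
  "mi_pd \<alpha> \<phi> = (pd 1 ^^ (\<alpha> $ 1)) ((pd 2 ^^ (\<alpha> $ 2)) ((pd 3 ^^ (\<alpha> $ 3)) \<phi>))"

definition Lp_space :: "(real^3) set \<Rightarrow> real \<Rightarrow> (real^3 \<Rightarrow> 'b::euclidean_space) set" where
  "Lp_space \<Omega> p = {f. f \<in> borel_measurable (lebesgue_on \<Omega>) \<and>
                        integrable (lebesgue_on \<Omega>) (\<lambda>x. norm (f x) powr p)}"

definition Lp_norm :: "(real^3) set \<Rightarrow> real \<Rightarrow> (real^3 \<Rightarrow> 'b::euclidean_space) \<Rightarrow> real" where
  "Lp_norm \<Omega> p f = (LINT x|lebesgue_on \<Omega>. norm (f x) powr p) powr (1 / p)"

definition loc_integrable :: "(real^3) set \<Rightarrow> (real^3 \<Rightarrow> 'b::euclidean_space) \<Rightarrow> bool" where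
  "loc_integrable \<Omega> f \<longleftrightarrow> (\<forall>K. compact K \<and> K \<subseteq> \<Omega> \<longrightarrow> integrable (lebesgue_on K) f)"

definition is_weak_deriv :: "(real^3) set \<Rightarrow> nat^3 \<Rightarrow>
    (real^3 \<Rightarrow> 'b::euclidean_space) \<Rightarrow> (real^3 \<Rightarrow> 'b) \<Rightarrow> bool" where
  "is_weak_deriv \<Omega> \<alpha> f g \<longleftrightarrow> loc_integrable \<Omega> f \<and> loc_integrable \<Omega> g \<and>
     (\<forall>\<phi>. test_function \<Omega> \<phi> \<longrightarrow>
        (LINT x|lebesgue_on \<Omega>. mi_pd \<alpha> \<phi> x *\<^sub>R f x) =
        (- 1) ^ mi_order \<alpha> *\<^sub>R (LINT x|lebesgue_on \<Omega>. \<phi> x *\<^sub>R g x))"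

text \<open>The weak derivative, where it exists, is determined only up to null sets; all uses below
  are insensitive to the representative.\<close>

definition wD :: "(real^3) set \<Rightarrow> nat^3 \<Rightarrow>
    (real^3 \<Rightarrow> 'b::euclidean_space) \<Rightarrow> real^3 \<Rightarrow> 'b" where
  "wD \<Omega> \<alpha> f = (SOME g. is_weak_deriv \<Omega> \<alpha> f g)"

definition Wkp :: "(real^3) set \<Rightarrow> nat \<Rightarrow> real \<Rightarrow> (real^3 \<Rightarrow> 'b::euclidean_space) set" where
  "Wkp \<Omega> k p = {f \<in> Lp_space \<Omega> p.
     \<forall>\<alpha>. mi_order \<alpha> \<le> k \<longrightarrow> (\<exists>g\<in>Lp_space \<Omega> p. is_weak_deriv \<Omega> \<alpha> f g)}"

definition Wkp_norm ::
  "(real^3) set \<Rightarrow> nat \<Rightarrow> real \<Rightarrow> (real^3 \<Rightarrow> 'b::euclidean_space) \<Rightarrow> real" where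
  "Wkp_norm \<Omega> k p f =
     (\<Sum>\<alpha> | mi_order \<alpha> \<le> k. LINT x|lebesgue_on \<Omega>. norm (wD \<Omega> \<alpha> f x) powr p) powr (1 / p)"

abbreviation Hk :: "(real^3) set \<Rightarrow> nat \<Rightarrow> (real^3 \<Rightarrow> 'b::euclidean_space) set" where
  "Hk \<Omega> k \<equiv> Wkp \<Omega> k 2"

abbreviation Hk_norm :: "(real^3) set \<Rightarrow> nat \<Rightarrow> (real^3 \<Rightarrow> 'b::euclidean_space) \<Rightarrow> real" where
  "Hk_norm \<Omega> k \<equiv> Wkp_norm \<Omega> k 2"

definition wgrad :: "(real^3) set \<Rightarrow> (real^3 \<Rightarrow> real) \<Rightarrow> real^3 \<Rightarrow> real^3" where
  "wgrad \<Omega> f x = (\<chi> i. wD \<Omega> (axis i 1) f x)"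

definition wdvg :: "(real^3) set \<Rightarrow> (real^3 \<Rightarrow> real^3) \<Rightarrow> real^3 \<Rightarrow> real" where
  "wdvg \<Omega> v x = (\<Sum>i\<in>UNIV. wD \<Omega> (axis i 1) v x $ i)"

definition wlaplace ::
  "(real^3) set \<Rightarrow> (real^3 \<Rightarrow> real^3) \<Rightarrow> real^3 \<Rightarrow> real^3" where
  "wlaplace \<Omega> v x = (\<Sum>j\<in>UNIV. wD \<Omega> (axis j 2) v x)"

definition grad_L2_norm :: "(real^3) set \<Rightarrow> (real^3 \<Rightarrow> real^3) \<Rightarrow> real" where
  "grad_L2_norm \<Omega> v =
     sqrt (LINT x|lebesgue_on \<Omega>. (\<Sum>i\<in>UNIV. (norm (wD \<Omega> (axis i 1) v x))\<^sup>2))"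

definition mean :: "(real^3) set \<Rightarrow> (real^3 \<Rightarrow> real) \<Rightarrow> real" where
  "mean \<Omega> f = (LINT x|lebesgue_on \<Omega>. f x) / measure lebesgue \<Omega>"


section \<open>Spaces of functions of time with values in \<open>H\<^sup>k\<close>\<close>

definition C_Hk :: "(real^3) set \<Rightarrow> nat \<Rightarrow> real set \<Rightarrow>
    (real \<Rightarrow> real^3 \<Rightarrow> 'b::euclidean_space) \<Rightarrow> bool" where
  "C_Hk \<Omega> k I v \<longleftrightarrow> (\<forall>t\<in>I. v t \<in> Hk \<Omega> k) \<and>
     (\<forall>t\<in>I. ((\<lambda>s. Hk_norm \<Omega> k (\<lambda>x. v s x - v t x)) \<longlongrightarrow> 0) (at t within I))"

text \<open>Bochner measurability: almost everywhere limit of simple functions.\<close>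

definition strongly_meas_Hk :: "(real^3) set \<Rightarrow> nat \<Rightarrow> real set \<Rightarrow>
    (real \<Rightarrow> real^3 \<Rightarrow> 'b::euclidean_space) \<Rightarrow> bool" where
  "strongly_meas_Hk \<Omega> k I v \<longleftrightarrow> (AE t in lebesgue_on I. v t \<in> Hk \<Omega> k) \<and>
     (\<exists>s. (\<forall>n::nat. finite (s n ` I) \<and> s n ` I \<subseteq> Hk \<Omega> k \<and>
                (\<forall>w. {t\<in>I. s n t = w} \<in> sets lebesgue)) \<and>
          (AE t in lebesgue_on I. (\<lambda>n. Hk_norm \<Omega> k (\<lambda>x. s n t x - v t x)) \<longlonglongrightarrow> 0))"

definition L2_Hk :: "(real^3) set \<Rightarrow> nat \<Rightarrow> real set \<Rightarrow>
    (real \<Rightarrow> real^3 \<Rightarrow> 'b::euclidean_space) \<Rightarrow> bool" where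
  "L2_Hk \<Omega> k I v \<longleftrightarrow> strongly_meas_Hk \<Omega> k I v \<and>
     integrable (lebesgue_on I) (\<lambda>t. (Hk_norm \<Omega> k (v t))\<^sup>2)"

definition Linf_Hk :: "(real^3) set \<Rightarrow> nat \<Rightarrow> real set \<Rightarrow>
    (real \<Rightarrow> real^3 \<Rightarrow> 'b::euclidean_space) \<Rightarrow> bool" where
  "Linf_Hk \<Omega> k I v \<longleftrightarrow> strongly_meas_Hk \<Omega> k I v \<and>
     (\<exists>B. AE t in lebesgue_on I. Hk_norm \<Omega> k (v t) \<le> B)"

text \<open>The weak time derivative is tested against products \<open>\<phi>(t) \<theta>(x)\<close>, which separate the
  points of \<open>L\<^sup>2\<close> and hence characterise the Bochner-integral identity.\<close>

definition H1_Hk :: "(real^3) set \<Rightarrow> nat \<Rightarrow> real set \<Rightarrow>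
    (real \<Rightarrow> real^3 \<Rightarrow> 'b::euclidean_space) \<Rightarrow> bool" where
  "H1_Hk \<Omega> k I v \<longleftrightarrow> L2_Hk \<Omega> k I v \<and>
     (\<exists>w. L2_Hk \<Omega> k I w \<and>
       (\<forall>\<phi> \<theta>. test_function I \<phi> \<and> test_function \<Omega> \<theta> \<longrightarrow>
         (LINT t|lebesgue_on I. deriv \<phi> t *\<^sub>R (LINT x|lebesgue_on \<Omega>. \<theta> x *\<^sub>R v t x)) =
         - (LINT t|lebesgue_on I. \<phi> t *\<^sub>R (LINT x|lebesgue_on \<Omega>. \<theta> x *\<^sub>R w t x))))"


section \<open>Smooth domains and boundary conditions\<close>

definition local_defining_function ::
  "(real^3) set \<Rightarrow> real^3 \<Rightarrow> (real^3) set \<Rightarrow> (real^3 \<Rightarrow> real) \<Rightarrow> bool" where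
  "local_defining_function \<Omega> p U \<psi> \<longleftrightarrow> open U \<and> p \<in> U \<and> smooth_on U \<psi> \<and>
     (\<forall>x\<in>U. grad \<psi> x \<noteq> 0) \<and>
     \<Omega> \<inter> U = {x\<in>U. \<psi> x < 0} \<and> frontier \<Omega> \<inter> U = {x\<in>U. \<psi> x = 0}"

definition smooth_bounded_domain :: "(real^3) set \<Rightarrow> bool" where
  "smooth_bounded_domain \<Omega> \<longleftrightarrow> open \<Omega> \<and> connected \<Omega> \<and> bounded \<Omega> \<and> \<Omega> \<noteq> {} \<and>
     (\<forall>p\<in>frontier \<Omega>. \<exists>U \<psi>. local_defining_function \<Omega> p U \<psi>)"

definition outward_unit_normal :: "(real^3) set \<Rightarrow> real^3 \<Rightarrow> real^3 \<Rightarrow> bool" where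
  "outward_unit_normal \<Omega> p \<nu> \<longleftrightarrow>
     (\<exists>U \<psi>. local_defining_function \<Omega> p U \<psi> \<and> \<nu> = grad \<psi> p /\<^sub>R norm (grad \<psi> p))"

text \<open>\<open>v \<bullet> n = 0\<close> and \<open>curl v \<times> n = 0\<close> on the boundary. Boundary values are limits from inside,
  since the values of \<open>v\<close> outside \<open>\<Omega>\<close> carry no meaning; they exist for the continuous
  representative of an \<open>H\<^sup>3\<close> field, which is \<open>C\<^sup>1\<close> up to the boundary.\<close>

definition slip_boundary :: "(real^3) set \<Rightarrow> (real^3 \<Rightarrow> real^3) \<Rightarrow> bool" where
  "slip_boundary \<Omega> v \<longleftrightarrow>
     (\<forall>p\<in>frontier \<Omega>. \<forall>\<nu>. outward_unit_normal \<Omega> p \<nu> \<longrightarrow>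
        ((\<lambda>y. v y \<bullet> \<nu>) \<longlongrightarrow> 0) (at p within \<Omega>) \<and>
        ((\<lambda>y. cross3 (curl v y) \<nu>) \<longlongrightarrow> 0) (at p within \<Omega>))"


section \<open>The barotropic compressible Navier--Stokes system\<close>

definition pressure :: "real \<Rightarrow> real \<Rightarrow> real \<Rightarrow> real" where
  "pressure a \<gamma> r = a * r powr \<gamma>"

definition viscosity :: "real \<Rightarrow> real \<Rightarrow> real \<Rightarrow> real" where
  "viscosity b \<beta> r = b * r powr \<beta>"

definition potential_energy :: "(real \<Rightarrow> real) \<Rightarrow> real \<Rightarrow> real \<Rightarrow> real" where
  "potential_energy P rbar r =
     (let G = (\<lambda>r. r * (LBINT s=ereal rbar..ereal r. (P s - P rbar) / s\<^sup>2))
      in if r = 0 then Lim (at_right 0) G else G r)"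

definition initial_energy ::
  "(real^3) set \<Rightarrow> (real \<Rightarrow> real) \<Rightarrow> (real^3 \<Rightarrow> real) \<Rightarrow> (real^3 \<Rightarrow> real^3) \<Rightarrow> real" where
  "initial_energy \<Omega> P \<rho>0 u0 =
     (LINT x|lebesgue_on \<Omega>. \<rho>0 x * (norm (u0 x))\<^sup>2 / 2 + potential_energy P (mean \<Omega> \<rho>0) (\<rho>0 x))"

text \<open>\<open>H\<^sup>3\<close> functions are given by their continuous representatives, so that pointwise
  conditions make sense. The compatibility condition involves derivatives that are only weak.\<close>

definition admissible_data ::
  "(real^3) set \<Rightarrow> real \<Rightarrow> (real \<Rightarrow> real) \<Rightarrow> (real \<Rightarrow> real) \<Rightarrow> real \<Rightarrow> real \<Rightarrow>
   (real^3 \<Rightarrow> real) \<Rightarrow> (real^3 \<Rightarrow> real^3) \<Rightarrow> bool" where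
  "admissible_data \<Omega> \<mu> lam P rhohat M \<rho>0 u0 \<longleftrightarrow>
     continuous_on \<Omega> \<rho>0 \<and> continuous_on \<Omega> u0 \<and>
     u0 \<in> Hk \<Omega> 3 \<and> \<rho>0 \<in> Hk \<Omega> 3 \<and> (\<lambda>x. P (\<rho>0 x)) \<in> Hk \<Omega> 3 \<and>
     (\<forall>x\<in>\<Omega>. 0 \<le> \<rho>0 x \<and> \<rho>0 x \<le> rhohat) \<and>
     (grad_L2_norm \<Omega> u0)\<^sup>2 \<le> M \<and>
     slip_boundary \<Omega> u0 \<and>
     (\<exists>g\<in>Lp_space \<Omega> 2. AE x in lebesgue_on \<Omega>.
        - \<mu> *\<^sub>R wlaplace \<Omega> u0 x
        - wgrad \<Omega> (\<lambda>y. (lam (\<rho>0 y) + \<mu>) * wdvg \<Omega> u0 y) x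
        + wgrad \<Omega> (\<lambda>y. P (\<rho>0 y)) x = \<rho>0 x *\<^sub>R g x)"

definition classical_regularity ::
  "(real^3) set \<Rightarrow> (real \<Rightarrow> real^3 \<Rightarrow> real) \<Rightarrow> (real \<Rightarrow> real^3 \<Rightarrow> real^3) \<Rightarrow> bool" where
  "classical_regularity \<Omega> \<rho> u \<longleftrightarrow>
     continuous_on ({0..} \<times> \<Omega>) (\<lambda>(t, x). \<rho> t x) \<and>
     continuous_on ({0..} \<times> \<Omega>) (\<lambda>(t, x). u t x) \<and>
     C_k_on 1 (\<lambda>(t, x). \<rho> t x) ({0<..} \<times> \<Omega>) \<and>
     C_k_on 1 (\<lambda>(t, x). u t x) ({0<..} \<times> \<Omega>) \<and>
     (\<forall>t>0. C_k_on 2 (u t) \<Omega>) \<and>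
     (\<forall>i j. continuous_on ({0<..} \<times> \<Omega>) (\<lambda>(t, x). pd i (pd j (u t)) x))"

definition NS_equations ::
  "(real^3) set \<Rightarrow> real \<Rightarrow> (real \<Rightarrow> real) \<Rightarrow> (real \<Rightarrow> real) \<Rightarrow>
   (real \<Rightarrow> real^3 \<Rightarrow> real) \<Rightarrow> (real \<Rightarrow> real^3 \<Rightarrow> real^3) \<Rightarrow> bool" where
  "NS_equations \<Omega> \<mu> lam P \<rho> u \<longleftrightarrow> (\<forall>t>0. \<forall>x\<in>\<Omega>.
     dt \<rho> t x + dvg (\<lambda>y. \<rho> t y *\<^sub>R u t y) x = 0 \<and>
     dt (\<lambda>s y. \<rho> s y *\<^sub>R u s y) t x
       + (\<Sum>j\<in>UNIV. pd j (\<lambda>y. (\<rho> t y * u t y $ j) *\<^sub>R u t y) x)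
       - \<mu> *\<^sub>R laplace (u t) x
       - grad (\<lambda>y. (lam (\<rho> t y) + \<mu>) * dvg (u t) y) x
       + grad (\<lambda>y. P (\<rho> t y)) x = 0)"

definition solution_regularity ::
  "(real^3) set \<Rightarrow> (real \<Rightarrow> real) \<Rightarrow>
   (real \<Rightarrow> real^3 \<Rightarrow> real) \<Rightarrow> (real \<Rightarrow> real^3 \<Rightarrow> real^3) \<Rightarrow> bool" where
  "solution_regularity \<Omega> P \<rho> u \<longleftrightarrow> (\<forall>\<tau> T. 0 < \<tau> \<and> \<tau> < T \<longrightarrow>
     C_Hk \<Omega> 3 {0..T} \<rho> \<and> C_Hk \<Omega> 3 {0..T} (\<lambda>t x. P (\<rho> t x)) \<and>
     C_Hk \<Omega> 3 {0..T} u \<and> L2_Hk \<Omega> 4 {0<..<T} u \<and> Linf_Hk \<Omega> 4 {\<tau><..<T} u \<and>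
     Linf_Hk \<Omega> 1 {0<..<T} (dt u) \<and> L2_Hk \<Omega> 2 {0<..<T} (dt u) \<and>
     Linf_Hk \<Omega> 2 {\<tau><..<T} (dt u) \<and> H1_Hk \<Omega> 1 {\<tau><..<T} (dt u) \<and>
     Linf_Hk \<Omega> 0 {0<..<T} (\<lambda>t x. sqrt (\<rho> t x) *\<^sub>R dt u t x))"

definition global_classical_solution ::
  "(real^3) set \<Rightarrow> real \<Rightarrow> (real \<Rightarrow> real) \<Rightarrow> (real \<Rightarrow> real) \<Rightarrow>
   (real^3 \<Rightarrow> real) \<Rightarrow> (real^3 \<Rightarrow> real^3) \<Rightarrow>
   (real \<Rightarrow> real^3 \<Rightarrow> real) \<Rightarrow> (real \<Rightarrow> real^3 \<Rightarrow> real^3) \<Rightarrow> bool" where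
  "global_classical_solution \<Omega> \<mu> lam P \<rho>0 u0 \<rho> u \<longleftrightarrow>
     classical_regularity \<Omega> \<rho> u \<and> solution_regularity \<Omega> P \<rho> u \<and>
     (\<forall>t\<ge>0. \<forall>x\<in>\<Omega>. 0 \<le> \<rho> t x) \<and>
     NS_equations \<Omega> \<mu> lam P \<rho> u \<and>
     (\<forall>x\<in>\<Omega>. \<rho> 0 x = \<rho>0 x \<and> \<rho> 0 x *\<^sub>R u 0 x = \<rho>0 x *\<^sub>R u0 x) \<and>
     (\<forall>t>0. slip_boundary \<Omega> (u t))"

definition unique_global_classical_solution ::
  "(real^3) set \<Rightarrow> real \<Rightarrow> (real \<Rightarrow> real) \<Rightarrow> (real \<Rightarrow> real) \<Rightarrow>
   (real^3 \<Rightarrow> real) \<Rightarrow> (real^3 \<Rightarrow> real^3) \<Rightarrow>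
   (real \<Rightarrow> real^3 \<Rightarrow> real) \<Rightarrow> (real \<Rightarrow> real^3 \<Rightarrow> real^3) \<Rightarrow> bool" where
  "unique_global_classical_solution \<Omega> \<mu> lam P \<rho>0 u0 \<rho> u \<longleftrightarrow>
     global_classical_solution \<Omega> \<mu> lam P \<rho>0 u0 \<rho> u \<and>
     (\<forall>\<rho>' u'. global_classical_solution \<Omega> \<mu> lam P \<rho>0 u0 \<rho>' u' \<longrightarrow>
        (\<forall>t>0. \<forall>x\<in>\<Omega>. \<rho>' t x = \<rho> t x \<and> u' t x = u t x))"

text \<open>What the global existence theorem asserts of its smallness constant \<open>\<epsilon>\<close> about the solutions
  it produces. The order of quantifiers encodes on what the constants \<open>Ct\<close>, \<open>C\<close> and \<open>\<eta>\<close> may depend.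
  Solvability for every admissible datum is deliberately not demanded, which makes this a weaker
  requirement on \<open>\<epsilon>\<close>. The decay is asserted for \<open>t \<ge> 1\<close> only: for \<open>t\<close> near \<open>0\<close> the norms of \<open>u\<close>
  and of its material derivative are not bounded in terms of the listed quantities.\<close>

definition smallness_constant ::
  "(real^3) set \<Rightarrow> real \<Rightarrow> (real \<Rightarrow> real) \<Rightarrow> (real \<Rightarrow> real) \<Rightarrow> real \<Rightarrow> real \<Rightarrow> real \<Rightarrow> bool" where
  "smallness_constant \<Omega> \<mu> lam P rhohat M \<epsilon> \<longleftrightarrow> 0 < \<epsilon> \<and>
     (\<forall>T>0. \<exists>Ct>0. \<forall>\<rho>0 u0 \<rho> u.
        admissible_data \<Omega> \<mu> lam P rhohat M \<rho>0 u0 \<and> initial_energy \<Omega> P \<rho>0 u0 \<le> \<epsilon> \<and>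
        unique_global_classical_solution \<Omega> \<mu> lam P \<rho>0 u0 \<rho> u \<longrightarrow>
        (\<forall>t\<in>{0..T}. \<forall>x\<in>\<Omega>. Ct * (INF y\<in>\<Omega>. \<rho>0 y) \<le> \<rho> t x \<and> \<rho> t x \<le> 2 * rhohat)) \<and>
     (\<forall>rbar. \<forall>r\<ge>1. \<forall>p\<in>{1..6}. \<exists>C>0. \<exists>\<eta>>0. \<forall>\<rho>0 u0 \<rho> u.
        admissible_data \<Omega> \<mu> lam P rhohat M \<rho>0 u0 \<and> initial_energy \<Omega> P \<rho>0 u0 \<le> \<epsilon> \<and>
        mean \<Omega> \<rho>0 = rbar \<and>
        unique_global_classical_solution \<Omega> \<mu> lam P \<rho>0 u0 \<rho> u \<longrightarrow>
        (\<forall>t\<ge>1. Lp_norm \<Omega> r (\<lambda>x. \<rho> t x - rbar) + Wkp_norm \<Omega> 1 p (u t)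
           + (Lp_norm \<Omega> 2 (\<lambda>x. sqrt (\<rho> t x) *\<^sub>R material_derivative u t x))\<^sup>2
           \<le> C * exp (- \<eta> * t)))"

end

theory Submission
  imports Defs "HOL-Computational_Algebra.Polynomial"
begin

text \<open>
  Vacuum persists. If \<open>\<rho>(\<cdot>, t)\<close> were bounded below by a positive constant, the transport equation
  run backwards in time would make \<open>\<rho>(\<cdot>, 0)\<close> positive everywhere in \<open>\<Omega>\<close>. Since \<open>u\<close> is only
  controlled inside \<open>\<Omega>\<close>, characteristics are avoided in favour of a minimum principle: a
  barrier \<open>D\<close> comparable to the distance to the boundary satisfies \<open>|u \<bullet> \<nabla>D| \<le> C D\<close> because of the slip
  condition, so that a small multiple of \<open>ln D\<close> keeps minima away from \<open>\<partial>\<Omega>\<close>. The same barrier yields conservation of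
  mass. Hence \<open>inf \<rho>(\<cdot>, t) < rbar / 4\<close> for every \<open>t\<close>, while \<open>sup \<rho>(\<cdot>, t) \<ge> 3 rbar / 4\<close>.

  For \<open>r > 3\<close> and \<open>0 < s \<le> 1\<close>, a Morrey estimate on a domain covered by sets star-shaped with respect to
  boxes gives \<open>sup |f| \<le> C (s\<^sup>\<kappa> \<parallel>\<nabla>f\<parallel>\<^sub>r + s\<^sup>-\<^sup>3 \<parallel>f\<parallel>\<^sub>1)\<close> with \<open>\<kappa> = 1 - 3 / r\<close>. With \<open>f = \<rho> - rbar\<close>,
  the exponential decay of \<open>\<parallel>f\<parallel>\<^sub>1\<close> and \<open>s\<close> a small exponential in \<open>t\<close>, the left side stays above
  \<open>3 rbar / 4\<close>, which forces \<open>\<parallel>\<nabla>\<rho>\<parallel>\<^sub>r\<close> to grow exponentially. For bounded times the oscillation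
  of \<open>\<rho>\<close> is estimated by \<open>\<parallel>\<nabla>\<rho>\<parallel>\<^sub>r\<close> directly.
\<close>

section \<open>Smooth bumps and tensor products\<close>

text \<open>Classical derivatives exist inside \<Omega>, but uniform bounds on the velocity gradient
  up to the boundary come only through \<open>H^3\<close> norms, so a Sobolev bound is needed before
  the barrier can act. It shares one identity with the Morrey estimate. If \<Omega> is star-shaped
  from x with respect to a box and k is a bump in that box, then k contracted towards x by the
  factor s, with its mass kept, is a test function in \<Omega> for all 0 < s <= 1. Conservation of
  mass under the contraction says that the s-derivative of the kernel is minus the divergence of the
  kernel times (y - x) / s, and this product is a kernel of the same type. So the s-derivative of an
  average of f is a sum of averages of weak derivatives of f, without boundary terms. One
  integration in s gives Morrey for r > 3; two integrations bound functions with second derivatives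
  in L^2.

  The constants of the theorem must not depend on the individual solution. The bound K on its
  velocity does, but it serves only two conclusions free of K: positivity of the initial density and
  conservation of mass. The quantitative input is the geometry of \<Omega> and the given decay
  constants.\<close>

primrec smooth1_upto :: "nat \<Rightarrow> (real \<Rightarrow> real) \<Rightarrow> bool" where
  "smooth1_upto 0 f \<longleftrightarrow> True"
| "smooth1_upto (Suc k) f \<longleftrightarrow> (\<forall>x. (f has_real_derivative deriv f x) (at x)) \<and> smooth1_upto k (deriv f)"

definition smooth1 :: "(real \<Rightarrow> real) \<Rightarrow> bool" where
  "smooth1 f \<longleftrightarrow> (\<forall>k. smooth1_upto k f)"

lemma smooth1_has_deriv: "smooth1 f \<Longrightarrow> (f has_real_derivative deriv f x) (at x)"
  unfolding smooth1_def by (drule spec[of _ "Suc 0"]) simp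

lemma smooth1_deriv: "smooth1 f \<Longrightarrow> smooth1 (deriv f)"
  unfolding smooth1_def
proof
  show "smooth1_upto k (deriv f)" if "\<forall>k. smooth1_upto k f" for k
    using that[rule_format, of "Suc k"] by simp
qed

lemma smooth1_deriv_funpow: "smooth1 f \<Longrightarrow> smooth1 ((deriv ^^ n) f)"
  by (induction n) (auto intro: smooth1_deriv)

lemma smooth1_continuous: "smooth1 f \<Longrightarrow> continuous_on S f"
  by (intro continuous_at_imp_continuous_on ballI DERIV_isCont[OF smooth1_has_deriv])

lemma smooth1_upto_SucI:
  "(\<And>x. (f has_real_derivative f' x) (at x)) \<Longrightarrow> smooth1_upto k f' \<Longrightarrow> smooth1_upto (Suc k) f"
proof -
  assume d: "\<And>x. (f has_real_derivative f' x) (at x)" and "smooth1_upto k f'"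
  moreover from d have "deriv f = f'"
    by (intro ext DERIV_imp_deriv)
  ultimately show ?thesis
    by simp
qed

lemma smooth1_upto_mono: "smooth1_upto (Suc k) f \<Longrightarrow> smooth1_upto k f"
  by (induction k arbitrary: f) auto

lemma smooth1_upto_add:
  "smooth1_upto k f \<Longrightarrow> smooth1_upto k g \<Longrightarrow> smooth1_upto k (\<lambda>x. f x + g x)"
proof (induction k arbitrary: f g)
  case (Suc k)
  show ?case
  proof (rule smooth1_upto_SucI)
    show "((\<lambda>x. f x + g x) has_real_derivative (deriv f x + deriv g x)) (at x)" for x
      using Suc.prems by (intro DERIV_add) auto
  qed (use Suc in auto)
qed auto

lemma smooth1_upto_mult:
  "smooth1_upto k f \<Longrightarrow> smooth1_upto k g \<Longrightarrow> smooth1_upto k (\<lambda>x. f x * g x)"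
proof (induction k arbitrary: f g)
  case (Suc k)
  show ?case
  proof (rule smooth1_upto_SucI)
    show "((\<lambda>x. f x * g x) has_real_derivative (deriv f x * g x + f x * deriv g x)) (at x)" for x
      using Suc.prems by (auto intro!: derivative_eq_intros)
    show "smooth1_upto k (\<lambda>x. deriv f x * g x + f x * deriv g x)"
      using Suc.prems Suc.prems[THEN smooth1_upto_mono]
      by (intro smooth1_upto_add Suc.IH) auto
  qed
qed auto

lemma smooth1_upto_const: "smooth1_upto k (\<lambda>x. c)"
proof (induction k arbitrary: c)
  case (Suc k)
  show ?case by (rule smooth1_upto_SucI[OF DERIV_const Suc])
qed simp

lemma smooth1_upto_affine: "smooth1_upto k f \<Longrightarrow> smooth1_upto k (\<lambda>x. f (a * x + b))"
proof (induction k arbitrary: f)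
  case (Suc k)
  show ?case
  proof (rule smooth1_upto_SucI)
    have d: "(f has_real_derivative deriv f y) (at y)" for y
      using Suc.prems by auto
    show "((\<lambda>x. f (a * x + b)) has_real_derivative (deriv f (a * x + b) * a)) (at x)" for x
      by (rule DERIV_chain2[OF d]) (auto intro!: derivative_eq_intros)
    show "smooth1_upto k (\<lambda>x. deriv f (a * x + b) * a)"
      using Suc by (intro smooth1_upto_mult smooth1_upto_const Suc.IH) auto
  qed
qed auto

lemma smooth1_mult: "smooth1 f \<Longrightarrow> smooth1 g \<Longrightarrow> smooth1 (\<lambda>x. f x * g x)"
  by (simp add: smooth1_def smooth1_upto_mult)

lemma smooth1_const: "smooth1 (\<lambda>x. c)"
  by (simp add: smooth1_def smooth1_upto_const)

lemma smooth1_affine: "smooth1 f \<Longrightarrow> smooth1 (\<lambda>x. f (a * x + b))"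
  by (simp add: smooth1_def smooth1_upto_affine)

lemma smooth1_id: "smooth1 (\<lambda>x. x)"
  unfolding smooth1_def
proof
  show "smooth1_upto k (\<lambda>x. x)" for k
  proof (cases k)
    case (Suc j)
    then show ?thesis
      by (auto simp del: smooth1_upto.simps(2) intro: smooth1_upto_SucI[OF DERIV_ident smooth1_upto_const])
  qed simp
qed

section \<open>The flat exponential and bumps on the line\<close>

definition exp_flat :: "real poly \<Rightarrow> real \<Rightarrow> real" where
  "exp_flat p t = (if 0 < t then poly p (1 / t) * exp (- (1 / t)) else 0)"

lemma poly_times_exp_neg_tendsto_0: "((\<lambda>x. poly p x * exp (- x)) \<longlongrightarrow> 0) at_top" for p :: "real poly"
proof -
  have "((\<lambda>x. \<Sum>i\<le>degree p. coeff p i * (x ^ i / exp x)) \<longlongrightarrow> (\<Sum>i\<le>degree p. coeff p i * 0)) at_top"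
    by (intro tendsto_sum tendsto_mult tendsto_const tendsto_power_div_exp_0)
  moreover have "(\<Sum>i\<le>degree p. coeff p i * (x ^ i / exp x)) = poly p x * exp (- x)" for x
    by (simp add: poly_altdef sum_distrib_right exp_minus divide_inverse mult.assoc)
  ultimately show ?thesis
    by simp
qed

text \<open>Since 1/t has derivative -1/t^2, differentiating p(1/t) exp(-1/t) replaces p by X^2 (p -
  p'). The polynomial factor thus makes the family closed under differentiation, and one induction
  gives smoothness of all its members.\<close>

lemma exp_flat_has_derivative:
  "(exp_flat p has_real_derivative exp_flat ([:0, 0, 1:] * (p - pderiv p)) t) (at t)"
proof -
  consider "t > 0" | "t < 0" | "t = 0" by linarith
  then show ?thesis
  proof cases
    case 1
    have "((\<lambda>t. poly p (1 / t) * exp (- (1 / t))) has_real_derivative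
             exp_flat ([:0, 0, 1:] * (p - pderiv p)) t) (at t)"
      using 1 by (auto intro!: derivative_eq_intros DERIV_chain2[OF poly_DERIV]
          simp: exp_flat_def field_simps power2_eq_square)
    moreover have "\<forall>\<^sub>F x in nhds t. exp_flat p x = poly p (1 / x) * exp (- (1 / x))"
      using eventually_nhds_in_open[of "{0<..}" t] 1
      by (auto elim!: eventually_mono simp: exp_flat_def)
    ultimately show ?thesis
      by (subst DERIV_cong_ev[OF refl _ refl]) auto
  next
    case 2
    have "\<forall>\<^sub>F x in nhds t. exp_flat p x = 0"
      using eventually_nhds_in_open[of "{..<0}" t] 2
      by (auto elim!: eventually_mono simp: exp_flat_def)
    with 2 show ?thesis
      by (subst DERIV_cong_ev[OF refl _ refl, where g = "\<lambda>_. 0"]) (auto simp: exp_flat_def)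
  next
    case 3
    have "((\<lambda>h. exp_flat p h / h) \<longlongrightarrow> 0) (at_left 0)"
      by (rule tendsto_eventually) (auto simp: exp_flat_def eventually_at_filter)
    moreover have "((\<lambda>h. exp_flat p h / h) \<longlongrightarrow> 0) (at_right 0)"
    proof -
      \<comment> \<open>\<open>pCons 0 p\<close> is p times the variable, which supplies the factor
        1/h of the difference quotient at 0.\<close>
      have "((\<lambda>h. poly (pCons 0 p) (inverse h) * exp (- inverse h)) \<longlongrightarrow> 0) (at_right (0::real))"
        by (rule filterlim_compose[OF poly_times_exp_neg_tendsto_0 filterlim_inverse_at_top_right])
      moreover have "\<forall>\<^sub>F h in at_right 0. poly (pCons 0 p) (inverse h) * exp (- inverse h) = exp_flat p h / h"
        by (auto simp: exp_flat_def eventually_at_filter field_simps)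
      ultimately show ?thesis
        by (rule Lim_transform_eventually)
    qed
    ultimately have "((\<lambda>h. exp_flat p h / h) \<longlongrightarrow> 0) (at 0)"
      by (rule filterlim_split_at)
    with 3 show ?thesis
      by (simp add: DERIV_def exp_flat_def)
  qed
qed

lemma smooth1_exp_flat: "smooth1 (exp_flat p)"
  unfolding smooth1_def
proof
  show "smooth1_upto k (exp_flat p)" for k
  proof (induction k arbitrary: p)
    case (Suc k)
    show ?case by (rule smooth1_upto_SucI[OF exp_flat_has_derivative Suc])
  qed simp
qed

text \<open>As \<open>n\<close> grows these bumps increase to the indicator of the open interval.\<close>

definition bump1 :: "real \<Rightarrow> real \<Rightarrow> real \<Rightarrow> real \<Rightarrow> real" where
  "bump1 n a b t = exp_flat 1 (n * (t - a)) * exp_flat 1 (n * (b - t))"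

lemma smooth1_bump1: "smooth1 (bump1 n a b)"
proof -
  have "bump1 n a b = (\<lambda>t. exp_flat 1 (n * t + (- n * a)) * exp_flat 1 ((- n) * t + n * b))"
    by (auto simp: bump1_def fun_eq_iff algebra_simps)
  then show ?thesis
    using smooth1_mult smooth1_affine[OF smooth1_exp_flat] by presburger
qed

lemma bump1_bounds: "0 \<le> bump1 n a b t" "bump1 n a b t \<le> 1"
proof -
  have "0 \<le> exp_flat 1 x" "exp_flat 1 x \<le> 1" for x
    by (auto simp: exp_flat_def)
  then show "0 \<le> bump1 n a b t" "bump1 n a b t \<le> 1"
    by (auto simp: bump1_def mult_le_one)
qed

lemma bump1_eq_0: "n \<ge> 0 \<Longrightarrow> t \<notin> {a<..<b} \<Longrightarrow> bump1 n a b t = 0"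
  by (auto simp: bump1_def exp_flat_def zero_less_mult_iff)

lemma bump1_pos: "n > 0 \<Longrightarrow> t \<in> {a<..<b} \<Longrightarrow> bump1 n a b t > 0"
  by (auto simp: bump1_def exp_flat_def)

lemma bump1_tendsto: "(\<lambda>n. bump1 (real n) a b t) \<longlonglongrightarrow> indicator {a<..<b} t"
proof (cases "t \<in> {a<..<b}")
  case True
  have *: "(\<lambda>n. exp (- (1 / (real n * c)))) \<longlonglongrightarrow> 1" if "c > 0" for c :: real
  proof -
    have "(\<lambda>n. exp (- ((1 / c) * inverse (real n)))) \<longlonglongrightarrow> exp (- ((1 / c) * 0))"
      by (intro tendsto_intros lim_inverse_n)
    then show ?thesis
      by (simp add: field_simps)
  qed
  have "(\<lambda>n. exp (- (1 / (real n * (t - a)))) * exp (- (1 / (real n * (b - t))))) \<longlonglongrightarrow> 1 * 1"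
    using True by (intro tendsto_mult *) auto
  moreover have "\<forall>\<^sub>F n in sequentially.
      exp (- (1 / (real n * (t - a)))) * exp (- (1 / (real n * (b - t)))) = bump1 (real n) a b t"
    using eventually_gt_at_top[of 0] by eventually_elim (use True in \<open>auto simp: bump1_def exp_flat_def\<close>)
  ultimately show ?thesis
    using True by (auto intro: Lim_transform_eventually)
qed (auto simp: bump1_eq_0)

text \<open>Tensor products serve as test functions throughout: all their partial derivatives are
  explicit tensor products again, and they still determine a locally integrable function up to null
  sets (\<open>fundamental_lemma\<close>).\<close>

definition tprod :: "(3 \<Rightarrow> real \<Rightarrow> real) \<Rightarrow> real^3 \<Rightarrow> real" where
  "tprod F y = (\<Prod>i\<in>UNIV. F i (y $ i))"

lemma tprod_alt: "tprod F y = F 1 (y $ 1) * F 2 (y $ 2) * F 3 (y $ 3)"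
  unfolding tprod_def UNIV_3 by simp

lemma tprod_has_derivative:
  assumes "\<And>i. smooth1 (F i)"
  shows "(tprod F has_derivative
           (\<lambda>h. \<Sum>i\<in>UNIV. h $ i * tprod (F(i := deriv (F i))) y)) (at y)"
proof -
  have d: "((\<lambda>y. F i (y $ i)) has_derivative (\<lambda>h. deriv (F i) (y $ i) * h $ i)) (at y)" for i
    by (rule has_derivative_compose[of "\<lambda>y. y $ i" "\<lambda>h. h $ i", OF _
          smooth1_has_deriv[OF assms[of i], of "y $ i", unfolded has_field_derivative_def]])
       (intro bounded_linear_imp_has_derivative bounded_linear_vec_nth)
  have "((\<lambda>y. F 1 (y $ 1) * F 2 (y $ 2) * F 3 (y $ 3)) has_derivative
      (\<lambda>h. F 1 (y $ 1) * F 2 (y $ 2) * (deriv (F 3) (y $ 3) * h $ 3) +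
        (F 1 (y $ 1) * (deriv (F 2) (y $ 2) * h $ 2) + deriv (F 1) (y $ 1) * h $ 1 * F 2 (y $ 2)) *
        F 3 (y $ 3))) (at y)"
    by (intro has_derivative_mult d)
  moreover have "(\<lambda>h. F 1 (y $ 1) * F 2 (y $ 2) * (deriv (F 3) (y $ 3) * h $ 3) +
        (F 1 (y $ 1) * (deriv (F 2) (y $ 2) * h $ 2) + deriv (F 1) (y $ 1) * h $ 1 * F 2 (y $ 2)) *
        F 3 (y $ 3)) = (\<lambda>h. \<Sum>i\<in>UNIV. h $ i * tprod (F(i := deriv (F i))) y)"
    by (rule ext) (simp only: tprod_alt sum_3 fun_upd_apply, simp add: algebra_simps)
  ultimately show ?thesis
    unfolding tprod_alt[of F, abs_def] by (rule has_derivative_eq_rhs)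
qed

lemma frechet_derivative_tprod:
  assumes "\<And>i. smooth1 (F i)"
  shows "frechet_derivative (tprod F) (at y) (axis i 1) = tprod (F(i := deriv (F i))) y"
proof -
  have "frechet_derivative (tprod F) (at y) = (\<lambda>h. \<Sum>i\<in>UNIV. h $ i * tprod (F(i := deriv (F i))) y)"
    using frechet_derivative_at[OF tprod_has_derivative[OF assms]] by simp
  then show ?thesis
    by (simp add: axis_def if_distrib[of "\<lambda>x. x * _"] cong: if_cong)
qed

lemma pd_tprod:
  assumes "\<And>i. smooth1 (F i)"
  shows "pd i (tprod F) = tprod (F(i := deriv (F i)))"
proof
  show "pd i (tprod F) y = tprod (F(i := deriv (F i))) y" for y
    unfolding pd_def by (rule frechet_derivative_tprod[of F, OF assms])
qed

lemma C_k_on_tprod: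
  "(\<And>i. smooth1 (F i)) \<Longrightarrow> C_k_on k (tprod F) S"
proof (induction k arbitrary: F)
  case 0
  have "tprod F differentiable_on UNIV"
    unfolding differentiable_on_def using tprod_has_derivative[of F] 0 differentiable_def by blast
  then show ?case
    using differentiable_imp_continuous_on continuous_on_subset by (metis C_k_on.simps(1) subset_UNIV)
next
  case (Suc k)
  have "tprod F differentiable_on S"
    unfolding differentiable_on_def differentiable_def
    using has_derivative_at_withinI[OF tprod_has_derivative[of F]] Suc.prems by blast
  moreover have "C_k_on k (\<lambda>x. frechet_derivative (tprod F) (at x) e) S" if e: "e \<in> Basis" for e
  proof -
    obtain i where "e = axis i 1"
      using e unfolding Basis_vec_def Basis_real_def by auto
    then show ?thesis
      using Suc.prems unfolding \<open>e = _\<close> frechet_derivative_tprod[of F, OF Suc.prems]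
      by (intro Suc.IH) (simp add: smooth1_deriv)
  qed
  ultimately show ?case
    by simp
qed

lemma continuous_on_tprod: "(\<And>i. smooth1 (F i)) \<Longrightarrow> continuous_on S (tprod F)"
  using C_k_on_tprod[of F 0] by simp

lemma pd_funpow_tprod:
  "(\<And>i. smooth1 (F i)) \<Longrightarrow> (pd i ^^ n) (tprod F) = tprod (F(i := (deriv ^^ n) (F i)))"
proof (induction n)
  case (Suc n)
  have "smooth1 ((F(i := (deriv ^^ n) (F i))) j)" for j
    using Suc.prems by (simp add: smooth1_deriv_funpow)
  then have "pd i (tprod (F(i := (deriv ^^ n) (F i)))) = tprod (F(i := deriv ((deriv ^^ n) (F i))))"
    by (subst pd_tprod) simp_all
  then show ?case
    by (simp only: funpow.simps o_apply Suc.IH[OF Suc.prems])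
qed simp

lemma mi_pd_tprod:
  assumes "\<And>i. smooth1 (F i)"
  shows "mi_pd \<alpha> (tprod F) = tprod (\<lambda>i. (deriv ^^ (\<alpha> $ i)) (F i))"
proof -
  have "(\<lambda>i. (deriv ^^ (\<alpha> $ i)) (F i)) =
      F(3 := (deriv ^^ (\<alpha> $ 3)) (F 3), 2 := (deriv ^^ (\<alpha> $ 2)) (F 2), 1 := (deriv ^^ (\<alpha> $ 1)) (F 1))"
    using exhaust_3 by (auto simp: fun_eq_iff)
  then show ?thesis
    using assms by (simp add: mi_pd_def pd_funpow_tprod smooth1_deriv_funpow)
qed

text \<open>\<open>mi_pd\<close> differentiates in a fixed order of directions, so that an extra
  derivative applied first has to be moved past the others. In a tensor product derivatives in
  different directions act on different factors, and no symmetry theorem for second derivatives is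
  called upon.\<close>

lemma mi_pd_add_axis_tprod:
  assumes "\<And>i. smooth1 (F i)"
  shows "mi_pd (\<alpha> + axis j 1) (tprod F) = mi_pd \<alpha> (pd j (tprod F))"
proof -
  have "(\<lambda>i. (deriv ^^ ((\<alpha> + axis j 1) $ i)) (F i)) =
        (\<lambda>i. (deriv ^^ (\<alpha> $ i)) ((F(j := deriv (F j))) i))"
  proof (rule ext)
    fix i
    show "(deriv ^^ ((\<alpha> + axis j 1) $ i)) (F i) = (deriv ^^ (\<alpha> $ i)) ((F(j := deriv (F j))) i)"
    proof (cases "i = j")
      case True
      then have "(\<alpha> + axis j 1) $ i = Suc (\<alpha> $ i)"
        by (simp add: axis_def)
      with True show ?thesis
        by (simp only: funpow_Suc_right o_apply fun_upd_same)
    next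
      case False
      then have "(\<alpha> + axis j 1) $ i = \<alpha> $ i"
        by (simp add: axis_def)
      with False show ?thesis
        by simp
    qed
  qed
  then show ?thesis
    unfolding mi_pd_tprod[of F, OF assms] pd_tprod[of F, OF assms]
    by (subst mi_pd_tprod) (auto simp: assms smooth1_deriv)
qed

lemma test_function_tprod:
  assumes "\<And>i. smooth1 (F i)" and "\<And>i t. t \<notin> {lo $ i..hi $ i} \<Longrightarrow> F i t = 0" and "cbox lo hi \<subseteq> S"
  shows "test_function S (tprod F)"
proof -
  have "{x. tprod F x \<noteq> 0} \<subseteq> cbox lo hi"
  proof
    fix x assume x: "x \<in> {x. tprod F x \<noteq> 0}"
    then have "F i (x $ i) \<noteq> 0" for i
      by (simp add: tprod_def)
    with assms(2) have "x $ i \<in> {lo $ i..hi $ i}" for i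
      by blast
    then show "x \<in> cbox lo hi"
      by (simp add: mem_box_cart)
  qed
  then have "closure {x. tprod F x \<noteq> 0} \<subseteq> cbox lo hi"
    by (intro closure_minimal closed_cbox)
  moreover have "compact (closure {x. tprod F x \<noteq> 0})"
    using \<open>{x. tprod F x \<noteq> 0} \<subseteq> cbox lo hi\<close> by (simp add: bounded_subset[OF bounded_cbox])
  ultimately show ?thesis
    using assms(3) C_k_on_tprod[of F, OF assms(1)] unfolding test_function_def smooth_on_def by blast
qed

section \<open>Integration by parts and the fundamental lemma\<close>

lemma norm_increment_le:
  fixes F :: "'a::euclidean_space \<Rightarrow> 'b::euclidean_space"
  assumes "\<And>s. s \<in> {0..h} \<Longrightarrow> (F has_derivative F' (y + s *\<^sub>R e)) (at (y + s *\<^sub>R e))"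
    and "\<And>s. s \<in> {0..h} \<Longrightarrow> norm (F' (y + s *\<^sub>R e) e) \<le> L" and "0 \<le> h"
  shows "norm (F (y + h *\<^sub>R e) - F y) \<le> L * h"
proof -
  have "((\<lambda>s. F (y + s *\<^sub>R e)) has_derivative (\<lambda>d. d *\<^sub>R F' (y + s *\<^sub>R e) e)) (at s within {0..h})"
    if s: "s \<in> {0..h}" for s
  proof -
    have lin: "linear (F' (y + s *\<^sub>R e))"
      using assms(1)[OF s] has_derivative_linear by blast
    have "((\<lambda>s. F (y + s *\<^sub>R e)) has_derivative (\<lambda>d. F' (y + s *\<^sub>R e) (d *\<^sub>R e))) (at s within {0..h})"
      by (rule has_derivative_compose[of "\<lambda>s. y + s *\<^sub>R e" _ s "{0..h}" F, OF _ assms(1)[OF s]])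
         (auto intro!: derivative_eq_intros)
    then show ?thesis
      by (simp add: linear_scale[OF lin])
  qed
  moreover have "onorm (\<lambda>d. d *\<^sub>R F' (y + s *\<^sub>R e) e) \<le> L" if "s \<in> {0..h}" for s
    using mult_right_mono[OF assms(2)[OF that] abs_ge_zero] by (intro onorm_le) (simp add: mult.commute)
  ultimately have "norm (F (y + h *\<^sub>R e) - F (y + 0 *\<^sub>R e)) \<le> L * norm (h - 0)"
    using assms(3) by (intro differentiable_bound[of "{0..h}"]) auto
  then show ?thesis
    using assms(3) by simp
qed

lemma has_vector_derivative_at_iff_quotient:
  "(f has_vector_derivative D) (at x) \<longleftrightarrow> ((\<lambda>h. (f (x + h) - f x) /\<^sub>R h) \<longlongrightarrow> D) (at 0)"
proof -
  have eq: "norm (f (x + h) - f x - h *\<^sub>R D) / norm h = norm ((f (x + h) - f x) /\<^sub>R h - D)" if "h \<noteq> 0" for h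
  proof -
    have "(f (x + h) - f x) /\<^sub>R h - D = (f (x + h) - f x - h *\<^sub>R D) /\<^sub>R h"
      using that by (simp add: scaleR_diff_right)
    then show ?thesis
      by (simp add: divide_inverse)
  qed
  have "(f has_vector_derivative D) (at x) \<longleftrightarrow>
      ((\<lambda>h. norm (f (x + h) - f x - h *\<^sub>R D) / norm h) \<longlongrightarrow> 0) (at 0)"
    by (simp add: has_vector_derivative_def has_derivative_at bounded_linear_scaleR_left)
  also have "\<dots> \<longleftrightarrow> ((\<lambda>h. norm ((f (x + h) - f x) /\<^sub>R h - D)) \<longlongrightarrow> 0) (at 0)"
    by (rule tendsto_cong) (use eq in \<open>auto simp: eventually_at_filter intro!: always_eventually\<close>)
  finally show ?thesis
    by (simp add: Lim_null[of _ D] tendsto_norm_zero_iff)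
qed

text \<open>Translation invariance: every difference quotient of F in direction e has integral 0.
  The quotients are bounded by a bound for the derivative and vanish off a common ball, so the limit
  passes under the integral.\<close>

lemma integral_derivative_compact_support:
  fixes F :: "'a::euclidean_space \<Rightarrow> 'b::euclidean_space"
  assumes F: "\<And>y. (F has_derivative F' y) (at y)"
    and cont: "continuous_on UNIV (\<lambda>y. F' y e)"
    and H: "bounded H" and zero: "\<And>y. y \<notin> H \<Longrightarrow> F y = 0"
  shows "(LINT y|lborel. F' y e) = 0"
proof -
  obtain R where R: "H \<subseteq> cball 0 R" "R > 0"
    using H by (auto simp: bounded_pos subset_iff)
  have zero': "F' y e = 0" if "y \<notin> cball 0 R" for y
  proof -
    have "(F has_derivative (\<lambda>_. 0)) (at y)"
      by (rule has_derivative_transform_within_open[of "\<lambda>_. 0" _ _ _ "- cball 0 R"])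
         (use that R zero in \<open>auto simp: open_Compl subset_iff\<close>)
    then show ?thesis
      using has_derivative_unique[OF F[of y]] by metis
  qed
  have "bounded ((\<lambda>y. F' y e) ` cball 0 R)"
    by (intro compact_imp_bounded compact_continuous_image continuous_on_subset[OF cont]) auto
  then obtain L0 where L0: "\<forall>v\<in>(\<lambda>y. F' y e) ` cball 0 R. norm v \<le> L0"
    unfolding bounded_iff by (elim exE)
  define L where "L = max L0 0"
  have L: "norm (F' y e) \<le> L" for y
  proof (cases "y \<in> cball 0 R")
    case True
    with L0 have "norm (F' y e) \<le> L0" by blast
    then show ?thesis by (simp add: L_def)
  qed (simp add: zero' L_def)
  have contF: "continuous_on UNIV F"
    by (rule has_derivative_continuous_on) (rule has_derivative_at_withinI[OF F])
  have Fm[measurable]: "F \<in> borel_measurable borel" "(\<lambda>y. F' y e) \<in> borel_measurable borel"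
    by (rule borel_measurable_continuous_onI[OF contF], rule borel_measurable_continuous_onI[OF cont])
  have intF: "integrable lborel F"
  proof -
    have "set_integrable lborel (cball 0 R) F"
      unfolding set_integrable_def
      by (rule borel_integrable_compact) (auto intro: continuous_on_subset[OF contF])
    moreover have "(\<lambda>x. indicator (cball 0 R) x *\<^sub>R F x) = F"
    proof (rule ext)
      show "indicator (cball 0 R) x *\<^sub>R F x = F x" for x
      proof (cases "x \<in> cball 0 R")
        case False
        with R(1) have "x \<notin> H" by blast
        with False show ?thesis by (simp add: zero)
      qed simp
    qed
    ultimately show ?thesis
      by (simp add: set_integrable_def)
  qed
  define G where "G n y = real (Suc n) *\<^sub>R (F (y + (1 / real (Suc n)) *\<^sub>R e) - F y)" for n y
  \<comment> \<open>The shifts (1 / (n + 1)) e have length at most |e|, hence all quotients vanish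
    outside the ball of radius R + |e|, which gives the dominating function.\<close>
  have "(\<lambda>n. LINT y|lborel. G n y) \<longlonglongrightarrow> (LINT y|lborel. F' y e)"
  proof (rule integral_dominated_convergence[where w = "\<lambda>y. indicator (cball 0 (R + norm e)) y *\<^sub>R L"])
    show "integrable lborel (\<lambda>y. indicator (cball 0 (R + norm e)) y *\<^sub>R L)"
      by (rule borel_integrable_compact) auto
    show "AE y in lborel. (\<lambda>n. G n y) \<longlonglongrightarrow> F' y e"
    proof (rule AE_I2)
      fix y
      have "((\<lambda>s. F (y + s *\<^sub>R e)) has_vector_derivative F' y e) (at 0)"
      proof -
        have "((\<lambda>s::real. F (y + s *\<^sub>R e)) has_derivative (\<lambda>d. F' y (d *\<^sub>R e))) (at 0)"
          by (rule has_derivative_compose[of "\<lambda>s. y + s *\<^sub>R e" _ 0 UNIV F "F' y"])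
             (use F[of y] in \<open>auto intro!: derivative_eq_intros\<close>)
        then show ?thesis
          using has_derivative_linear[OF F[of y]] by (simp add: has_vector_derivative_def linear_scale)
      qed
      then have "((\<lambda>s. (F (y + s *\<^sub>R e) - F y) /\<^sub>R s) \<longlongrightarrow> F' y e) (at 0)"
        by (simp add: has_vector_derivative_at_iff_quotient)
      then have "(\<lambda>n. (F (y + (1 / real (Suc n)) *\<^sub>R e) - F y) /\<^sub>R (1 / real (Suc n))) \<longlonglongrightarrow> F' y e"
        by (rule filterlim_compose)
           (auto simp: filterlim_at LIMSEQ_Suc[OF lim_1_over_n] simp del: of_nat_Suc)
      then show "(\<lambda>n. G n y) \<longlonglongrightarrow> F' y e"
        by (simp add: G_def)
    qed
    show "AE y in lborel. norm (G n y) \<le> indicator (cball 0 (R + norm e)) y *\<^sub>R L" for n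
    proof (rule AE_I2)
      fix y
      let ?h = "1 / real (Suc n)"
      have "norm (F (y + ?h *\<^sub>R e) - F y) \<le> L * ?h"
        by (rule norm_increment_le[where F' = F']) (use F L in auto)
      then have *: "norm (G n y) \<le> L"
        unfolding G_def norm_scaleR by (simp add: pos_le_divide_eq mult.commute del: of_nat_Suc)
      show "norm (G n y) \<le> indicator (cball 0 (R + norm e)) y *\<^sub>R L"
      proof (cases "y \<in> cball 0 (R + norm e)")
        case False
        have "norm (?h *\<^sub>R e) \<le> norm e"
          unfolding norm_scaleR by (rule mult_left_le_one_le) auto
        then have "norm y - norm e \<le> norm (y + ?h *\<^sub>R e)"
          using norm_diff_ineq[of y "?h *\<^sub>R e"] by linarith
        moreover have "norm y > R + norm e"
          using False by simp
        ultimately have "norm (y + ?h *\<^sub>R e) > R" "norm y > R"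
          using norm_ge_zero[of e] by linarith+
        then have "y + ?h *\<^sub>R e \<notin> H" "y \<notin> H"
          using R(1) by (auto simp del: of_nat_Suc)
        then have "G n y = 0"
          by (simp add: G_def zero del: of_nat_Suc)
        then show ?thesis
          using False by simp
      qed (use * in auto)
    qed
  qed (auto simp: G_def)
  moreover have "(LINT y|lborel. G n y) = 0" for n
  proof -
    let ?c = "(1 / real (Suc n)) *\<^sub>R e"
    have d: "distr lborel borel (\<lambda>y. y + ?c) = lborel"
    proof -
      have "(\<lambda>y. y + ?c) = (+) ?c"
        by (rule ext) (rule add.commute)
      then show ?thesis
        using lborel_distr_plus[of ?c] by (simp only:)
    qed
    have "(LINT y|lborel. F (y + ?c)) = (LINT y|distr lborel borel (\<lambda>y. y + ?c). F y)"
      by (rule integral_distr[symmetric]) auto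
    moreover have "integrable lborel (\<lambda>y. F (y + ?c))"
    proof -
      have "integrable (distr lborel borel (\<lambda>y. y + ?c)) F"
        unfolding d by (rule intF)
      then show ?thesis
        by (subst (asm) integrable_distr_eq) auto
    qed
    ultimately show ?thesis
      using intF unfolding G_def d by (simp del: of_nat_Suc)
  qed
  ultimately show ?thesis
    by (simp add: LIMSEQ_const_iff)
qed

text \<open>F extended by zero is differentiable on the whole space: S and the complement of the
  compact set H are open, they cover everything, and the extension vanishes on the second.\<close>

lemma integral_pd_compact_support:
  fixes F :: "real^3 \<Rightarrow> 'b::euclidean_space"
  assumes S: "open S" and H: "compact H" "H \<subseteq> S"
    and zero: "\<And>y. y \<in> S \<Longrightarrow> y \<notin> H \<Longrightarrow> F y = 0"
    and diff: "\<And>y. y \<in> S \<Longrightarrow> F differentiable (at y)"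
    and cont: "continuous_on S (pd i F)"
  shows "(LINT y|lebesgue_on S. pd i F y) = 0"
proof -
  define F0 where "F0 y = (if y \<in> S then F y else 0)" for y
  define F' where "F' y = (if y \<in> S then frechet_derivative F (at y) else (\<lambda>_. 0))" for y
  have op: "open (- H)"
    using H by (simp add: compact_imp_closed open_Compl)
  have z0: "F0 y = 0" if "y \<notin> H" for y
    using zero that by (simp add: F0_def)
  have F0: "(F0 has_derivative F' y) (at y)" for y
  proof (cases "y \<in> S")
    case True
    have "(F has_derivative frechet_derivative F (at y)) (at y)"
      using diff[OF True] frechet_derivative_works by blast
    then show ?thesis
      using has_derivative_transform_within_open[of F _ y UNIV S F0] S True by (simp add: F0_def F'_def)
  next
    case False
    have "((\<lambda>_. 0) has_derivative (\<lambda>_. 0)) (at y)"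
      by simp
    then show ?thesis
      using has_derivative_transform_within_open[of "\<lambda>_. 0" "\<lambda>_. 0" y UNIV "- H" F0] op False H z0
      by (auto simp: F'_def)
  qed
  have pd: "F' y (axis i 1) = (if y \<in> S then pd i F y else 0)" for y
    by (simp add: F'_def pd_def)
  have zd: "F' y (axis i 1) = 0" if "y \<notin> H" for y
  proof -
    have "(F0 has_derivative (\<lambda>_. 0)) (at y)"
      using has_derivative_transform_within_open[of "\<lambda>_. 0" "\<lambda>_. 0" y UNIV "- H" F0] op that z0
      by auto
    then show ?thesis
      using has_derivative_unique[OF F0[of y]] by metis
  qed
  have cont': "continuous_on UNIV (\<lambda>y. F' y (axis i 1))"
  proof -
    have "continuous_on S (\<lambda>y. F' y (axis i 1))"
      using cont by (rule continuous_on_eq) (simp add: pd)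
    moreover have "continuous_on (- H) (\<lambda>y. F' y (axis i 1))"
      by (rule continuous_on_eq[of _ "\<lambda>_. 0"]) (auto simp: zd)
    ultimately have "continuous_on (S \<union> - H) (\<lambda>y. F' y (axis i 1))"
      by (rule continuous_on_open_Un[OF S op])
    then show ?thesis
      using H by (metis Compl_partition2 Un_mono compl_top_eq double_compl subset_antisym subset_refl sup_ge1
          sup_top_right top_greatest Compl_partition)
  qed
  have "(LINT y|lborel. F' y (axis i 1)) = 0"
    by (rule integral_derivative_compact_support[OF F0 cont' compact_imp_bounded[OF H(1)] z0])
  moreover have "(LINT y|lebesgue. F' y (axis i 1)) = (LINT y|lborel. F' y (axis i 1))"
    by (rule integral_completion) (simp add: borel_measurable_continuous_onI[OF cont'])
  moreover have "(LINT y|lebesgue_on S. pd i F y) = (LINT y|lebesgue. indicator S y *\<^sub>R pd i F y)"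
    using S by (subst integral_restrict_space) auto
  moreover have "(\<lambda>y. indicator S y *\<^sub>R pd i F y) = (\<lambda>y. F' y (axis i 1))"
    by (auto simp: pd indicator_def fun_eq_iff)
  ultimately show ?thesis
    by simp
qed

section \<open>The fundamental lemma of the calculus of variations\<close>

lemma tprod_bump_tendsto:
  "(\<lambda>n. tprod (\<lambda>i. bump1 (real n) (a $ i) (b $ i)) x) \<longlonglongrightarrow> indicator (box a b) x"
proof -
  have "(\<lambda>n. tprod (\<lambda>i. bump1 (real n) (a $ i) (b $ i)) x) \<longlonglongrightarrow>
      (\<Prod>i\<in>UNIV. indicator {a $ i<..<b $ i} (x $ i))"
    unfolding tprod_def by (intro tendsto_prod bump1_tendsto)
  moreover have "(\<Prod>i\<in>UNIV. indicator {a $ i<..<b $ i} (x $ i)) = (indicator (box a b) x :: real)"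
    by (auto simp: indicator_def mem_box_cart)
  ultimately show ?thesis
    by metis
qed

lemma tprod_bump_bounds:
  "0 \<le> tprod (\<lambda>i. bump1 n (a $ i) (b $ i)) x" "tprod (\<lambda>i. bump1 n (a $ i) (b $ i)) x \<le> 1"
  unfolding tprod_def
  by (rule prod_nonneg, simp add: bump1_bounds) (rule prod_le_1, simp add: bump1_bounds)

lemma test_function_tprod_bump:
  "n \<ge> 0 \<Longrightarrow> cbox a b \<subseteq> S \<Longrightarrow> test_function S (tprod (\<lambda>i. bump1 n (a $ i) (b $ i)))"
  by (rule test_function_tprod[where lo = a and hi = b], rule smooth1_bump1, rule bump1_eq_0) auto

lemma sigma_finite_lebesgue: "sigma_finite_measure (lebesgue :: 'a::euclidean_space measure)"
proof
  have "(\<Union>n::nat. cball (0::'a) (real n)) = UNIV"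
    using real_arch_simple by auto
  moreover have "emeasure lebesgue (cball (0::'a) (real n)) \<noteq> \<infinity>" for n
    using less_imp_neq[OF emeasure_lborel_cball_finite[of "0::'a" "real n"]] by simp
  ultimately show "\<exists>A::'a set set. countable A \<and> A \<subseteq> sets lebesgue \<and> \<Union> A = space lebesgue \<and> (\<forall>a\<in>A. emeasure lebesgue a \<noteq> \<infinity>)"
    by (intro exI[of _ "range (\<lambda>n::nat. cball (0::'a) (real n))"])
       (auto simp del: emeasure_completion)
qed

text \<open>The sets over which g integrates to 0 form a Dynkin system, the assumption on the whole
  space providing complements. Boxes are stable under intersection and generate the Borel sets, and
  a Lebesgue set differs from a Borel set by a null set.\<close>

lemma zero_of_integral_boxes:
  fixes g :: "real^3 \<Rightarrow> 'b::euclidean_space"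
  assumes g: "integrable lebesgue g"
    and box: "\<And>c d. (LINT x|lebesgue. indicator (box c d) x *\<^sub>R g x) = 0"
    and all: "(LINT x|lebesgue. g x) = 0"
  shows "AE x in lebesgue. g x = 0"
proof -
  have borel: "(LINT x|lebesgue. indicator A x *\<^sub>R g x) = 0" if "A \<in> sets borel" for A
  proof -
    let ?E = "range (\<lambda>(a, b). box a b :: (real^3) set)"
    have A: "A \<in> sigma_sets UNIV ?E"
      using that unfolding borel_eq_box by simp
    have sub: "X \<in> sets lebesgue" if "X \<in> sigma_sets UNIV ?E" for X
      using that borel_eq_box[where 'a = "real^3"]
      by (metis (no_types, lifting) sets_completionI_sets sets_lborel sets_measure_of subset_Pow_Union
          Pow_UNIV subset_UNIV)
    have "Int_stable ?E"
      unfolding Int_stable_def by (auto simp: box_Int_box)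
    moreover have "?E \<subseteq> Pow UNIV"
      by blast
    ultimately show ?thesis
      using A
    proof (induction rule: sigma_sets_induct_disjoint)
      case (basic A)
      then show ?case using box by auto
    next
      case (compl A)
      have "(LINT x|lebesgue. indicator (UNIV - A) x *\<^sub>R g x) = (LINT x|lebesgue. g x - indicator A x *\<^sub>R g x)"
        by (rule Bochner_Integration.integral_cong) (auto simp: indicator_def)
      also have "\<dots> = 0"
        using compl g all sub[OF compl(1)] by (subst Bochner_Integration.integral_diff) (auto intro!: integrable_mult_indicator)
      finally show ?case .
    next
      case (union A)
      have "set_lebesgue_integral lebesgue (\<Union>i. A i) g = (\<Sum>i. set_lebesgue_integral lebesgue (A i) g)"
      proof (rule lebesgue_integral_countable_add)
        show "A i \<in> sets lebesgue" for i
          using sub union by blast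
        then have "(\<Union>i. A i) \<in> sets lebesgue"
          by blast
        then show "set_integrable lebesgue (\<Union>i. A i) g"
          unfolding set_integrable_def by (rule integrable_mult_indicator[OF _ g])
      qed (use union in \<open>auto simp: disjoint_family_on_def\<close>)
      then show ?case
        using union by (simp add: set_lebesgue_integral_def)
    qed auto
  qed
  show ?thesis
  proof (rule sigma_finite_measure.density_zero[OF sigma_finite_lebesgue g])
    fix A :: "(real^3) set"
    assume A: "A \<in> sets lebesgue"
    have "main_part lborel A \<in> sets borel"
      using main_part_sets[OF A] by simp
    moreover have "AE x in lebesgue. x \<in> A \<longleftrightarrow> x \<in> main_part lborel A"
      using main_part_null_part_Un[OF A] null_part[OF A]
      by (intro AE_I'[of "null_part lborel A"]) (auto simp: null_sets_completion_iff2)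
    then have "(LINT x|lebesgue. indicator A x *\<^sub>R g x) = (LINT x|lebesgue. indicator (main_part lborel A) x *\<^sub>R g x)"
      using A g \<open>main_part lborel A \<in> sets borel\<close>
      by (intro integral_cong_AE borel_measurable_scaleR borel_measurable_indicator borel_measurable_integrable)
         (auto simp: indicator_def)
    ultimately show "set_lebesgue_integral lebesgue A g = 0"
      using borel by (simp add: set_lebesgue_integral_def)
  qed
qed

text \<open>Bumps in a box converge to its indicator, so h integrates to 0 over every box with
  closure in S. As h is only locally integrable, \<open>zero_of_integral_boxes\<close> is applied to
  h cut off to one such box at a time.\<close>

lemma fundamental_lemma:
  fixes h :: "real^3 \<Rightarrow> 'b::euclidean_space"
  assumes S: "open S" and h: "loc_integrable S h"
    and test: "\<And>F. (\<And>i. smooth1 (F i)) \<Longrightarrow> test_function S (tprod F) \<Longrightarrow>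
      (LINT x|lebesgue_on S. tprod F x *\<^sub>R h x) = 0"
  shows "AE x in lebesgue_on S. h x = 0"
proof -
  have Slm: "S \<in> sets lebesgue"
    using S by auto
  have box0: "AE x in lebesgue. x \<in> box a b \<longrightarrow> h x = 0" if ab: "cbox a b \<subseteq> S" for a b
  proof -
    define g where "g x = indicator (box a b) x *\<^sub>R h x" for x
    have "integrable lebesgue (\<lambda>x. indicator (cbox a b) x *\<^sub>R h x)"
      using h ab unfolding loc_integrable_def
      by (intro integrable_restrict_space[THEN iffD1]) (auto simp: compact_cbox)
    then have "integrable lebesgue (\<lambda>x. indicator (box a b) x *\<^sub>R (indicator (cbox a b) x *\<^sub>R h x))"
      by (rule integrable_mult_indicator[rotated]) auto
    moreover have "(\<lambda>x. indicator (box a b) x *\<^sub>R (indicator (cbox a b) x *\<^sub>R h x)) = g"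
      using box_subset_cbox[of a b] by (auto simp: g_def indicator_def fun_eq_iff)
    ultimately have g: "integrable lebesgue g"
      by simp
    have *: "(LINT x|lebesgue. indicator (box c d) x *\<^sub>R g x) = 0" if cd: "cbox c d \<subseteq> cbox a b" "box c d \<subseteq> box a b" for c d
    proof -
      let ?f = "\<lambda>n. tprod (\<lambda>i. bump1 (real n) (c $ i) (d $ i))"
      have f0: "?f n x = 0" if "x \<notin> box c d" for n x
      proof -
        obtain i where "x $ i \<notin> {c $ i<..<d $ i}"
          using \<open>x \<notin> box c d\<close> by (auto simp: mem_box_cart)
        then show ?thesis
          by (auto simp: tprod_def intro!: bump1_eq_0)
      qed
      have "(\<lambda>n. LINT x|lebesgue. ?f n x *\<^sub>R g x) \<longlonglongrightarrow> (LINT x|lebesgue. indicator (box c d) x *\<^sub>R g x)"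
      proof (rule integral_dominated_convergence[where w = "\<lambda>x. norm (g x)"])
        show "(\<lambda>x. indicator (box c d) x *\<^sub>R g x) \<in> borel_measurable lebesgue"
          using g by (intro borel_measurable_scaleR borel_measurable_indicator borel_measurable_integrable) auto
        show "(\<lambda>x. ?f n x *\<^sub>R g x) \<in> borel_measurable lebesgue" for n
        proof -
          have "?f n \<in> borel_measurable borel"
            by (intro borel_measurable_continuous_onI continuous_on_tprod smooth1_bump1)
          then show ?thesis
            by (intro borel_measurable_scaleR borel_measurable_integrable[OF g])
               (auto intro: measurable_completion)
        qed
        show "AE x in lebesgue. (\<lambda>n. ?f n x *\<^sub>R g x) \<longlonglongrightarrow> indicator (box c d) x *\<^sub>R g x"
          by (intro AE_I2 tendsto_scaleR tendsto_const tprod_bump_tendsto)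
        show "AE x in lebesgue. norm (?f n x *\<^sub>R g x) \<le> norm (g x)" for n
          using tprod_bump_bounds by (intro AE_I2) (simp add: mult_left_le_one_le)
      qed (use g in auto)
      moreover have "(LINT x|lebesgue. ?f n x *\<^sub>R g x) = 0" for n
      proof -
        have "(LINT x|lebesgue. ?f n x *\<^sub>R g x) = (LINT x|lebesgue. indicator S x *\<^sub>R (?f n x *\<^sub>R h x))"
          using f0[of _ n] cd ab box_subset_cbox[of a b]
          by (intro Bochner_Integration.integral_cong) (auto simp: g_def indicator_def subset_iff)
        also have "\<dots> = (LINT x|lebesgue_on S. ?f n x *\<^sub>R h x)"
          using Slm by (subst integral_restrict_space) auto
        also have "\<dots> = 0"
          using cd ab by (intro test smooth1_bump1 test_function_tprod_bump) auto
        finally show ?thesis .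
      qed
      ultimately show ?thesis
        by (simp add: LIMSEQ_const_iff)
    qed
    have "AE x in lebesgue. g x = 0"
    proof (rule zero_of_integral_boxes[OF g])
      fix c d :: "real^3"
      define c' where "c' = (\<chi> i. max (a $ i) (c $ i))"
      define d' where "d' = (\<chi> i. min (b $ i) (d $ i))"
      have "(LINT x|lebesgue. indicator (box c d) x *\<^sub>R g x) = (LINT x|lebesgue. indicator (box c' d') x *\<^sub>R g x)"
        by (intro Bochner_Integration.integral_cong) (auto simp: g_def indicator_def mem_box_cart c'_def d'_def)
      also have "\<dots> = 0"
        by (rule *) (auto simp: mem_box_cart c'_def d'_def)
      finally show "(LINT x|lebesgue. indicator (box c d) x *\<^sub>R g x) = 0" .
    next
      have "(LINT x|lebesgue. g x) = (LINT x|lebesgue. indicator (box a b) x *\<^sub>R g x)"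
        by (intro Bochner_Integration.integral_cong) (auto simp: g_def indicator_def)
      then show "(LINT x|lebesgue. g x) = 0"
        using *[of a b] by simp
    qed
    then show ?thesis
      by eventually_elim (auto simp: g_def)
  qed
  \<comment> \<open>The faces of a box are negligible, and S is a countable union of closed
    boxes.\<close>
  have cbox0: "AE x in lebesgue. x \<in> cbox a b \<longrightarrow> h x = 0" if ab: "cbox a b \<subseteq> S" for a b
  proof -
    have "AE x in lebesgue. x \<notin> cbox a b - box a b"
      using negligible_frontier_interval[of a b] by (intro AE_not_in) (simp add: negligible_iff_null_sets)
    with box0[OF ab] show ?thesis
      by eventually_elim auto
  qed
  obtain \<D> where D: "countable \<D>" "\<D> \<subseteq> Pow S" "\<And>X. X \<in> \<D> \<Longrightarrow> \<exists>a b. X = cbox a b" "\<Union>\<D> = S"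
    using open_countable_Union_open_cbox[OF S] by metis
  have "AE x in lebesgue. x \<in> X \<longrightarrow> h x = 0" if X: "X \<in> \<D>" for X
  proof -
    obtain a b where "X = cbox a b"
      using D(3)[OF X] by (elim exE)
    with D(2) X show ?thesis
      using cbox0 by blast
  qed
  then have "AE x in lebesgue. \<forall>X\<in>\<D>. x \<in> X \<longrightarrow> h x = 0"
    by (subst AE_ball_countable[OF D(1)]) blast
  then have "AE x in lebesgue. x \<in> S \<longrightarrow> h x = 0"
    by eventually_elim (use D(4) in blast)
  then show ?thesis
    using Slm by (simp add: AE_restrict_space_iff)
qed

section \<open>Differentiation under the integral sign\<close>

lemma integrable_bounded_scaleR:
  fixes g :: "'a \<Rightarrow> 'b::euclidean_space"
  assumes "integrable M g" and "f \<in> borel_measurable M" and "\<And>y. \<bar>f y\<bar> \<le> (L::real)"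
  shows "integrable M (\<lambda>y. f y *\<^sub>R g y)"
proof (rule Bochner_Integration.integrable_bound[where f = "\<lambda>y. L *\<^sub>R g y"])
  show "integrable M (\<lambda>y. L *\<^sub>R g y)"
    using assms(1) by simp
  show "AE y in M. norm (f y *\<^sub>R g y) \<le> norm (L *\<^sub>R g y)"
    using assms(3) by (intro AE_I2) (simp add: mult_right_mono order_trans[OF _ abs_ge_self])
qed (use assms in \<open>auto intro!: borel_measurable_scaleR\<close>)

lemma has_vector_derivative_integral_scaleR:
  fixes g :: "'a \<Rightarrow> 'b::euclidean_space" and f :: "real \<Rightarrow> 'a \<Rightarrow> real"
  assumes g: "integrable M g"
    and meas: "\<And>s. s \<in> {a<..<b} \<Longrightarrow> f s \<in> borel_measurable M" "f' s0 \<in> borel_measurable M"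
    and deriv: "\<And>s y. s \<in> {a<..<b} \<Longrightarrow> ((\<lambda>s. f s y) has_real_derivative f' s y) (at s)"
    and bound: "\<And>s y. s \<in> {a<..<b} \<Longrightarrow> \<bar>f' s y\<bar> \<le> L" "\<And>s y. s \<in> {a<..<b} \<Longrightarrow> \<bar>f s y\<bar> \<le> L'"
    and s0: "s0 \<in> {a<..<b}"
  shows "((\<lambda>s. LINT y|M. f s y *\<^sub>R g y) has_vector_derivative (LINT y|M. f' s0 y *\<^sub>R g y)) (at s0)"
  unfolding has_vector_derivative_at_iff_quotient
proof -
  \<comment> \<open>When s0 + h leaves the interval the quotient is replaced by the derivative at
    s0, so that the bound L holds for every nonzero h and the sequence X below can be
    arbitrary.\<close>
  define q where "q h y = (if s0 + h \<in> {a<..<b} then (f (s0 + h) y - f s0 y) / h else f' s0 y)" for h y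
  have q: "\<bar>q h y\<bar> \<le> L" if "h \<noteq> 0" for h y
  proof (cases "s0 + h \<in> {a<..<b}")
    case True
    have "norm (f (s0 + h) y - f s0 y) \<le> L * norm (s0 + h - s0)"
      by (rule field_differentiable_bound[where S = "{a<..<b}" and f' = "\<lambda>s. f' s y"])
         (use True s0 deriv bound in \<open>auto intro: DERIV_subset has_field_derivative_at_within\<close>)
    then show ?thesis
      using True that by (simp add: q_def abs_divide divide_le_eq)
  qed (use bound s0 in \<open>auto simp: q_def\<close>)
  have int: "integrable M (\<lambda>y. f s y *\<^sub>R g y)" if "s \<in> {a<..<b}" for s
    by (rule integrable_bounded_scaleR[OF g meas(1)[OF that] bound(2)[OF that]])
  have "((\<lambda>h. LINT y|M. q h y *\<^sub>R g y) \<longlongrightarrow> (LINT y|M. f' s0 y *\<^sub>R g y)) (at 0)"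
    unfolding tendsto_at_iff_sequentially
  proof (intro allI impI)
    fix X :: "nat \<Rightarrow> real"
    assume X: "\<forall>i. X i \<in> UNIV - {0}" "X \<longlonglongrightarrow> 0"
    show "((\<lambda>h. LINT y|M. q h y *\<^sub>R g y) \<circ> X) \<longlonglongrightarrow> (LINT y|M. f' s0 y *\<^sub>R g y)"
      unfolding comp_def
    proof (rule integral_dominated_convergence[where w = "\<lambda>y. L * norm (g y)"])
      show "integrable M (\<lambda>y. L * norm (g y))"
        using g by simp
      show "AE y in M. (\<lambda>i. q (X i) y *\<^sub>R g y) \<longlonglongrightarrow> f' s0 y *\<^sub>R g y"
      proof (intro AE_I2 tendsto_scaleR tendsto_const)
        fix y
        have "((\<lambda>h. (f (s0 + h) y - f s0 y) / h) \<longlongrightarrow> f' s0 y) (at 0)"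
          using deriv[OF s0] by (simp add: DERIV_def)
        then have "(\<lambda>i. (f (s0 + X i) y - f s0 y) / X i) \<longlonglongrightarrow> f' s0 y"
          by (rule filterlim_compose) (use X in \<open>auto simp: filterlim_at\<close>)
        moreover have "(\<lambda>i. s0 + X i) \<longlonglongrightarrow> s0 + 0"
          by (intro tendsto_intros X)
        then have "\<forall>\<^sub>F i in sequentially. s0 + X i \<in> {a<..<b}"
          using s0 by (intro topological_tendstoD) auto
        then have "\<forall>\<^sub>F i in sequentially. (f (s0 + X i) y - f s0 y) / X i = q (X i) y"
          by eventually_elim (simp add: q_def)
        ultimately show "(\<lambda>i. q (X i) y) \<longlonglongrightarrow> f' s0 y"
          by (rule Lim_transform_eventually)
      qed
      show "AE y in M. norm (q (X i) y *\<^sub>R g y) \<le> L * norm (g y)" for i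
        using q[of "X i"] X(1) by (intro AE_I2) (auto intro!: mult_right_mono)
      show "(\<lambda>y. q (X i) y *\<^sub>R g y) \<in> borel_measurable M" for i
      proof -
        have "q (X i) \<in> borel_measurable M"
          unfolding q_def[abs_def] using meas s0 by (cases "s0 + X i \<in> {a<..<b}") (simp_all del: greaterThanLessThan_iff)
        then show ?thesis
          using g by (intro borel_measurable_scaleR) auto
      qed
    qed (use g meas in \<open>auto intro!: borel_measurable_scaleR\<close>)
  qed
  then show "((\<lambda>h. ((LINT y|M. f (s0 + h) y *\<^sub>R g y) - (LINT y|M. f s0 y *\<^sub>R g y)) /\<^sub>R h) \<longlongrightarrow>
      (LINT y|M. f' s0 y *\<^sub>R g y)) (at 0)"
  proof (rule Lim_transform_eventually)
    have "\<forall>\<^sub>F h in at 0. h \<in> {a - s0<..<b - s0}"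
      using s0 by (intro eventually_at_in_open') auto
    then have "\<forall>\<^sub>F h in at 0. s0 + h \<in> {a<..<b}"
      by eventually_elim auto
    then show "\<forall>\<^sub>F h in at 0. (LINT y|M. q h y *\<^sub>R g y) =
        ((LINT y|M. f (s0 + h) y *\<^sub>R g y) - (LINT y|M. f s0 y *\<^sub>R g y)) /\<^sub>R h"
    proof eventually_elim
      case (elim h)
      have "(LINT y|M. q h y *\<^sub>R g y) = (LINT y|M. (f (s0 + h) y *\<^sub>R g y - f s0 y *\<^sub>R g y) /\<^sub>R h)"
        using elim by (intro Bochner_Integration.integral_cong)
          (auto simp: q_def divide_inverse scaleR_diff_left[symmetric] mult.commute)
      then show ?case
        using int[OF elim] int[OF s0] by simp
    qed
  qed
qed

section \<open>Smearing along star-shaped boxes\<close>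

text \<open>The product of the bumps k contracted towards x by the factor s and divided by s^3, see
  \<open>kern_alt\<close>. Distributing the contraction and one 1/s to each coordinate keeps it a
  tensor product.\<close>

definition kern :: "(3 \<Rightarrow> real \<Rightarrow> real) \<Rightarrow> real^3 \<Rightarrow> real \<Rightarrow> real^3 \<Rightarrow> real" where
  "kern k x s = tprod (\<lambda>i t. k i (x $ i + (t - x $ i) / s) / s)"

text \<open>Multiplies the tensor product by the coordinate y_i - x_i; the factor is absorbed into
  the i-th function so that a tensor product results.\<close>

definition kmul :: "real^3 \<Rightarrow> 3 \<Rightarrow> (3 \<Rightarrow> real \<Rightarrow> real) \<Rightarrow> 3 \<Rightarrow> real \<Rightarrow> real" where
  "kmul x i k = k(i := \<lambda>w. (w - x $ i) * k i w)"

definition bump_family :: "real^3 \<Rightarrow> real^3 \<Rightarrow> real \<Rightarrow> (3 \<Rightarrow> real \<Rightarrow> real) \<Rightarrow> bool" where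
  "bump_family lo hi B k \<longleftrightarrow> (\<forall>i. smooth1 (k i)) \<and> (\<forall>i t. t \<notin> {lo $ i..hi $ i} \<longrightarrow> k i t = 0) \<and>
     (\<forall>y. \<bar>tprod k y\<bar> \<le> B)"

text \<open>s = 1 puts the box itself inside S, while s = 0 is left out, so that x may a priori be
  any point.\<close>

definition star_box :: "(real^3) set \<Rightarrow> real^3 \<Rightarrow> real^3 \<Rightarrow> real^3 \<Rightarrow> bool" where
  "star_box S x lo hi \<longleftrightarrow> (\<forall>i. lo $ i < hi $ i) \<and> (\<forall>s. 0 < s \<and> s \<le> 1 \<longrightarrow> (\<forall>y\<in>cbox lo hi. x + s *\<^sub>R (y - x) \<in> S))"

text \<open>Tests only with tensor products, because all kernels are of this form.\<close>

definition weak_partial ::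
  "(real^3) set \<Rightarrow> 3 \<Rightarrow> (real^3 \<Rightarrow> 'b::euclidean_space) \<Rightarrow> (real^3 \<Rightarrow> 'b) \<Rightarrow> bool" where
  "weak_partial S i f g \<longleftrightarrow> (\<forall>F. (\<forall>j. smooth1 (F j)) \<and> test_function S (tprod F) \<longrightarrow>
     (LINT y|lebesgue_on S. pd i (tprod F) y *\<^sub>R f y) = - (LINT y|lebesgue_on S. tprod F y *\<^sub>R g y))"

definition smear ::
  "(real^3) set \<Rightarrow> (3 \<Rightarrow> real \<Rightarrow> real) \<Rightarrow> real^3 \<Rightarrow> real \<Rightarrow> (real^3 \<Rightarrow> 'b::euclidean_space) \<Rightarrow> 'b" where
  "smear S k x s g = (LINT y|lebesgue_on S. kern k x s y *\<^sub>R g y)"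

section \<open>Contracted kernels as test functions\<close>

lemma smooth1_kern_factor: "smooth1 k \<Longrightarrow> smooth1 (\<lambda>t. k (c + (t - c) / s) / s)"
proof -
  assume "smooth1 k"
  then have "smooth1 (\<lambda>t. k ((1 / s) * t + (c - c / s)) * (1 / s))"
    by (intro smooth1_mult smooth1_const smooth1_affine)
  moreover have "(\<lambda>t. k ((1 / s) * t + (c - c / s)) * (1 / s)) = (\<lambda>t. k (c + (t - c) / s) / s)"
  proof (rule ext)
    fix t
    have "(1 / s) * t + (c - c / s) = c + (t - c) / s"
      by (simp add: diff_divide_distrib)
    then show "k ((1 / s) * t + (c - c / s)) * (1 / s) = k (c + (t - c) / s) / s"
      by (simp only: mult_1_right times_divide_eq_right)
  qed
  ultimately show ?thesis
    by (simp only:)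
qed

lemma smooth1_kmul: "(\<And>j. smooth1 (k j)) \<Longrightarrow> smooth1 (kmul x i k j)"
proof -
  assume "\<And>j. smooth1 (k j)"
  moreover have "smooth1 (\<lambda>w. 1 * w + (- x $ i))"
    by (rule smooth1_affine[OF smooth1_id])
  then have "smooth1 (\<lambda>w. w - x $ i)"
    by simp
  ultimately show ?thesis
    by (auto simp: kmul_def intro: smooth1_mult)
qed

lemma tprod_kmul: "tprod (kmul x i k) y = (y $ i - x $ i) * tprod k y"
  using exhaust_3[of i] by (auto simp: tprod_alt kmul_def)

lemma bump_family_kmul:
  assumes "bump_family lo hi B k" and "\<And>y. y \<in> cbox lo hi \<Longrightarrow> \<bar>y $ i - x $ i\<bar> \<le> d" and "B \<ge> 0" "d \<ge> 0"
  shows "bump_family lo hi (d * B) (kmul x i k)"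
  unfolding bump_family_def
proof (intro conjI allI impI)
  show "smooth1 (kmul x i k j)" for j
    using assms(1) by (intro smooth1_kmul) (simp add: bump_family_def)
  show "kmul x i k j t = 0" if "t \<notin> {lo $ j..hi $ j}" for j t
  proof -
    have "k j t = 0"
      using assms(1) that unfolding bump_family_def by blast
    then show ?thesis
      by (auto simp: kmul_def)
  qed
  show "\<bar>tprod (kmul x i k) y\<bar> \<le> d * B" for y
  proof (cases "y \<in> cbox lo hi")
    case True
    then show ?thesis
      using assms by (auto simp: tprod_kmul abs_mult bump_family_def intro!: mult_mono)
  next
    case False
    then obtain j where "y $ j \<notin> {lo $ j..hi $ j}"
      by (auto simp: mem_box_cart)
    then have "k j (y $ j) = 0"
      using assms(1) unfolding bump_family_def by blast
    then have "tprod k y = 0"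
      by (auto simp: tprod_def)
    then show ?thesis
      using assms by (simp add: tprod_kmul)
  qed
qed

lemma kern_alt: "kern k x s y = tprod k (x + (y - x) /\<^sub>R s) / s ^ 3"
  by (simp add: kern_def tprod_alt power3_eq_cube divide_inverse algebra_simps)

lemma kern_one: "kern k x 1 = tprod k"
  by (simp add: kern_def)

lemma mem_scaled_cbox_iff:
  fixes x y lo hi :: "real^3"
  assumes "s > 0"
  shows "y \<in> cbox (x + s *\<^sub>R (lo - x)) (x + s *\<^sub>R (hi - x)) \<longleftrightarrow> x + (y - x) /\<^sub>R s \<in> cbox lo hi"
proof -
  have "x $ i + s * (lo $ i - x $ i) \<le> y $ i \<longleftrightarrow> lo $ i \<le> x $ i + (y $ i - x $ i) / s"
       "y $ i \<le> x $ i + s * (hi $ i - x $ i) \<longleftrightarrow> x $ i + (y $ i - x $ i) / s \<le> hi $ i" for i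
    using assms by (auto simp: field_simps)
  then show ?thesis
    by (simp add: mem_box_cart divide_inverse mult.commute)
qed

lemma tprod_bump_family_eq_0: "bump_family lo hi B k \<Longrightarrow> y \<notin> cbox lo hi \<Longrightarrow> tprod k y = 0"
  by (force simp: bump_family_def mem_box_cart tprod_def)

lemma kern_bound:
  assumes "bump_family lo hi B k" "s > 0"
  shows "\<bar>kern k x s y\<bar> \<le> B / s ^ 3 * indicator (cbox (x + s *\<^sub>R (lo - x)) (x + s *\<^sub>R (hi - x))) y"
proof (cases "y \<in> cbox (x + s *\<^sub>R (lo - x)) (x + s *\<^sub>R (hi - x))")
  case True
  then show ?thesis
    using assms by (simp add: kern_alt abs_divide divide_right_mono bump_family_def)
next
  case False
  then have "x + (y - x) /\<^sub>R s \<notin> cbox lo hi"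
    using mem_scaled_cbox_iff[OF assms(2)] by blast
  then show ?thesis
    using tprod_bump_family_eq_0[OF assms(1)] False by (simp add: kern_alt)
qed

lemma star_box_subset:
  assumes "star_box S x lo hi" "0 < s" "s \<le> 1"
  shows "cbox (x + s *\<^sub>R (lo - x)) (x + s *\<^sub>R (hi - x)) \<subseteq> S"
proof
  fix y assume "y \<in> cbox (x + s *\<^sub>R (lo - x)) (x + s *\<^sub>R (hi - x))"
  then have "x + (y - x) /\<^sub>R s \<in> cbox lo hi"
    using mem_scaled_cbox_iff[OF assms(2)] by blast
  then have "x + s *\<^sub>R (x + (y - x) /\<^sub>R s - x) \<in> S"
    using assms unfolding star_box_def by blast
  moreover have "s *\<^sub>R ((y - x) /\<^sub>R s) = y - x"
    using assms by simp
  ultimately show "y \<in> S"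
    by (simp only: add_diff_cancel_left') simp
qed

lemma test_function_kern:
  assumes "bump_family lo hi B k" "star_box S x lo hi" "0 < s" "s \<le> 1"
  shows "test_function S (kern k x s)"
  unfolding kern_def
proof (rule test_function_tprod)
  show "smooth1 (\<lambda>t. k i (x $ i + (t - x $ i) / s) / s)" for i
    using assms(1) by (intro smooth1_kern_factor) (simp add: bump_family_def)
  show "cbox (x + s *\<^sub>R (lo - x)) (x + s *\<^sub>R (hi - x)) \<subseteq> S"
    by (rule star_box_subset[OF assms(2-4)])
  show "k i (x $ i + (t - x $ i) / s) / s = 0"
    if "t \<notin> {(x + s *\<^sub>R (lo - x)) $ i..(x + s *\<^sub>R (hi - x)) $ i}" for i t
  proof -
    have "x $ i + (t - x $ i) / s \<notin> {lo $ i..hi $ i}"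
      using that assms(3) by (auto simp: field_simps)
    then show ?thesis
      using assms(1) unfolding bump_family_def by simp
  qed
qed

section \<open>The kernel as a function of the scale\<close>

lemma deriv_compact_support:
  assumes "\<And>t. t \<notin> {a..b} \<Longrightarrow> f t = (0::real)" "t \<notin> {a..b}"
  shows "deriv f t = 0"
proof -
  have "(f has_real_derivative 0) (at t)"
    using assms by (intro has_field_derivative_transform_within_open[OF DERIV_const[of 0], of "- {a..b}"])
      (auto simp: open_Compl)
  then show ?thesis
    by (rule DERIV_imp_deriv)
qed

lemma smooth1_compact_support_bounded:
  assumes "smooth1 f" "\<And>t. t \<notin> {a..b} \<Longrightarrow> f t = 0"
  obtains C where "C \<ge> 0" "\<And>t. \<bar>f t\<bar> \<le> C"
proof -
  have "bounded (f ` {a..b})"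
    by (intro compact_imp_bounded compact_continuous_image smooth1_continuous assms) auto
  then obtain C where C: "\<forall>v\<in>f ` {a..b}. norm v \<le> C"
    unfolding bounded_iff by (elim exE)
  have "\<bar>f t\<bar> \<le> max C 0" for t
  proof (cases "t \<in> {a..b}")
    case True
    with C have "norm (f t) \<le> C" by blast
    then show ?thesis by simp
  qed (simp add: assms(2))
  then show thesis
    using that[of "max C 0"] by simp
qed

text \<open>Right side of the continuity equation in the variable s: the contraction moves points
  with velocity (y - x) / s, and the kernel of \<open>kmul x i k\<close> is the i-th component of
  velocity times density.\<close>

definition kern_ds :: "(3 \<Rightarrow> real \<Rightarrow> real) \<Rightarrow> real^3 \<Rightarrow> real \<Rightarrow> real^3 \<Rightarrow> real" where
  "kern_ds k x s y = - (\<Sum>i\<in>UNIV. pd i (kern (kmul x i k) x s) y)"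

lemma pd_kern_kmul:
  assumes k: "\<And>i. smooth1 (k i)" and s: "s > 0"
  shows "pd i (kern (kmul x i k) x s) y =
    tprod ((\<lambda>j t. k j (x $ j + (t - x $ j) / s) / s)
      (i := \<lambda>t. deriv (\<lambda>w. (w - x $ i) * k i w) (x $ i + (t - x $ i) / s) / s\<^sup>2)) y"
proof -
  let ?G = "\<lambda>j t. kmul x i k j (x $ j + (t - x $ j) / s) / s"
  have "smooth1 (?G j)" for j
    by (intro smooth1_kern_factor smooth1_kmul k)
  then have "pd i (kern (kmul x i k) x s) = tprod (?G(i := deriv (?G i)))"
    unfolding kern_def by (rule pd_tprod)
  moreover have dG: "deriv (?G i) t = deriv (\<lambda>w. (w - x $ i) * k i w) (x $ i + (t - x $ i) / s) / s\<^sup>2" for t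
  proof -
    have sm: "smooth1 (\<lambda>w. (w - x $ i) * k i w)"
      using smooth1_kmul[of k x i i] k by (simp add: kmul_def)
    have "((\<lambda>t. (\<lambda>w. (w - x $ i) * k i w) (x $ i + (t - x $ i) / s) / s) has_real_derivative
        deriv (\<lambda>w. (w - x $ i) * k i w) (x $ i + (t - x $ i) / s) * (1 / s) / s) (at t)"
      by (intro DERIV_cdivide DERIV_chain2[OF smooth1_has_deriv[OF sm]])
         (use s in \<open>auto intro!: derivative_eq_intros\<close>)
    then show ?thesis
      by (intro DERIV_imp_deriv) (simp add: kmul_def power2_eq_square)
  qed
  moreover have "?G j = (\<lambda>t. k j (x $ j + (t - x $ j) / s) / s)" if "j \<noteq> i" for j
    using that by (simp add: kmul_def)
  then have "?G(i := deriv (?G i)) = (\<lambda>j t. k j (x $ j + (t - x $ j) / s) / s)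
      (i := \<lambda>t. deriv (\<lambda>w. (w - x $ i) * k i w) (x $ i + (t - x $ i) / s) / s\<^sup>2)"
    using dG by (intro ext) (simp add: fun_upd_def)
  ultimately show ?thesis
    by simp
qed

text \<open>Each of the three factors obeys a continuity equation on the line: its s-derivative is
  minus the t-derivative of itself times (t - x_i) / s. The product rule adds these up.\<close>

lemma kern_has_derivative:
  assumes k: "\<And>i. smooth1 (k i)" and s: "s > 0"
  shows "((\<lambda>s. kern k x s y) has_real_derivative kern_ds k x s y) (at s)"
proof -
  let ?p = "\<lambda>i s. k i (x $ i + (y $ i - x $ i) / s) / s"
  let ?p' = "\<lambda>i. - deriv (\<lambda>w. (w - x $ i) * k i w) (x $ i + (y $ i - x $ i) / s) / s\<^sup>2"
  have d: "((\<lambda>s. ?p i s) has_real_derivative ?p' i) (at s)" for i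
  proof -
    let ?w = "x $ i + (y $ i - x $ i) / s"
    have "((\<lambda>w. (w - x $ i) * k i w) has_real_derivative (k i ?w + (?w - x $ i) * deriv (k i) ?w)) (at ?w)"
      by (auto intro!: derivative_eq_intros smooth1_has_deriv k)
    then have "deriv (\<lambda>w. (w - x $ i) * k i w) ?w = k i ?w + (?w - x $ i) * deriv (k i) ?w"
      by (rule DERIV_imp_deriv)
    moreover have "((\<lambda>s. k i (x $ i + (y $ i - x $ i) / s)) has_real_derivative
        deriv (k i) ?w * (- (y $ i - x $ i) / s\<^sup>2)) (at s)"
      by (rule DERIV_chain2[OF smooth1_has_deriv[OF k]])
         (use s in \<open>auto intro!: derivative_eq_intros simp: power2_eq_square\<close>)
    then have "((\<lambda>s. ?p i s) has_real_derivative
        (deriv (k i) ?w * (- (y $ i - x $ i) / s\<^sup>2) * s - k i ?w * 1) / (s * s)) (at s)"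
      using s by (intro DERIV_divide DERIV_ident) auto
    moreover have "(b * (- c / s\<^sup>2) * s - a * 1) / (s * s) = - (a + (x $ i + c / s - x $ i) * b) / s\<^sup>2" for a b c
      using s by (simp add: field_simps power2_eq_square)
    ultimately show ?thesis
      by (simp only:)
  qed
  have "((\<lambda>s. ?p 1 s * ?p 2 s * ?p 3 s) has_real_derivative
      ((?p' 1 * ?p 2 s + ?p' 2 * ?p 1 s) * ?p 3 s + ?p' 3 * (?p 1 s * ?p 2 s))) (at s)"
    by (intro DERIV_mult d)
  moreover have "(?p' 1 * ?p 2 s + ?p' 2 * ?p 1 s) * ?p 3 s + ?p' 3 * (?p 1 s * ?p 2 s) = kern_ds k x s y"
    unfolding kern_ds_def sum_3 pd_kern_kmul[of k, OF k s] tprod_alt fun_upd_apply by (simp add: algebra_simps)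
  ultimately show ?thesis
    by (simp add: kern_def tprod_alt)
qed

text \<open>The factors scale like 1/s and the differentiated one like 1/s^2, so the bound is
  uniform only away from s = 0. It provides the domination for differentiating averages.\<close>

lemma kern_ds_bounded:
  assumes k: "bump_family lo hi B k" and a: "a > 0"
  obtains L where "\<And>s y. s > a \<Longrightarrow> \<bar>kern_ds k x s y\<bar> \<le> L"
proof -
  have sm: "smooth1 (k i)" for i
    using k by (simp add: bump_family_def)
  have supp: "k i t = 0" if "t \<notin> {lo $ i..hi $ i}" for i t
    using k that unfolding bump_family_def by blast
  have "\<exists>C\<ge>0. \<forall>t. \<bar>k i t\<bar> \<le> C" for i
    by (rule smooth1_compact_support_bounded[OF sm[of i] supp[of _ i]]) blast+
  then obtain C where C: "\<And>i. C i \<ge> 0" "\<And>i t. \<bar>k i t\<bar> \<le> C i"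
    by metis
  have "\<exists>C\<ge>0. \<forall>t. \<bar>deriv (\<lambda>w. (w - x $ i) * k i w) t\<bar> \<le> C" for i
  proof -
    have "smooth1 (deriv (\<lambda>w. (w - x $ i) * k i w))"
      using smooth1_kmul[of k x i i] sm by (intro smooth1_deriv) (simp add: kmul_def)
    moreover have "deriv (\<lambda>w. (w - x $ i) * k i w) t = 0" if "t \<notin> {lo $ i..hi $ i}" for t
      by (rule deriv_compact_support[OF _ that]) (simp add: supp)
    ultimately show ?thesis
      by (rule smooth1_compact_support_bounded) blast+
  qed
  then obtain C' where C': "\<And>i. C' i \<ge> 0" "\<And>i t. \<bar>deriv (\<lambda>w. (w - x $ i) * k i w) t\<bar> \<le> C' i"
    by metis
  define D where "D i j = (if j = i then C' j / a\<^sup>2 else C j / a)" for i j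
  have "\<bar>pd i (kern (kmul x i k) x s) y\<bar> \<le> (\<Prod>j\<in>UNIV. D i j)" if s: "s > a" for i s y
  proof -
    have "\<bar>tprod ((\<lambda>j t. k j (x $ j + (t - x $ j) / s) / s)
      (i := \<lambda>t. deriv (\<lambda>w. (w - x $ i) * k i w) (x $ i + (t - x $ i) / s) / s\<^sup>2)) y\<bar> \<le> (\<Prod>j\<in>UNIV. D i j)"
      unfolding tprod_def abs_prod
    proof (rule prod_mono, intro conjI)
      fix j :: 3
      have *: "c / s \<le> c / a" "c / s\<^sup>2 \<le> c / a\<^sup>2" if "c \<ge> 0" for c
        using that s a by (auto intro!: divide_left_mono power_mono mult_pos_pos)
      show "\<bar>((\<lambda>j t. k j (x $ j + (t - x $ j) / s) / s)
          (i := \<lambda>t. deriv (\<lambda>w. (w - x $ i) * k i w) (x $ i + (t - x $ i) / s) / s\<^sup>2)) j (y $ j)\<bar> \<le> D i j"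
      proof (cases "j = i")
        case True
        then show ?thesis
          using order_trans[OF divide_right_mono[OF C'(2)[of i "x $ i + (y $ i - x $ i) / s"]
                zero_le_power2[of s]] *(2)[OF C'(1)[of i]]]
          by (simp add: D_def abs_divide)
      next
        case False
        then show ?thesis
          using order_trans[OF divide_right_mono[OF C(2)[of j "x $ j + (y $ j - x $ j) / s"], of s]
              *(1)[OF C(1)[of j]]] s a
          by (simp add: D_def abs_divide)
      qed
    qed simp
    then show ?thesis
      using s a by (subst pd_kern_kmul[of k, OF sm]) auto
  qed
  then have "\<bar>kern_ds k x s y\<bar> \<le> (\<Sum>i\<in>UNIV. \<Prod>j\<in>UNIV. D i j)" if "s > a" for s y
    using that unfolding kern_ds_def abs_minus by (intro order_trans[OF sum_abs] sum_mono)
  then show thesis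
    using that by blast
qed

lemma bump_family_smooth1: "bump_family lo hi B k \<Longrightarrow> smooth1 (k i)"
  by (simp add: bump_family_def)

lemma kern_measurable:
  assumes "bump_family lo hi B k"
  shows "kern k x s \<in> borel_measurable (lebesgue_on S)"
proof -
  have "kern k x s \<in> borel_measurable borel"
    unfolding kern_def
    by (intro borel_measurable_continuous_onI continuous_on_tprod smooth1_kern_factor bump_family_smooth1[OF assms])
  then show ?thesis
    by (intro measurable_restrict_space1) (auto intro: measurable_completion)
qed

lemma kern_ds_measurable:
  assumes "bump_family lo hi B k" "s > 0"
  shows "kern_ds k x s \<in> borel_measurable (lebesgue_on S)"
proof -
  have "(\<lambda>y. pd i (kern (kmul x i k) x s) y) \<in> borel_measurable borel" for i
    unfolding kern_def
    by (subst pd_tprod, intro smooth1_kern_factor smooth1_kmul bump_family_smooth1[OF assms(1)],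
        intro borel_measurable_continuous_onI continuous_on_tprod)
       (auto intro!: smooth1_deriv smooth1_kern_factor smooth1_kmul bump_family_smooth1[OF assms(1)])
  then have "kern_ds k x s \<in> borel_measurable borel"
    unfolding kern_ds_def[abs_def] by (intro borel_measurable_uminus borel_measurable_sum)
  then show ?thesis
    by (intro measurable_restrict_space1) (auto intro: measurable_completion)
qed

lemma kern_abs_le:
  assumes "bump_family lo hi B k" "s > 0" "B \<ge> 0"
  shows "\<bar>kern k x s y\<bar> \<le> B / s ^ 3"
  by (rule order_trans[OF kern_bound[OF assms(1,2)]]) (use assms in \<open>auto simp: indicator_def\<close>)

lemma smear_integrable:
  fixes g :: "real^3 \<Rightarrow> 'b::euclidean_space"
  assumes "bump_family lo hi B k" "s > 0" "integrable (lebesgue_on S) g" "B \<ge> 0"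
  shows "integrable (lebesgue_on S) (\<lambda>y. kern k x s y *\<^sub>R g y)"
proof (rule integrable_bounded_scaleR[OF assms(3) kern_measurable[OF assms(1)]])
  show "\<bar>kern k x s y\<bar> \<le> B / s ^ 3" for y
    by (rule kern_abs_le[OF assms(1,2,4)])
qed

lemma kern_ds_integrable:
  fixes g :: "real^3 \<Rightarrow> 'b::euclidean_space"
  assumes k: "bump_family lo hi B k" and "s > 0" and g: "integrable (lebesgue_on S) g"
  shows "integrable (lebesgue_on S) (\<lambda>y. pd i (kern (kmul x i k) x s) y *\<^sub>R g y)"
    and "(LINT y|lebesgue_on S. kern_ds k x s y *\<^sub>R g y) =
      - (\<Sum>i\<in>UNIV. LINT y|lebesgue_on S. pd i (kern (kmul x i k) x s) y *\<^sub>R g y)"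
proof -
  show *: "integrable (lebesgue_on S) (\<lambda>y. pd i (kern (kmul x i k) x s) y *\<^sub>R g y)" for i
  proof -
    let ?F = "(\<lambda>j t. kmul x i k j (x $ j + (t - x $ j) / s) / s)"
    have sm: "smooth1 (?F j)" for j
      by (intro smooth1_kern_factor smooth1_kmul bump_family_smooth1[OF k])
    have sm': "smooth1 ((?F(i := deriv (?F i))) j)" for j
      using sm[of j] smooth1_deriv[OF sm[of i]] by simp
    have eq: "pd i (kern (kmul x i k) x s) = tprod (?F(i := deriv (?F i)))"
      unfolding kern_def by (rule pd_tprod[OF sm])
    have supp: "?F j t = 0"
      if "t \<notin> {(x + s *\<^sub>R (lo - x)) $ j..(x + s *\<^sub>R (hi - x)) $ j}" for j t
    proof -
      have "x $ j + (t - x $ j) / s \<notin> {lo $ j..hi $ j}"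
        using that assms(2) by (auto simp: field_simps)
      then have "k j (x $ j + (t - x $ j) / s) = 0"
        using k unfolding bump_family_def by blast
      then show ?thesis
        by (cases "j = i") (auto simp: kmul_def)
    qed
    have supp': "(?F(i := deriv (?F i))) j t = 0"
      if "t \<notin> {(x + s *\<^sub>R (lo - x)) $ j..(x + s *\<^sub>R (hi - x)) $ j}" for j t
      using supp[OF that] deriv_compact_support[OF supp that] by (cases "j = i") auto
    define G where "G = ?F(i := deriv (?F i))"
    have "\<exists>C\<ge>0. \<forall>t. \<bar>G j t\<bar> \<le> C" for j
      unfolding G_def by (rule smooth1_compact_support_bounded[OF sm'[of j] supp'[of _ j]]) blast+
    then obtain C where C: "\<And>j t. \<bar>G j t\<bar> \<le> C j"
      by metis
    have "\<bar>tprod G y\<bar> \<le> (\<Prod>j\<in>UNIV. C j)" for y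
      unfolding tprod_def abs_prod by (rule prod_mono) (use C in auto)
    moreover have "tprod G \<in> borel_measurable borel"
      unfolding G_def by (intro borel_measurable_continuous_onI continuous_on_tprod sm')
    then have "tprod G \<in> borel_measurable (lebesgue_on S)"
      by (intro measurable_restrict_space1) (auto intro: measurable_completion)
    ultimately show ?thesis
      unfolding eq G_def[symmetric] by (intro integrable_bounded_scaleR[OF g])
  qed
  show "(LINT y|lebesgue_on S. kern_ds k x s y *\<^sub>R g y) =
      - (\<Sum>i\<in>UNIV. LINT y|lebesgue_on S. pd i (kern (kmul x i k) x s) y *\<^sub>R g y)"
    unfolding kern_ds_def scaleR_minus_left scaleR_sum_left
    using * by (subst integral_minus, subst Bochner_Integration.integral_sum) auto
qed

lemma smear_has_derivative:
  assumes k: "bump_family lo hi B k" "B \<ge> 0" and g: "integrable (lebesgue_on S) g" and s: "s > 0"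
  shows "((\<lambda>s. smear S k x s g) has_vector_derivative (LINT y|lebesgue_on S. kern_ds k x s y *\<^sub>R g y)) (at s)"
proof -
  \<comment> \<open>The window from s / 2 to s + 1 contains s and stays away from scale 0, where the
    bounds degenerate.\<close>
  obtain L where L: "\<And>r y. r > s / 2 \<Longrightarrow> \<bar>kern_ds k x r y\<bar> \<le> L"
    using kern_ds_bounded[OF k(1), of "s / 2" x] s by auto
  show ?thesis
    unfolding smear_def
  proof (rule has_vector_derivative_integral_scaleR[where a = "s / 2" and b = "s + 1" and L = L and L' = "B / (s / 2) ^ 3", OF g])
    fix r y assume "r \<in> {s / 2<..<s + 1}"
    then have r: "r > s / 2" by simp
    then have "r > 0" using s by linarith
    show "kern k x r \<in> borel_measurable (lebesgue_on S)"
      by (rule kern_measurable[OF k(1)])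
    show "((\<lambda>s. kern k x s y) has_real_derivative kern_ds k x r y) (at r)"
      by (rule kern_has_derivative[OF bump_family_smooth1[OF k(1)] \<open>r > 0\<close>])
    show "\<bar>kern_ds k x r y\<bar> \<le> L"
      by (rule L[OF r])
    have "\<bar>kern k x r y\<bar> \<le> B / r ^ 3"
      by (rule kern_abs_le[OF k(1) \<open>r > 0\<close> k(2)])
    also have "\<dots> \<le> B / (s / 2) ^ 3"
      using r s k(2) \<open>r > 0\<close> by (intro divide_left_mono power_mono mult_pos_pos) auto
    finally show "\<bar>kern k x r y\<bar> \<le> B / (s / 2) ^ 3" .
  qed (use s kern_ds_measurable[OF k(1)] in auto)
qed

text \<open>For 0 < s <= 1 the kernel of \<open>kmul x i k\<close> is a test function in S, so the
  divergence in \<open>kern_ds\<close> can be moved onto g. The two minus signs cancel.\<close>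

lemma smear_has_derivative_weak:
  assumes k: "bump_family lo hi B k" "B \<ge> 0" and g: "integrable (lebesgue_on S) g" and s: "0 < s" "s \<le> 1"
    and star: "star_box S x lo hi" and w: "\<And>i. weak_partial S i g (g' i)"
  shows "((\<lambda>s. smear S k x s g) has_vector_derivative (\<Sum>i\<in>UNIV. smear S (kmul x i k) x s (g' i))) (at s)"
proof -
  have "(LINT y|lebesgue_on S. pd i (kern (kmul x i k) x s) y *\<^sub>R g y) = - smear S (kmul x i k) x s (g' i)" for i
  proof -
    have "bounded (cbox lo hi)"
      by simp
    then obtain d where d: "\<And>y. y \<in> cbox lo hi \<Longrightarrow> norm y \<le> d"
      unfolding bounded_iff by (elim exE) blast
    have "\<bar>y $ i - x $ i\<bar> \<le> max 0 (d + norm x)" if "y \<in> cbox lo hi" for y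
      using d[OF that] component_le_norm_cart[of y i] component_le_norm_cart[of x i] by linarith
    then have "bump_family lo hi (max 0 (d + norm x) * B) (kmul x i k)"
      by (intro bump_family_kmul k) auto
    then have "test_function S (kern (kmul x i k) x s)"
      by (rule test_function_kern[OF _ star s])
    then show ?thesis
      using w[of i] unfolding weak_partial_def kern_def smear_def
      by (simp add: smooth1_kern_factor smooth1_kmul bump_family_smooth1[OF k(1)])
  qed
  then have "(LINT y|lebesgue_on S. kern_ds k x s y *\<^sub>R g y) = (\<Sum>i\<in>UNIV. smear S (kmul x i k) x s (g' i))"
    using kern_ds_integrable(2)[OF k(1) s(1) g] by (simp add: sum_negf)
  then show ?thesis
    using smear_has_derivative[OF k g s(1)] by metis
qed

text \<open>Mean value inequality with the majorant \<phi>. Each of the three coordinate directions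
  is allotted a third of its derivative, whence the factor 3.\<close>

lemma smear_increment:
  assumes k: "bump_family lo hi B k" "B \<ge> 0" and g: "integrable (lebesgue_on S) g"
    and ab: "0 < a" "a \<le> b" "b \<le> 1"
    and star: "star_box S x lo hi" and w: "\<And>i. weak_partial S i g (g' i)"
    and phi: "\<And>s. 0 < s \<Longrightarrow> (\<phi> has_real_derivative \<phi>' s) (at s)"
    and bound: "\<And>s i. a < s \<Longrightarrow> s < b \<Longrightarrow> 3 * norm (smear S (kmul x i k) x s (g' i)) \<le> \<phi>' s"
  shows "norm (smear S k x b g - smear S k x a g) \<le> \<phi> b - \<phi> a"
proof (cases "a = b")
  case False
  show ?thesis
  proof (rule differentiable_bound_general)
    show "a < b" using False ab by simp
    show "continuous_on {a..b} (\<lambda>s. smear S k x s g)"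
    proof (rule continuous_at_imp_continuous_on, intro ballI)
      fix s assume "s \<in> {a..b}"
      then have "s > 0" using ab by auto
      then show "isCont (\<lambda>s. smear S k x s g) s"
        using smear_has_derivative[OF k g] has_vector_derivative_continuous by blast
    qed
    show "continuous_on {a..b} \<phi>"
      using ab by (intro continuous_at_imp_continuous_on ballI DERIV_isCont[OF phi]) auto
    fix s assume s: "a < s" "s < b"
    show "((\<lambda>s. smear S k x s g) has_vector_derivative (\<Sum>i\<in>UNIV. smear S (kmul x i k) x s (g' i))) (at s)"
      using s ab by (intro smear_has_derivative_weak[OF k g _ _ star w]) auto
    show "(\<phi> has_vector_derivative \<phi>' s) (at s)"
      using phi[of s] s ab by (simp add: has_real_derivative_iff_has_vector_derivative)
    show "norm (\<Sum>i\<in>UNIV. smear S (kmul x i k) x s (g' i)) \<le> \<phi>' s"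
    proof -
      have "norm (\<Sum>i\<in>UNIV. smear S (kmul x i k) x s (g' i)) \<le> (\<Sum>i\<in>(UNIV::3 set). \<phi>' s / 3)"
        using bound[OF s] by (intro order_trans[OF norm_sum] sum_mono) (simp add: field_simps)
      then show ?thesis by simp
    qed
  qed
qed simp

text \<open>Hoelder against an indicator, by integrating Young's inequality for |g| / l. With N the
  integral of |g|^r, the choice l = (N / m)^(1/r) makes the two contributions add up to l m, which
  is the claimed bound. The case N = 0, where l would vanish, is separate.\<close>

lemma holder_finite_measure:
  fixes g :: "'a \<Rightarrow> 'b::euclidean_space"
  assumes r: "r \<ge> 1" and g: "g \<in> borel_measurable M" and gr: "integrable M (\<lambda>y. norm (g y) powr r)"
    and A: "A \<in> sets M" "emeasure M A \<noteq> \<infinity>" "measure M A \<le> m" "m > 0"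
  shows "integrable M (\<lambda>y. indicator A y * norm (g y))"
    and "(LINT y|M. indicator A y * norm (g y)) \<le> m powr (1 - 1 / r) * (LINT y|M. norm (g y) powr r) powr (1 / r)"
proof -
  have young: "a \<le> a powr r / r + (1 - 1 / r)" if "a \<ge> 0" for a
  proof (cases "r = 1")
    case False
    then have r1: "r > 1" using r by simp
    have "a * 1 \<le> a powr r / r + 1 powr (r / (r - 1)) / (r / (r - 1))"
      by (rule Youngs_inequality) (use r1 that in \<open>auto simp: field_simps\<close>)
    then show ?thesis
      using r1 by (simp add: field_simps)
  qed (use that in auto)
  have intA: "integrable M (indicator A :: 'a \<Rightarrow> real)"
    using A by (simp add: less_top)
  show int: "integrable M (\<lambda>y. indicator A y * norm (g y))"
  proof (rule Bochner_Integration.integrable_bound)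
    show "integrable M (\<lambda>y. norm (g y) powr r + indicator A y)"
      using gr intA by simp
    have "norm (g y) \<le> norm (g y) powr r + 1" for y
    proof -
      have "norm (g y) powr r / r \<le> norm (g y) powr r"
        using r mult_left_mono[of 1 r "norm (g y) powr r"] by (simp add: divide_le_eq)
      moreover have "1 - 1 / r \<le> 1"
        using r by simp
      ultimately show ?thesis
        using young[OF norm_ge_zero[of "g y"]] by linarith
    qed
    then show "AE y in M. norm (indicator A y * norm (g y)) \<le> norm (norm (g y) powr r + indicator A y)"
      by (intro AE_I2) (auto simp: indicator_def)
    show "(\<lambda>y. indicator A y * norm (g y)) \<in> borel_measurable M"
      using g A by measurable
  qed
  define N where "N = (LINT y|M. norm (g y) powr r)"
  have N0: "N \<ge> 0" unfolding N_def by (rule Bochner_Integration.integral_nonneg) simp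
  show "(LINT y|M. indicator A y * norm (g y)) \<le> m powr (1 - 1 / r) * (LINT y|M. norm (g y) powr r) powr (1 / r)"
    unfolding N_def[symmetric]
  proof (cases "N = 0")
    case True
    have "AE y in M. norm (g y) powr r = 0"
      using True gr unfolding N_def by (subst (asm) integral_nonneg_eq_0_iff_AE) auto
    then have "AE y in M. indicator A y * norm (g y) = 0"
      by eventually_elim auto
    then have "(LINT y|M. indicator A y * norm (g y)) = (LINT y|M. 0)"
      by (intro integral_cong_AE) (use int g A in auto)
    then show "(LINT y|M. indicator A y * norm (g y)) \<le> m powr (1 - 1 / r) * N powr (1 / r)"
      by simp
  next
    case False
    define l where "l = (N / m) powr (1 / r)"
    have l: "l > 0" using False N0 A by (simp add: l_def)
    have lr: "l powr r = N / m"
      using False N0 A r by (simp add: l_def powr_powr)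
    have "(LINT y|M. indicator A y * norm (g y)) \<le>
        (LINT y|M. l * (norm (g y) powr r / (l powr r * r) + (1 - 1 / r) * indicator A y))"
    proof (rule integral_mono[OF int])
      show "integrable M (\<lambda>y. l * (norm (g y) powr r / (l powr r * r) + (1 - 1 / r) * indicator A y))"
        using gr intA by simp
      fix y
      have "norm (g y) / l \<le> norm (g y) powr r / (l powr r * r) + (1 - 1 / r)"
        using young[of "norm (g y) / l"] l by (simp add: powr_divide)
      then show "indicator A y * norm (g y) \<le> l * (norm (g y) powr r / (l powr r * r) + (1 - 1 / r) * indicator A y)"
      proof (cases "y \<in> A")
        case True
        then show ?thesis
          using \<open>norm (g y) / l \<le> _\<close> l by (simp add: pos_divide_le_eq mult.commute[of l])
      next
        case False
        then show ?thesis
          using l r by simp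
      qed
    qed
    also have "\<dots> = l * (N / (l powr r * r) + (1 - 1 / r) * measure M A)"
      using gr intA A by (simp add: N_def)
    also have "\<dots> \<le> l * (N / (l powr r * r) + (1 - 1 / r) * m)"
      using l r A by (intro mult_left_mono add_left_mono) auto
    also have "\<dots> = l * m"
      using False N0 A r by (simp add: lr field_simps)
    also have "\<dots> = m powr (1 - 1 / r) * N powr (1 / r)"
      using A N0 by (simp add: l_def powr_diff powr_divide)
    finally show "(LINT y|M. indicator A y * norm (g y)) \<le> m powr (1 - 1 / r) * N powr (1 / r)" .
  qed
qed

text \<open>The kernel is at most B / s^3 and lives in a box of volume s^3 V, so Hoelder produces
  the power s^(-3) (s^3)^(1 - 1/r) = s^(-3/r).\<close>

lemma smear_bound:
  fixes g :: "real^3 \<Rightarrow> 'b::euclidean_space"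
  assumes k: "bump_family lo hi B k" "B \<ge> 0" and g: "g \<in> borel_measurable (lebesgue_on S)"
    and gr: "integrable (lebesgue_on S) (\<lambda>y. norm (g y) powr r)" "r \<ge> 1"
    and S: "S \<in> sets lebesgue" and s: "0 < s" "s \<le> 1" and star: "star_box S x lo hi"
    and V: "V = (\<Prod>i\<in>UNIV. hi $ i - lo $ i)"
  shows "norm (smear S k x s g) \<le> B * V powr (1 - 1 / r) * s powr (- 3 / r) * Lp_norm S r g"
proof -
  let ?A = "cbox (x + s *\<^sub>R (lo - x)) (x + s *\<^sub>R (hi - x))"
  have lohi: "lo $ i < hi $ i" for i
    using star by (simp add: star_box_def)
  have V0: "V > 0"
    unfolding V using lohi by (intro prod_pos) simp
  have sub: "?A \<subseteq> S"
    by (rule star_box_subset[OF star s])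
  have mA: "measure lebesgue ?A = s ^ 3 * V"
  proof -
    have "measure lebesgue ?A = (\<Prod>i\<in>UNIV. s * (hi $ i - lo $ i))"
    proof -
      have "x + s *\<^sub>R (lo - x) \<in> ?A"
        using lohi s by (simp add: mem_box_cart mult_left_mono less_imp_le)
      then have "measure lborel ?A = (\<Prod>i\<in>UNIV. (x + s *\<^sub>R (hi - x)) $ i - (x + s *\<^sub>R (lo - x)) $ i)"
        by (intro content_cbox_cart) auto
      then show ?thesis
        by (simp add: algebra_simps)
    qed
    then show ?thesis
      unfolding V by (simp add: prod.distrib)
  qed
  have Am: "?A \<in> sets (lebesgue_on S)"
    using sub S by (simp add: sets_restrict_space_iff)
  have mA': "measure (lebesgue_on S) ?A = s ^ 3 * V"
    using sub S mA by (simp add: measure_restrict_space)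
  have fA: "emeasure (lebesgue_on S) ?A \<noteq> \<infinity>"
    using sub S by (simp add: emeasure_restrict_space emeasure_lborel_cbox_eq)
  note H = holder_finite_measure[OF gr(2) g gr(1) Am fA, of "s ^ 3 * V"]
  have "norm (smear S k x s g) \<le> (LINT y|lebesgue_on S. B / s ^ 3 * (indicator ?A y * norm (g y)))"
    unfolding smear_def
  proof (rule Bochner_Integration.integral_norm_bound_integral)
    show int: "integrable (lebesgue_on S) (\<lambda>y. B / s ^ 3 * (indicator ?A y * norm (g y)))"
      using H(1) mA' V0 s by simp
    show bd: "norm (kern k x s y *\<^sub>R g y) \<le> B / s ^ 3 * (indicator ?A y * norm (g y))" for y
      using mult_right_mono[OF kern_bound[OF k(1) s(1), of x y] norm_ge_zero[of "g y"]] by (simp add: mult.assoc)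
    show "integrable (lebesgue_on S) (\<lambda>y. kern k x s y *\<^sub>R g y)"
    proof (rule Bochner_Integration.integrable_bound[OF int])
      show "(\<lambda>y. kern k x s y *\<^sub>R g y) \<in> borel_measurable (lebesgue_on S)"
        by (intro borel_measurable_scaleR kern_measurable[OF k(1)] g)
      show "AE y in lebesgue_on S. norm (kern k x s y *\<^sub>R g y) \<le> norm (B / s ^ 3 * (indicator ?A y * norm (g y)))"
        by (intro AE_I2) (unfold real_norm_def, rule order_trans[OF bd abs_ge_self])
    qed
  qed
  also have "\<dots> = B / s ^ 3 * (LINT y|lebesgue_on S. indicator ?A y * norm (g y))"
    by simp
  also have "\<dots> \<le> B / s ^ 3 * ((s ^ 3 * V) powr (1 - 1 / r) * Lp_norm S r g)"
    using H(2) mA' V0 s k(2) by (intro mult_left_mono) (auto simp: Lp_norm_def)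
  also have "\<dots> = B * V powr (1 - 1 / r) * s powr (- 3 / r) * Lp_norm S r g"
  proof -
    have "s ^ 3 = s powr 3"
      using s by (simp add: powr_numeral)
    then have "(s ^ 3 * V) powr (1 - 1 / r) = s powr (3 - 3 / r) * V powr (1 - 1 / r)"
    proof -
      have "(s ^ 3 * V) powr (1 - 1 / r) = (s powr 3) powr (1 - 1 / r) * V powr (1 - 1 / r)"
        using s V0 by (subst \<open>s ^ 3 = s powr 3\<close>) (simp add: powr_mult)
      also have "(s powr 3) powr (1 - 1 / r) = s powr (3 * (1 - 1 / r))"
        by (rule powr_powr)
      finally show ?thesis
        by (simp add: right_diff_distrib)
    qed
    moreover have "s powr (3 - 3 / r) = s ^ 3 * s powr (- 3 / r)"
    proof -
      have "s powr (3 + - 3 / r) = s powr 3 * s powr (- 3 / r)"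
        by (rule powr_add)
      then show ?thesis
        by (simp add: \<open>s ^ 3 = s powr 3\<close> del: powr_numeral)
    qed
    ultimately show ?thesis
      using s by simp
  qed
  finally show ?thesis .
qed

section \<open>Classical derivatives as weak derivatives\<close>

lemma integrable_continuous_compact_support:
  fixes h :: "real^3 \<Rightarrow> 'b::euclidean_space"
  assumes S: "open S" and h: "continuous_on S h" and H: "compact H" "H \<subseteq> S"
    and zero: "\<And>y. y \<in> S \<Longrightarrow> y \<notin> H \<Longrightarrow> h y = 0"
  shows "integrable (lebesgue_on S) h"
proof -
  have "integrable lborel (\<lambda>y. indicator H y *\<^sub>R h y)"
    by (rule borel_integrable_compact[OF H(1) continuous_on_subset[OF h H(2)]])
  then have "integrable lebesgue (\<lambda>y. indicator H y *\<^sub>R h y)"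
    by (subst integrable_completion) auto
  moreover have "(\<lambda>y. indicator H y *\<^sub>R h y) = (\<lambda>y. indicator S y *\<^sub>R h y)"
    using zero H(2) by (auto simp: indicator_def fun_eq_iff)
  ultimately show ?thesis
    using S by (subst integrable_restrict_space) auto
qed

lemma pd_eq_0_open:
  assumes "open U" "y \<in> U" "\<And>z. z \<in> U \<Longrightarrow> f z = 0"
  shows "pd i f y = 0"
proof -
  have "(f has_derivative (\<lambda>_. 0)) (at y)"
    using has_derivative_transform_within_open[of "\<lambda>_. 0" "\<lambda>_. 0" y UNIV U f] assms by auto
  then show ?thesis
    using frechet_derivative_at by (metis pd_def)
qed

lemma pd_scaleR:
  fixes f :: "real^3 \<Rightarrow> 'b::real_normed_vector"
  assumes "\<phi> differentiable (at y)" "f differentiable (at y)"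
  shows "pd i (\<lambda>y. \<phi> y *\<^sub>R f y) y = pd i \<phi> y *\<^sub>R f y + \<phi> y *\<^sub>R pd i f y"
    and "(\<lambda>y. \<phi> y *\<^sub>R f y) differentiable (at y)"
proof -
  have "((\<lambda>y. \<phi> y *\<^sub>R f y) has_derivative
      (\<lambda>h. \<phi> y *\<^sub>R frechet_derivative f (at y) h + frechet_derivative \<phi> (at y) h *\<^sub>R f y)) (at y)"
    using assms by (intro has_derivative_scaleR) (auto simp: frechet_derivative_works)
  from frechet_derivative_at[OF this] this
  show "pd i (\<lambda>y. \<phi> y *\<^sub>R f y) y = pd i \<phi> y *\<^sub>R f y + \<phi> y *\<^sub>R pd i f y"
    and "(\<lambda>y. \<phi> y *\<^sub>R f y) differentiable (at y)"
    by (auto simp: pd_def differentiable_def add.commute fun_eq_iff dest: fun_cong[where x = "axis i 1"])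
qed

lemma integral_pd_scaleR_compact_support:
  fixes f :: "real^3 \<Rightarrow> 'b::euclidean_space"
  assumes S: "open S" and diff: "\<And>y. y \<in> S \<Longrightarrow> f differentiable (at y)" and pd: "continuous_on S (pd i f)"
    and \<phi>: "\<And>y. y \<in> S \<Longrightarrow> \<phi> differentiable (at y)" "continuous_on S (pd i \<phi>)"
    and H: "compact H" "H \<subseteq> S" "\<And>y. y \<in> S \<Longrightarrow> y \<notin> H \<Longrightarrow> \<phi> y = 0"
  shows "(LINT y|lebesgue_on S. pd i \<phi> y *\<^sub>R f y) = - (LINT y|lebesgue_on S. \<phi> y *\<^sub>R pd i f y)"
proof -
  have cf: "continuous_on S f" and c\<phi>: "continuous_on S \<phi>"
    using diff \<phi>(1) by (auto intro!: continuous_at_imp_continuous_on differentiable_imp_continuous_within)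
  have zero': "pd i \<phi> y = 0" if "y \<in> S" "y \<notin> H" for y
    using that H S by (intro pd_eq_0_open[of "S - H"]) (auto intro!: open_Diff compact_imp_closed)
  have int1: "integrable (lebesgue_on S) (\<lambda>y. pd i \<phi> y *\<^sub>R f y)"
    by (rule integrable_continuous_compact_support[OF S _ H(1,2)])
       (auto intro!: continuous_intros cf \<phi> simp: zero')
  have int2: "integrable (lebesgue_on S) (\<lambda>y. \<phi> y *\<^sub>R pd i f y)"
    by (rule integrable_continuous_compact_support[OF S _ H(1,2)])
       (auto intro!: continuous_intros c\<phi> pd simp: H)
  have eq: "pd i (\<lambda>y. \<phi> y *\<^sub>R f y) y = pd i \<phi> y *\<^sub>R f y + \<phi> y *\<^sub>R pd i f y" if "y \<in> S" for y
    using pd_scaleR(1)[OF \<phi>(1) diff] that by auto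
  have "(LINT y|lebesgue_on S. pd i (\<lambda>y. \<phi> y *\<^sub>R f y) y) = 0"
  proof (rule integral_pd_compact_support[OF S H(1,2)])
    show "continuous_on S (pd i (\<lambda>y. \<phi> y *\<^sub>R f y))"
      by (rule continuous_on_eq[of _ "\<lambda>y. pd i \<phi> y *\<^sub>R f y + \<phi> y *\<^sub>R pd i f y"])
         (auto intro!: continuous_intros cf c\<phi> pd \<phi> simp: eq)
  qed (use H pd_scaleR(2)[OF \<phi>(1) diff] in auto)
  moreover have "(LINT y|lebesgue_on S. pd i (\<lambda>y. \<phi> y *\<^sub>R f y) y) =
      (LINT y|lebesgue_on S. pd i \<phi> y *\<^sub>R f y + \<phi> y *\<^sub>R pd i f y)"
    by (rule Bochner_Integration.integral_cong) (auto simp: eq)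
  ultimately show ?thesis
    using int1 int2 by (simp add: eq_neg_iff_add_eq_0)
qed

lemma tprod_differentiable: "(\<And>i. smooth1 (F i)) \<Longrightarrow> tprod F differentiable (at y)"
  using tprod_has_derivative[of F] differentiable_def by blast

lemma weak_partial_C1:
  fixes f :: "real^3 \<Rightarrow> 'b::euclidean_space"
  assumes S: "open S" and diff: "\<And>y. y \<in> S \<Longrightarrow> f differentiable (at y)" and pd: "continuous_on S (pd i f)"
  shows "weak_partial S i f (pd i f)"
  unfolding weak_partial_def
proof (intro allI impI, elim conjE)
  fix F assume F: "\<forall>j. smooth1 (F j)" and test: "test_function S (tprod F)"
  let ?H = "closure {x. tprod F x \<noteq> 0}"
  have "smooth1 ((F(i := deriv (F i))) j)" for j
    using F by (simp add: smooth1_deriv)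
  then have "continuous_on S (pd i (tprod F))"
    using F by (simp only: pd_tprod) (intro continuous_on_tprod)
  moreover have "tprod F y = 0" if "y \<notin> ?H" for y
    using that closure_subset[of "{x. tprod F x \<noteq> 0}"] by blast
  moreover have "tprod F differentiable (at y)" for y
    by (rule tprod_differentiable) (simp add: F)
  moreover have "compact ?H" "?H \<subseteq> S"
    using test by (simp_all add: test_function_def)
  ultimately show "(LINT y|lebesgue_on S. pd i (tprod F) y *\<^sub>R f y) = - (LINT y|lebesgue_on S. tprod F y *\<^sub>R pd i f y)"
    by (intro integral_pd_scaleR_compact_support[OF S diff pd, where H = ?H]) blast+
qed

section \<open>Averages at small scales\<close>

lemma kern_nonneg: "(\<And>y. 0 \<le> tprod k y) \<Longrightarrow> s > 0 \<Longrightarrow> 0 \<le> kern k x s y"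
  by (simp add: kern_alt)

lemma integrable_const_bounded:
  fixes S :: "'a::euclidean_space set"
  shows "open S \<Longrightarrow> bounded S \<Longrightarrow> integrable (lebesgue_on S) (\<lambda>_. c :: 'b::euclidean_space)"
  by (intro finite_measure.integrable_const finite_measure_lebesgue_on lmeasurable_open)

text \<open>The derivative of a constant is 0, so \<open>smear_increment\<close> with majorant 0
  shows that the mass of the kernel is the same at all scales. This takes the place of a change of
  variables.\<close>

lemma smear_const:
  assumes k: "bump_family lo hi B k" "B \<ge> 0" and S: "open S" "bounded S"
    and star: "star_box S x lo hi" and s: "0 < s" "s \<le> 1"
  shows "smear S k x s (\<lambda>_. 1::real) = (LINT y|lebesgue_on S. tprod k y)"
proof -
  have one: "integrable (lebesgue_on S) (\<lambda>_. 1::real)"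
    by (rule integrable_const_bounded[OF S])
  have pd1: "pd i (\<lambda>_. 1::real) = (\<lambda>_. 0)" for i
    by (simp add: pd_def fun_eq_iff)
  have w: "weak_partial S i (\<lambda>_. 1::real) (\<lambda>_. 0)" for i
    using weak_partial_C1[OF S(1), of "\<lambda>_. 1::real" i] unfolding pd1 by simp
  have "norm (smear S k x 1 (\<lambda>_. 1::real) - smear S k x s (\<lambda>_. 1)) \<le> 0 - 0"
    by (rule smear_increment[OF k one s order_refl star w, where \<phi> = "\<lambda>_. 0" and \<phi>' = "\<lambda>_. 0"])
       (auto simp: smear_def)
  then show ?thesis
    by (simp add: smear_def kern_one)
qed

text \<open>An approximate identity: the mass is independent of s, and the support of the kernel
  lies within a distance proportional to s of x because S is bounded.\<close>

lemma smear_tendsto: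
  fixes g :: "real^3 \<Rightarrow> 'b::euclidean_space"
  assumes k: "bump_family lo hi B k" "B \<ge> 0" "\<And>y. 0 \<le> tprod k y" and S: "open S" "bounded S"
    and star: "star_box S x lo hi" and x: "x \<in> S"
    and g: "integrable (lebesgue_on S) g" "isCont g x"
  shows "((\<lambda>s. smear S k x s g) \<longlongrightarrow> (LINT y|lebesgue_on S. tprod k y) *\<^sub>R g x) (at_right 0)"
proof (rule tendstoI)
  fix e :: real assume e: "e > 0"
  define I where "I = (LINT y|lebesgue_on S. tprod k y)"
  have I: "I \<ge> 0"
    unfolding I_def using k by simp
  \<comment> \<open>Dividing by I + 1 instead of I covers I = 0 and makes the final inequality
    strict.\<close>
  obtain d where d: "d > 0" "\<And>y. dist y x < d \<Longrightarrow> dist (g y) (g x) < e / (I + 1)"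
    using g(2) e I unfolding continuous_at_eps_delta by (metis add_nonneg_pos divide_pos_pos zero_less_one)
  obtain b where b: "\<And>y. y \<in> S \<Longrightarrow> norm y \<le> b" "b > 0"
    using S(2) bounded_pos by metis
  have "\<forall>\<^sub>F s in at_right 0. s < min 1 (d / (3 * b))"
    unfolding eventually_at_right[OF zero_less_one] using d b by (intro exI[of _ "min 1 (d / (3 * b))"]) auto
  then show "\<forall>\<^sub>F s in at_right 0. dist (smear S k x s g) (I *\<^sub>R g x) < e"
    using eventually_at_right_less[of 0]
  proof eventually_elim
    case (elim s)
    then have s: "0 < s" "s \<le> 1" "s * (3 * b) < d"
      using b d by (auto simp: field_simps)
    have one: "integrable (lebesgue_on S) (\<lambda>_. 1::real)"
      by (rule integrable_const_bounded[OF S])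
    have i1: "integrable (lebesgue_on S) (\<lambda>y. kern k x s y *\<^sub>R g y)"
      by (rule smear_integrable[OF k(1) s(1) g(1) k(2)])
    have ik: "integrable (lebesgue_on S) (\<lambda>y. kern k x s y)"
      using smear_integrable[OF k(1) s(1) one k(2), of x] by simp
    have Ik: "(LINT y|lebesgue_on S. kern k x s y) = I"
      using smear_const[OF k(1,2) S star s(1,2)] by (simp add: smear_def I_def)
    have i2: "integrable (lebesgue_on S) (\<lambda>y. kern k x s y *\<^sub>R g x)"
      using ik by simp
    have "smear S k x s g - I *\<^sub>R g x = (LINT y|lebesgue_on S. kern k x s y *\<^sub>R (g y - g x))"
      using i1 i2 ik by (simp add: smear_def scaleR_diff_right Ik)
    also have "norm \<dots> \<le> (LINT y|lebesgue_on S. kern k x s y * (e / (I + 1)))"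
    proof (rule Bochner_Integration.integral_norm_bound_integral)
      show "integrable (lebesgue_on S) (\<lambda>y. kern k x s y *\<^sub>R (g y - g x))"
        using i1 i2 by (simp add: scaleR_diff_right)
      show "integrable (lebesgue_on S) (\<lambda>y. kern k x s y * (e / (I + 1)))"
        using ik by simp
      fix y
      show "norm (kern k x s y *\<^sub>R (g y - g x)) \<le> kern k x s y * (e / (I + 1))"
      proof (cases "kern k x s y = 0")
        case False
        then have "x + (y - x) /\<^sub>R s \<in> cbox lo hi"
          using tprod_bump_family_eq_0[OF k(1)] by (auto simp: kern_alt)
        then have "x + (y - x) /\<^sub>R s \<in> S"
          using star unfolding star_box_def by (metis scaleR_one add_diff_cancel_left' diff_add_cancel
              add.commute zero_less_one order_refl)
        then have "norm (x + (y - x) /\<^sub>R s) \<le> b" "norm x \<le> b"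
          using b x by auto
        then have "norm ((y - x) /\<^sub>R s) \<le> 2 * b"
          using norm_triangle_ineq4[of "x + (y - x) /\<^sub>R s" x] by simp
        then have "norm (y - x) \<le> s * (2 * b)"
          using s unfolding norm_scaleR by (simp add: field_simps)
        also have "\<dots> \<le> s * (3 * b)"
          using s b by simp
        finally have "dist (g y) (g x) < e / (I + 1)"
          using s by (intro d) (simp add: dist_norm)
        then have "kern k x s y * norm (g y - g x) \<le> kern k x s y * (e / (I + 1))"
          unfolding dist_norm by (intro mult_left_mono less_imp_le kern_nonneg[OF k(3) s(1)])
        then show ?thesis
          using kern_nonneg[OF k(3) s(1), of x y] by simp
      qed simp
    qed
    also have "\<dots> = I * (e / (I + 1))"
      using Ik by simp
    also have "\<dots> < e"
      using I e by (simp add: field_simps)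
    finally show ?case
      by (simp add: dist_norm)
  qed
qed

section \<open>The standard bump of a box\<close>

definition bumps :: "real^3 \<Rightarrow> real^3 \<Rightarrow> 3 \<Rightarrow> real \<Rightarrow> real" where
  "bumps lo hi = (\<lambda>i. bump1 1 (lo $ i) (hi $ i))"

lemma bump_family_bumps: "bump_family lo hi 1 (bumps lo hi)"
  using tprod_bump_bounds[of 1 lo hi]
  by (auto simp: bump_family_def bumps_def smooth1_bump1 abs_le_iff intro!: bump1_eq_0)

lemma tprod_bumps_nonneg: "0 \<le> tprod (bumps lo hi) y"
  unfolding bumps_def by (rule tprod_bump_bounds)

definition bump_mass :: "real^3 \<Rightarrow> real^3 \<Rightarrow> real" where
  "bump_mass lo hi = (LINT y|lebesgue. tprod (bumps lo hi) y)"

lemma integrable_tprod_bumps: "integrable lebesgue (tprod (bumps lo hi))"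
proof -
  have c: "continuous_on UNIV (tprod (bumps lo hi))"
    by (intro continuous_on_tprod bump_family_smooth1[OF bump_family_bumps])
  have "integrable (lebesgue_on UNIV) (tprod (bumps lo hi))"
    by (rule integrable_continuous_compact_support[OF open_UNIV c, of "cbox lo hi"])
       (auto intro: tprod_bump_family_eq_0[OF bump_family_bumps])
  then show ?thesis
    by (simp add: lebesgue_on_UNIV_eq)
qed

lemma bump_mass_pos:
  assumes "\<And>i. lo $ i < hi $ i"
  shows "bump_mass lo hi > 0"
proof (rule ccontr)
  assume "\<not> ?thesis"
  moreover have "bump_mass lo hi \<ge> 0"
    unfolding bump_mass_def by (simp add: tprod_bumps_nonneg)
  ultimately have "AE y in lebesgue. tprod (bumps lo hi) y = 0"
    using integral_nonneg_eq_0_iff_AE[OF integrable_tprod_bumps[of lo hi]] tprod_bumps_nonneg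
    unfolding bump_mass_def by (metis AE_I2 order_antisym_conv not_less)
  then have "AE y in lebesgue. y \<notin> box lo hi"
  proof eventually_elim
    case (elim y)
    have "tprod (bumps lo hi) y > 0" if "y \<in> box lo hi"
      using that unfolding tprod_def bumps_def by (intro prod_pos bump1_pos) (auto simp: mem_box_cart)
    with elim show ?case
      by auto
  qed
  then have "negligible (box lo hi)"
    by (simp add: negligible_iff_null_sets AE_iff_null_sets)
  moreover have "(\<chi> i. (lo $ i + hi $ i) / 2) \<in> box lo hi"
    using assms by (simp add: mem_box_cart)
  ultimately show False
    using open_not_negligible[OF open_box[of lo hi]] by blast
qed

lemma bump_mass_eq:
  assumes "cbox lo hi \<subseteq> S" "S \<in> sets lebesgue"
  shows "(LINT y|lebesgue_on S. tprod (bumps lo hi) y) = bump_mass lo hi"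
proof -
  have "(LINT y|lebesgue_on S. tprod (bumps lo hi) y) = (LINT y|lebesgue. indicator S y *\<^sub>R tprod (bumps lo hi) y)"
    using assms(2) by (subst integral_restrict_space) auto
  also have "\<dots> = bump_mass lo hi"
    unfolding bump_mass_def
    using tprod_bump_family_eq_0[OF bump_family_bumps, of _ lo hi] assms(1)
    by (intro Bochner_Integration.integral_cong) (auto simp: indicator_def)
  finally show ?thesis .
qed

lemma star_box_cbox: "star_box S x lo hi \<Longrightarrow> cbox lo hi \<subseteq> S"
  using star_box_subset[of S x lo hi 1] by simp

lemma star_box_dist:
  assumes "star_box S x lo hi" "x \<in> S" "\<And>y. y \<in> S \<Longrightarrow> norm y \<le> b" "y \<in> cbox lo hi"
  shows "\<bar>y $ i - x $ i\<bar> \<le> 2 * b"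
  using assms(3)[OF assms(2)] assms(3)[of y] star_box_cbox[OF assms(1)] assms(4)
    component_le_norm_cart[of y i] component_le_norm_cart[of x i] by (auto simp: subset_iff)

section \<open>Morrey and Sobolev estimates at one point\<close>

definition box_vol :: "real^3 \<Rightarrow> real^3 \<Rightarrow> real" where
  "box_vol lo hi = (\<Prod>i\<in>UNIV. hi $ i - lo $ i)"

text \<open>Smearing at scale \<open>1\<close> does not depend on the centre \<open>x\<close>, so this bounds the oscillation of \<open>f\<close>
  over all points that see the same box.\<close>

lemma morrey_star:
  fixes f :: "real^3 \<Rightarrow> 'b::euclidean_space"
  assumes S: "open S" "\<And>y. y \<in> S \<Longrightarrow> norm y \<le> b"
    and star: "star_box S x lo hi" and x: "x \<in> S" and r: "r > 3"
    and f: "integrable (lebesgue_on S) f" "\<And>y. y \<in> S \<Longrightarrow> f differentiable (at y)"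
      "\<And>i. continuous_on S (pd i f)" "\<And>i. integrable (lebesgue_on S) (\<lambda>y. norm (pd i f y) powr r)"
    and A: "\<And>i. Lp_norm S r (pd i f) \<le> A" and s: "0 < s" "s \<le> 1"
  shows "norm (smear S (bumps lo hi) x s f - bump_mass lo hi *\<^sub>R f x) \<le>
    6 * b * box_vol lo hi powr (1 - 1 / r) / (1 - 3 / r) * A * s powr (1 - 3 / r)"
proof -
  let ?k = "bumps lo hi"
  \<comment> \<open>6 b = 3 * 2 b: three directions, and each coordinate of y - x is at most 2 b
    when y runs through the box.\<close>
  define C where "C = 6 * b * box_vol lo hi powr (1 - 1 / r) * A"
  define \<kappa> where "\<kappa> = 1 - 3 / r"
  have \<kappa>: "\<kappa> > 0" using r by (simp add: \<kappa>_def)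
  have bS: "bounded S" using S(2) by (auto simp: bounded_iff)
  have b0: "b \<ge> 0" using S(2)[OF x] norm_ge_zero[of x] by linarith
  have Sm: "S \<in> sets lebesgue" using S(1) by auto
  have est: "norm (smear S ?k x s f - smear S ?k x a f) \<le> C / \<kappa> * s powr \<kappa> - C / \<kappa> * a powr \<kappa>"
    if a: "0 < a" "a \<le> s" for a
  proof (rule smear_increment[OF bump_family_bumps _ f(1) a s(2) star weak_partial_C1[OF S(1) f(2,3)],
        where \<phi>' = "\<lambda>s. C * s powr (- 3 / r)"])
    show "((\<lambda>s. C / \<kappa> * s powr \<kappa>) has_real_derivative C * t powr (- 3 / r)) (at t)" if "0 < t" for t
      using that \<kappa> by (auto intro!: derivative_eq_intros simp: \<kappa>_def)
    fix t i assume t: "a < t" "t < s"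
    have "norm (smear S (kmul x i ?k) x t (pd i f)) \<le>
        (2 * b * 1) * box_vol lo hi powr (1 - 1 / r) * t powr (- 3 / r) * Lp_norm S r (pd i f)"
    proof (rule smear_bound[OF bump_family_kmul[OF bump_family_bumps] _ _ f(4) _ Sm _ _ star box_vol_def])
      show "pd i f \<in> borel_measurable (lebesgue_on S)"
        by (rule continuous_imp_measurable_on_sets_lebesgue[OF f(3) Sm])
      show "\<bar>y $ i - x $ i\<bar> \<le> 2 * b" if "y \<in> cbox lo hi" for y
        by (rule star_box_dist[OF star x S(2) that])
    qed (use b0 r t a s in auto)
    also have "\<dots> \<le> (2 * b * 1) * box_vol lo hi powr (1 - 1 / r) * t powr (- 3 / r) * A"
      using b0 by (intro mult_left_mono A mult_nonneg_nonneg) auto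
    finally show "3 * norm (smear S (kmul x i ?k) x t (pd i f)) \<le> C * t powr (- 3 / r)"
      by (simp add: C_def mult_ac)
  qed (auto)
  \<comment> \<open>Letting the lower scale a tend to 0 turns the average at scale a into the bump
    mass times f x; the term subtracted in \<open>est\<close> has the favourable sign.\<close>
  have "((\<lambda>a. norm (smear S ?k x s f - smear S ?k x a f)) \<longlongrightarrow>
      norm (smear S ?k x s f - bump_mass lo hi *\<^sub>R f x)) (at_right 0)"
    using smear_tendsto[OF bump_family_bumps _ tprod_bumps_nonneg S(1) bS star x f(1)]
      differentiable_imp_continuous_within[OF f(2)[OF x]] bump_mass_eq[OF star_box_cbox[OF star] Sm]
    by (intro tendsto_intros) simp
  moreover have "\<forall>\<^sub>F a in at_right 0. norm (smear S ?k x s f - smear S ?k x a f) \<le> C / \<kappa> * s powr \<kappa>"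
  proof -
    have A0: "A \<ge> 0"
      using A[of undefined] by (rule order_trans[rotated]) (simp add: Lp_norm_def)
    then have "C / \<kappa> * a powr \<kappa> \<ge> 0" for a
      using b0 \<kappa> by (simp add: C_def)
    then have "norm (smear S ?k x s f - smear S ?k x a f) \<le> C / \<kappa> * s powr \<kappa>" if "0 < a" "a \<le> s" for a
      using est[OF that] by (smt (verit))
    then show ?thesis
      using s(1) by (auto simp: eventually_at_right intro!: exI[of _ s])
  qed
  ultimately have "norm (smear S ?k x s f - bump_mass lo hi *\<^sub>R f x) \<le> C / \<kappa> * s powr \<kappa>"
    by (intro tendsto_upperbound) auto
  then show ?thesis
    by (simp add: C_def \<kappa>_def mult_ac)
qed

lemma sobolev_smear_bound:
  fixes h :: "real^3 \<Rightarrow> 'b::euclidean_space"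
  assumes S: "open S" "\<And>y. y \<in> S \<Longrightarrow> norm y \<le> b"
    and star: "star_box S x lo hi" and x: "x \<in> S"
    and k: "bump_family lo hi B k" "B \<ge> 0"
    and h: "h \<in> Lp_space S 2" "\<And>i. h' i \<in> Lp_space S 2" "\<And>i j. h'' i j \<in> Lp_space S 2"
    and int: "integrable (lebesgue_on S) h" "\<And>i. integrable (lebesgue_on S) (h' i)"
    and w: "\<And>i. weak_partial S i h (h' i)" "\<And>i j. weak_partial S j (h' i) (h'' i j)"
    and N: "Lp_norm S 2 h \<le> N" "\<And>i. Lp_norm S 2 (h' i) \<le> N" "\<And>i j. Lp_norm S 2 (h'' i j) \<le> N"
    and s: "0 < s" "s \<le> 1"
  shows "norm (smear S k x s h) \<le> B * sqrt (box_vol lo hi) * N * (1 + 12 * b * (1 + 12 * b))"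
proof -
  define v where "v = sqrt (box_vol lo hi)"
  have v0: "v \<ge> 0" unfolding v_def box_vol_def using star
    by (intro real_sqrt_ge_zero prod_nonneg) (auto simp: star_box_def less_imp_le)
  have vp: "box_vol lo hi powr (1 - 1 / 2) = v"
    using star unfolding v_def box_vol_def
    by (subst powr_half_sqrt[symmetric]) (auto simp: star_box_def less_imp_le intro!: prod_nonneg)
  have b0: "b \<ge> 0" using S(2)[OF x] norm_ge_zero[of x] by linarith
  have N0: "N \<ge> 0"
    using N(1) by (rule order_trans[rotated]) (simp add: Lp_norm_def)
  have Sm: "S \<in> sets lebesgue" using S(1) by auto
  have kmul: "bump_family lo hi (2 * b * B') (kmul x i k')" if "bump_family lo hi B' k'" "B' \<ge> 0" for B' k' i
    using that b0 by (intro bump_family_kmul) (auto intro: star_box_dist[OF star x S(2)])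
  have base: "norm (smear S k' x s g) \<le> B' * v * s powr (- 3 / 2) * N"
    if "bump_family lo hi B' k'" "B' \<ge> 0" "g \<in> Lp_space S 2" "Lp_norm S 2 g \<le> N" "0 < s" "s \<le> 1"
    for B' k' s and g :: "real^3 \<Rightarrow> 'b"
  proof -
    have "norm (smear S k' x s g) \<le> B' * box_vol lo hi powr (1 - 1 / 2) * s powr (- 3 / 2) * Lp_norm S 2 g"
      using that by (intro smear_bound[OF _ _ _ _ _ Sm _ _ star box_vol_def]) (auto simp: Lp_space_def)
    also have "\<dots> \<le> B' * v * s powr (- 3 / 2) * N"
      unfolding vp using that v0 by (intro mult_left_mono) auto
    finally show ?thesis .
  qed
  have level1: "norm (smear S k' x s (h' i)) \<le> B' * v * N * (1 + 12 * b) * s powr (- 1 / 2)"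
    if k': "bump_family lo hi B' k'" "B' \<ge> 0" and s: "0 < s" "s \<le> 1" for B' k' s i
  proof -
    \<comment> \<open>12 b = 2 * 3 * 2 b: the antiderivative of t^(-3/2) brings a factor 2, there
      are three directions, and \<open>kmul\<close> costs 2 b.\<close>
    define C where "C = 12 * b * B' * v * N"
    have C0: "C \<ge> 0" using b0 v0 N0 k' by (simp add: C_def)
    have "norm (smear S k' x 1 (h' i) - smear S k' x s (h' i)) \<le> - C * 1 powr (- 1 / 2) - (- C * s powr (- 1 / 2))"
    proof (rule smear_increment[OF k' int(2) s order_refl star w(2), where \<phi>' = "\<lambda>s. C / 2 * s powr (- 3 / 2)"])
      show "((\<lambda>s. - C * s powr (- 1 / 2)) has_real_derivative C / 2 * t powr (- 3 / 2)) (at t)" if "0 < t" for t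
        using that by (auto intro!: derivative_eq_intros)
      fix t j assume t: "s < t" "t < 1"
      show "3 * norm (smear S (kmul x j k') x t (h'' i j)) \<le> C / 2 * t powr (- 3 / 2)"
        using base[OF kmul[OF k'] _ h(3) N(3), of t j i j] t s k' b0 by (simp add: C_def mult_ac)
    qed
    moreover have "norm (smear S k' x 1 (h' i)) \<le> B' * v * N"
      using base[OF k' h(2) N(2), of 1 i] by simp
    ultimately have "norm (smear S k' x s (h' i)) \<le> B' * v * N + C * s powr (- 1 / 2) - C"
      using norm_triangle_ineq3[of "smear S k' x s (h' i)" "smear S k' x 1 (h' i)"] by (simp add: norm_minus_commute)
    also have "\<dots> \<le> B' * v * N * s powr (- 1 / 2) + C * s powr (- 1 / 2)"
    proof -
      have "1 \<le> s powr (- 1 / 2)"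
        using s by (metis divide_minus_left less_eq_real_def minus_divide_left neg_le_0_iff_le powr_mono' powr_zero_eq_one
            zero_le_divide_1_iff zero_le_numeral order_less_le)
      then have "B' * v * N * 1 \<le> B' * v * N * s powr (- 1 / 2)"
        using v0 N0 k' by (intro mult_left_mono) auto
      then show ?thesis using C0 by simp
    qed
    also have "\<dots> = B' * v * N * (1 + 12 * b) * s powr (- 1 / 2)"
      by (simp add: C_def algebra_simps)
    finally show ?thesis .
  qed
  \<comment> \<open>The same count once more, with 1 + 12 b inherited from \<open>level1\<close>;
    the antiderivative of t^(-1/2) again brings a factor 2.\<close>
  define C where "C = 12 * b * (1 + 12 * b) * B * v * N"
  have "norm (smear S k x 1 h - smear S k x s h) \<le> C * 1 powr (1 / 2) - C * s powr (1 / 2)"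
  proof (rule smear_increment[OF k int(1) s order_refl star w(1), where \<phi>' = "\<lambda>s. C / 2 * s powr (- 1 / 2)"])
    show "((\<lambda>s. C * s powr (1 / 2)) has_real_derivative C / 2 * t powr (- 1 / 2)) (at t)" if "0 < t" for t
      using that by (auto intro!: derivative_eq_intros)
    fix t j assume t: "s < t" "t < 1"
    show "3 * norm (smear S (kmul x j k) x t (h' j)) \<le> C / 2 * t powr (- 1 / 2)"
      using mult_left_mono[OF level1[OF kmul[OF k], of t j j], of 3] t s k b0
      by (simp add: C_def algebra_simps)
  qed
  moreover have "norm (smear S k x 1 h) \<le> B * v * N"
    using base[OF k h(1) N(1), of 1] by simp
  moreover have "0 \<le> C * s powr (1 / 2)"
    using b0 v0 N0 k by (simp add: C_def)
  ultimately have "norm (smear S k x s h) \<le> B * v * N + C"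
    using norm_triangle_ineq3[of "smear S k x s h" "smear S k x 1 h"] by (simp add: norm_minus_commute)
  then show ?thesis
    by (simp add: C_def v_def algebra_simps)
qed

section \<open>Geometry of the boundary\<close>

lemma frechet_derivative_cart:
  fixes f :: "real^3 \<Rightarrow> 'b::real_normed_vector"
  assumes "f differentiable (at y)"
  shows "frechet_derivative f (at y) h = (\<Sum>i\<in>UNIV. h $ i *\<^sub>R pd i f y)"
proof -
  have lin: "linear (frechet_derivative f (at y))"
    using assms by (rule linear_frechet_derivative)
  have "h = (\<Sum>i\<in>UNIV. h $ i *\<^sub>R axis i 1)"
    using basis_expansion[of h] by (simp add: scalar_mult_eq_scaleR)
  then have "frechet_derivative f (at y) h = frechet_derivative f (at y) (\<Sum>i\<in>UNIV. h $ i *\<^sub>R axis i 1)"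
    by simp
  also have "\<dots> = (\<Sum>i\<in>UNIV. h $ i *\<^sub>R pd i f y)"
    by (simp add: linear_sum[OF lin] linear_scale[OF lin] pd_def)
  finally show ?thesis .
qed

lemma has_derivative_grad:
  assumes "f differentiable (at y)"
  shows "(f has_derivative (\<lambda>h. h \<bullet> grad f y)) (at y)"
proof -
  have "frechet_derivative f (at y) = (\<lambda>h. h \<bullet> grad f y)"
    by (rule ext) (simp add: frechet_derivative_cart[OF assms] inner_vec_def grad_def)
  then show ?thesis
    using assms by (simp add: frechet_derivative_works)
qed

lemma grad_eqI: "(f has_derivative (\<lambda>h. h \<bullet> G)) (at y) \<Longrightarrow> grad f y = G"
  by (simp add: grad_def pd_def vec_eq_iff frechet_derivative_at[symmetric] inner_commute[of "axis _ _"] inner_axis)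

lemma pd_eq_grad: "pd i f y = grad f y $ i"
  by (simp add: grad_def)

lemma continuous_on_grad: "(\<And>i. continuous_on S (pd i f)) \<Longrightarrow> continuous_on S (grad f)"
  unfolding grad_def[abs_def] by (intro continuous_on_vec_lambda) simp

lemma C_k_on_differentiable:
  assumes "C_k_on (Suc k) f U" "open U" "y \<in> U"
  shows "f differentiable (at y)"
  using assms at_within_open[of y U] by (auto simp: differentiable_on_def)

lemma C_k_on_mono: "C_k_on (Suc k) f U \<Longrightarrow> C_k_on k f U"
proof (induction k arbitrary: f)
  case 0
  then show ?case by (simp add: differentiable_imp_continuous_on)
qed auto

lemma C_k_on_pd: "C_k_on (Suc k) f U \<Longrightarrow> C_k_on k (pd i f) U"
  by (simp add: pd_def[abs_def] axis_in_Basis_iff)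

lemma C1_pd_continuous:
  assumes "C_k_on (Suc k) f U"
  shows "continuous_on U (pd i f)"
  using C_k_on_pd[OF assms, of i] by (cases k) (simp_all add: differentiable_imp_continuous_on)

lemma lipschitz_on_cball:
  fixes f :: "real^3 \<Rightarrow> real"
  assumes "C_k_on (Suc k) f U" "open U" "cball p R \<subseteq> U"
  obtains L where "L \<ge> 0" "\<And>x y. x \<in> cball p R \<Longrightarrow> y \<in> cball p R \<Longrightarrow> \<bar>f x - f y\<bar> \<le> L * norm (x - y)"
    "\<And>x. x \<in> cball p R \<Longrightarrow> norm (grad f x) \<le> L"
proof -
  have "continuous_on (cball p R) (grad f)"
    using C1_pd_continuous[OF assms(1)] assms(3) by (intro continuous_on_grad) (metis continuous_on_subset)
  then have "bounded (grad f ` cball p R)"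
    by (intro compact_imp_bounded compact_continuous_image) auto
  then obtain L where L: "\<forall>v\<in>grad f ` cball p R. norm v \<le> L" "L > 0"
    by (metis bounded_pos)
  have "norm (f x - f y) \<le> L * norm (x - y)" if "x \<in> cball p R" "y \<in> cball p R" for x y
  proof (rule differentiable_bound[OF convex_cball _ _ that(1,2)])
    fix z assume z: "z \<in> cball p R"
    have "f differentiable (at z)"
      by (rule C_k_on_differentiable[OF assms(1,2) subsetD[OF assms(3) z]])
    then show "(f has_derivative (\<lambda>h. h \<bullet> grad f z)) (at z within cball p R)"
      by (rule has_derivative_at_withinI[OF has_derivative_grad])
    show "onorm (\<lambda>h. h \<bullet> grad f z) \<le> L"
    proof (rule onorm_le)
      fix h
      have "norm (h \<bullet> grad f z) \<le> norm h * norm (grad f z)"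
        by (simp add: Cauchy_Schwarz_ineq2)
      also have "\<dots> = norm (grad f z) * norm h"
        by (rule mult.commute)
      also have "\<dots> \<le> L * norm h"
        using L(1) z by (intro mult_right_mono norm_ge_zero) blast
      finally show "norm (h \<bullet> grad f z) \<le> L * norm h" .
    qed
  qed
  then show thesis
    using that[of L] L by simp
qed

lemma directional_increment_le:
  fixes f :: "real^3 \<Rightarrow> real"
  assumes "\<And>s. 0 \<le> s \<Longrightarrow> s \<le> t \<Longrightarrow> f differentiable (at (x + s *\<^sub>R z))" "0 \<le> t"
    and "\<And>s. 0 \<le> s \<Longrightarrow> s \<le> t \<Longrightarrow> z \<bullet> grad f (x + s *\<^sub>R z) \<le> c"
  shows "f (x + t *\<^sub>R z) \<le> f x + c * t"
proof -
  have "(\<lambda>s. f (x + s *\<^sub>R z) - c * s) t \<le> (\<lambda>s. f (x + s *\<^sub>R z) - c * s) 0"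
  proof (rule DERIV_nonpos_imp_nonincreasing[OF assms(2)])
    fix s assume s: "0 \<le> s" "s \<le> t"
    have "((\<lambda>s. f (x + s *\<^sub>R z)) has_derivative (\<lambda>d. (d *\<^sub>R z) \<bullet> grad f (x + s *\<^sub>R z))) (at s)"
      by (rule has_derivative_compose[of "\<lambda>s. x + s *\<^sub>R z" _ s UNIV f, OF _ has_derivative_grad[OF assms(1)[OF s]]])
         (auto intro!: derivative_eq_intros)
    then have "((\<lambda>s. f (x + s *\<^sub>R z)) has_real_derivative z \<bullet> grad f (x + s *\<^sub>R z)) (at s)"
      by (simp add: has_field_derivative_def mult_commute_abs)
    then have "((\<lambda>s. f (x + s *\<^sub>R z) - c * s) has_real_derivative (z \<bullet> grad f (x + s *\<^sub>R z) - c)) (at s)"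
      by (auto intro!: derivative_eq_intros)
    then show "\<exists>y. ((\<lambda>s. f (x + s *\<^sub>R z) - c * s) has_real_derivative y) (at s) \<and> y \<le> 0"
      using assms(3)[OF s] by (intro exI conjI) auto
  qed
  then show ?thesis by simp
qed

section \<open>Star-shapedness with respect to boxes\<close>

lemma norm_le_cube:
  fixes v :: "real^3"
  assumes "\<And>i. \<bar>v $ i\<bar> \<le> \<delta>"
  shows "norm v \<le> 3 * \<delta>"
proof -
  have "norm v \<le> (\<Sum>i\<in>UNIV. \<bar>v $ i\<bar>)"
    by (rule norm_le_l1_cart)
  also have "\<dots> \<le> (\<Sum>i\<in>(UNIV::3 set). \<delta>)"
    by (intro sum_mono assms)
  finally show ?thesis by simp
qed

text \<open>Continuity of the gradient at p keeps it in a narrow cone around n. The tolerance 1/4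
  leaves a definite rate of change of \<psi> along all directions close to n or -n.\<close>

lemma boundary_chart:
  assumes loc: "local_defining_function S p U \<psi>"
  obtains R n where "R > 0" "cball p R \<subseteq> U" "n \<noteq> 0"
    "\<And>y. y \<in> cball p R \<Longrightarrow> norm (grad \<psi> y - n) \<le> norm n / 4"
proof -
  have U: "open U" "p \<in> U" and sm: "C_k_on 1 \<psi> U" and nz: "grad \<psi> p \<noteq> 0"
    using loc by (auto simp: local_defining_function_def smooth_on_def)
  have "continuous_on U (grad \<psi>)"
    using C1_pd_continuous[of 0] sm by (intro continuous_on_grad) simp
  then have "isCont (grad \<psi>) p"
    using U continuous_on_eq_continuous_at by blast
  then obtain d where d: "d > 0" "\<And>y. dist y p < d \<Longrightarrow> dist (grad \<psi> y) (grad \<psi> p) < norm (grad \<psi> p) / 4"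
    unfolding continuous_at_eps_delta using nz by (metis divide_pos_pos zero_less_norm_iff zero_less_numeral)
  obtain e where e: "e > 0" "ball p e \<subseteq> U"
    using U openE by blast
  show thesis
  proof (rule that[of "min d e / 2" "grad \<psi> p"])
    show "cball p (min d e / 2) \<subseteq> U"
      using e d by (intro subset_trans[OF _ e(2)]) (auto simp: subset_iff)
    show "norm (grad \<psi> y - grad \<psi> p) \<le> norm (grad \<psi> p) / 4" if "y \<in> cball p (min d e / 2)" for y
      using d(2)[of y] that d(1) e(1) by (auto simp: dist_norm norm_minus_commute)
  qed (use d e nz in auto)
qed

text \<open>Near p the function \<psi> decreases strictly along every direction close to -n. The box
  is a small cube around q, which is p moved inwards along -n by R / 4. A segment from x near p to a
  point of the cube has such a direction and stays in the chart, so \<psi> remains negative along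
  it.\<close>

lemma star_box_boundary:
  assumes S: "open S" and loc: "local_defining_function S p U \<psi>"
  shows "\<exists>R>0. \<exists>lo hi. \<forall>x\<in>S \<inter> ball p R. star_box S x lo hi"
proof -
  obtain R n where R: "R > 0" "cball p R \<subseteq> U" "n \<noteq> 0"
    "\<And>y. y \<in> cball p R \<Longrightarrow> norm (grad \<psi> y - n) \<le> norm n / 4"
    using boundary_chart[OF loc] by metis
  have U: "open U" and sm: "C_k_on 1 \<psi> U" and SU: "S \<inter> U = {x\<in>U. \<psi> x < 0}"
    using loc by (auto simp: local_defining_function_def smooth_on_def)
  define c where "c = - (R / (4 * norm n)) *\<^sub>R n"
  have nc: "norm c = R / 4"
    using R by (simp add: c_def)
  have cn: "c \<bullet> n = - (R * norm n / 4)"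
    using R by (simp add: c_def dot_square_norm power2_eq_square)
  \<comment> \<open>The main term -R |n| / 4 outweighs the errors 5 R |n| / 64, from z, and R |n| /
    16, from the gradient.\<close>
  have down: "z \<bullet> grad \<psi> y \<le> - (R * norm n / 64)" if y: "y \<in> cball p R" and z: "norm (z - c) \<le> R / 16" for y z
  proof -
    have "z \<bullet> grad \<psi> y = c \<bullet> n + (z - c) \<bullet> grad \<psi> y + c \<bullet> (grad \<psi> y - n)"
      by (simp add: inner_diff_left inner_diff_right)
    moreover have "(z - c) \<bullet> grad \<psi> y \<le> R / 16 * (5 / 4 * norm n)"
    proof -
      have "norm (grad \<psi> y) \<le> 5 / 4 * norm n"
        using R(4)[OF y] norm_triangle_ineq2[of "grad \<psi> y" n] by simp
      then have "norm (z - c) * norm (grad \<psi> y) \<le> R / 16 * (5 / 4 * norm n)"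
        using z R by (intro mult_mono) auto
      then show ?thesis
        using norm_cauchy_schwarz[of "z - c" "grad \<psi> y"] by linarith
    qed
    moreover have "c \<bullet> (grad \<psi> y - n) \<le> R / 4 * (norm n / 4)"
    proof -
      have "norm c * norm (grad \<psi> y - n) \<le> R / 4 * (norm n / 4)"
        using R(4)[OF y] R nc by (intro mult_mono) auto
      then show ?thesis
        using norm_cauchy_schwarz[of c "grad \<psi> y - n"] by linarith
    qed
    moreover have "0 < R * norm n"
      using R by simp
    ultimately show ?thesis
      using cn by linarith
  qed
  define q where "q = p + c"
  \<comment> \<open>The cube then lies within 3 \<delta> = R / 32 of q. Together with x within R /
    32 of p this gives the deviation R / 16 of y - x from c that \<open>down\<close>
    tolerates.\<close>
  define \<delta> where "\<delta> = R / 96"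
  define lo where "lo = (\<chi> i. q $ i - \<delta>)"
  define hi where "hi = (\<chi> i. q $ i + \<delta>)"
  have sb: "star_box S x lo hi" if x: "x \<in> S \<inter> ball p (R / 32)" for x
    unfolding star_box_def
  proof (intro conjI allI impI ballI)
    show "lo $ i < hi $ i" for i
      using R by (simp add: lo_def hi_def \<delta>_def)
    fix s y assume s: "0 < s \<and> s \<le> (1::real)" and y: "y \<in> cbox lo hi"
    have "\<bar>(y - q) $ i\<bar> \<le> \<delta>" for i
      using y by (auto simp: mem_box_cart lo_def hi_def abs_le_iff algebra_simps)
    from norm_le_cube[OF this] have "norm (y - q) \<le> R / 32"
      by (simp add: \<delta>_def)
    moreover have xp: "norm (x - p) \<le> R / 32"
      using x by (simp add: dist_norm norm_minus_commute)
    ultimately have zc: "norm (y - x - c) \<le> R / 16"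
      using norm_triangle_ineq4[of "y - q" "x - p"] by (simp add: q_def algebra_simps)
    then have nz: "norm (y - x) \<le> 5 * R / 16"
      using norm_triangle_ineq2[of "y - x" c] nc by simp
    have inb: "x + t *\<^sub>R (y - x) \<in> cball p R" if "0 \<le> t" "t \<le> 1" for t
    proof -
      have "norm (t *\<^sub>R (y - x)) \<le> norm (y - x)"
        using that by (simp add: mult_left_le_one_le)
      then have "norm (x + t *\<^sub>R (y - x) - p) \<le> R / 32 + 5 * R / 16"
        using norm_triangle_ineq[of "x - p" "t *\<^sub>R (y - x)"] xp nz by (simp add: algebra_simps)
      then show ?thesis
        using R by (simp add: dist_norm norm_minus_commute)
    qed
    have "\<psi> (x + s *\<^sub>R (y - x)) \<le> \<psi> x + - (R * norm n / 64) * s"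
      using s inb R(2) sm U zc
      by (intro directional_increment_le down) (auto intro!: C_k_on_differentiable[of 0 \<psi> U])
    moreover have "\<psi> x < 0"
      using SU x inb[of 0] R(2) by auto
    moreover have "0 < R * norm n / 64 * s"
      using R s by simp
    ultimately have "\<psi> (x + s *\<^sub>R (y - x)) < 0"
      by linarith
    then show "x + s *\<^sub>R (y - x) \<in> S"
      using SU inb[of s] s R(2) by auto
  qed
  then show ?thesis
    using R(1) by (intro exI[of _ "R / 32"] conjI exI[of _ lo] exI[of _ hi] ballI sb) simp_all
qed

lemma star_box_interior:
  assumes "open S" "p \<in> S"
  shows "\<exists>R>0. \<exists>lo hi. \<forall>x\<in>S \<inter> ball p R. star_box S x lo hi"
proof -
  obtain R where R: "R > 0" "ball p R \<subseteq> S"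
    using assms openE by blast
  define lo where "lo = (\<chi> i. p $ i - R / 6)"
  define hi where "hi = (\<chi> i. p $ i + R / 6)"
  have "star_box S x lo hi" if x: "x \<in> S \<inter> ball p R" for x
    unfolding star_box_def
  proof (intro conjI allI impI ballI)
    show "lo $ i < hi $ i" for i
      using R by (simp add: lo_def hi_def)
    fix s y assume s: "0 < s \<and> s \<le> (1::real)" and y: "y \<in> cbox lo hi"
    have "\<bar>(y - p) $ i\<bar> \<le> R / 6" for i
    proof -
      have "lo $ i \<le> y $ i" "y $ i \<le> hi $ i"
        using y by (simp_all add: mem_box_cart)
      then show ?thesis
        unfolding lo_def hi_def vec_lambda_beta vector_minus_component by linarith
    qed
    from norm_le_cube[OF this] have "y \<in> ball p R"
      using R by (simp add: dist_norm norm_minus_commute)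
    then have "(1 - s) *\<^sub>R x + s *\<^sub>R y \<in> ball p R"
      using x s by (intro convexD[OF convex_ball]) auto
    moreover have "x + s *\<^sub>R (y - x) = (1 - s) *\<^sub>R x + s *\<^sub>R y"
      by (simp add: algebra_simps)
    ultimately show "x + s *\<^sub>R (y - x) \<in> S"
      using R by auto
  qed
  then show ?thesis
    using R(1) by blast
qed

lemma star_box_local:
  assumes "smooth_bounded_domain S" "p \<in> closure S"
  shows "\<exists>R>0. \<exists>lo hi. \<forall>x\<in>S \<inter> ball p R. star_box S x lo hi"
proof (cases "p \<in> S")
  case False
  then have "p \<in> frontier S"
    using assms by (simp add: frontier_def smooth_bounded_domain_def interior_open)
  then show ?thesis
    using assms(1) star_box_boundary unfolding smooth_bounded_domain_def by blast
qed (use assms star_box_interior in \<open>auto simp: smooth_bounded_domain_def\<close>)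

section \<open>The boundary barrier\<close>

text \<open>The slip condition enters only through \<open>v \<bullet> n = 0\<close>.\<close>

definition tame_field :: "(real^3) set \<Rightarrow> (real^3 \<Rightarrow> real^3) \<Rightarrow> real \<Rightarrow> bool" where
  "tame_field S v K \<longleftrightarrow>
     (\<forall>y\<in>S. v differentiable (at y) \<and> norm (v y) \<le> K \<and> (\<forall>h. norm (frechet_derivative v (at y) h) \<le> K * norm h)) \<and>
     (\<forall>q\<in>frontier S. \<forall>\<nu>. outward_unit_normal S q \<nu> \<longrightarrow> ((\<lambda>y. v y \<bullet> \<nu>) \<longlongrightarrow> 0) (at q within S))"

lemma ball_infdist_frontier_subset:
  fixes S :: "'a::real_normed_vector set"
  assumes "x \<in> S" "frontier S \<noteq> {}"
  shows "ball x (infdist x (frontier S)) \<subseteq> S"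
proof (rule ccontr)
  assume "\<not> ?thesis"
  then have "ball x (infdist x (frontier S)) - S \<noteq> {}"
    by blast
  moreover from this have "0 < infdist x (frontier S)"
    by (metis Diff_eq_empty_iff ball_empty empty_subsetI not_le)
  then have "ball x (infdist x (frontier S)) \<inter> S \<noteq> {}"
    using assms(1) centre_in_ball by blast
  ultimately have "ball x (infdist x (frontier S)) \<inter> frontier S \<noteq> {}"
    using connected_Int_frontier[of "ball x (infdist x (frontier S))" S]
      connected_ball[of x "infdist x (frontier S)"] by blast
  then obtain y where "y \<in> ball x (infdist x (frontier S))" "y \<in> frontier S"
    by blast
  then show False
    using infdist_le[of y "frontier S" x] by simp
qed

text \<open>As y is a nearest boundary point, the segment from x to y runs inside S until its end.
  Along it the normal component changes by at most K times the length, and it tends to 0 at y by the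
  slip condition.\<close>

lemma tame_field_normal_component:
  assumes S: "open S" and v: "tame_field S v K" and x: "x \<in> S" and y: "y \<in> frontier S"
    and d: "dist x y = infdist x (frontier S)" and \<nu>: "outward_unit_normal S y \<nu>" "norm \<nu> = 1"
  shows "\<bar>v x \<bullet> \<nu>\<bar> \<le> K * dist x y"
proof -
  define X where "X s = x + s *\<^sub>R (y - x)" for s :: real
  have XS: "X s \<in> S" if "0 \<le> s" "s < 1" for s
  proof -
    have "dist x y > 0"
      using x y S by (metis disjoint_iff frontier_disjoint_eq zero_less_dist_iff)
    then have "dist x (X s) < dist x y"
      using that by (simp add: X_def dist_norm norm_minus_commute)
    then show ?thesis
      using ball_infdist_frontier_subset[OF x] y d by (auto simp: subset_iff)
  qed
  have near: "\<bar>v x \<bullet> \<nu> - v (X s) \<bullet> \<nu>\<bar> \<le> K * dist x y" if s: "0 \<le> s" "s < 1" for s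
  proof -
    have K0: "K \<ge> 0"
      using v x unfolding tame_field_def by (metis norm_ge_zero order_trans)
    have "norm (v (x + s *\<^sub>R (y - x)) - v x) \<le> (K * norm (y - x)) * s"
    proof (rule norm_increment_le[where F' = "\<lambda>z. frechet_derivative v (at z)"])
      fix t assume "t \<in> {0..s}"
      then have "x + t *\<^sub>R (y - x) \<in> S"
        using XS[of t] s by (simp add: X_def)
      then show "(v has_derivative frechet_derivative v (at (x + t *\<^sub>R (y - x)))) (at (x + t *\<^sub>R (y - x)))"
        "norm (frechet_derivative v (at (x + t *\<^sub>R (y - x))) (y - x)) \<le> K * norm (y - x)"
        using v by (auto simp: tame_field_def frechet_derivative_works)
    qed (use s in auto)
    also have "\<dots> \<le> K * norm (y - x) * 1"
      using s K0 by (intro mult_left_mono) auto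
    finally have "norm (v x - v (X s)) \<le> K * dist x y"
      by (simp add: X_def dist_norm norm_minus_commute)
    moreover have "\<bar>(v x - v (X s)) \<bullet> \<nu>\<bar> \<le> norm (v x - v (X s)) * norm \<nu>"
      by (rule Cauchy_Schwarz_ineq2)
    ultimately show ?thesis
      using \<nu> by (simp add: inner_diff_left)
  qed
  have "((\<lambda>y. v y \<bullet> \<nu>) \<longlongrightarrow> 0) (at y within S)"
    using v y \<nu> by (auto simp: tame_field_def)
  moreover have "filterlim X (at y within S) (at_left 1)"
  proof -
    have "(X \<longlongrightarrow> x + 1 *\<^sub>R (y - x)) (at_left 1)"
      unfolding X_def by (intro tendsto_intros)
    moreover have "\<forall>\<^sub>F s in at_left 1. X s \<in> S \<and> X s \<noteq> y"
    proof -
      have "y \<notin> S"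
        using y S by (metis disjoint_iff frontier_disjoint_eq)
      then have "X s \<in> S \<and> X s \<noteq> y" if "0 < s" "s < 1" for s
        using XS[of s] that by auto
      then show ?thesis
        unfolding eventually_at_left[OF zero_less_one] by (intro exI[of _ 0]) auto
    qed
    ultimately show ?thesis
      by (simp add: filterlim_at)
  qed
  ultimately have "((\<lambda>s. v (X s) \<bullet> \<nu>) \<longlongrightarrow> 0) (at_left 1)"
    by (rule filterlim_compose)
  then have "((\<lambda>s. \<bar>v x \<bullet> \<nu> - v (X s) \<bullet> \<nu>\<bar>) \<longlongrightarrow> \<bar>v x \<bullet> \<nu> - 0\<bar>) (at_left 1)"
    by (intro tendsto_intros)
  moreover have "\<forall>\<^sub>F s in at_left 1. \<bar>v x \<bullet> \<nu> - v (X s) \<bullet> \<nu>\<bar> \<le> K * dist x y"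
    unfolding eventually_at_left[OF zero_less_one] using near by (intro exI[of _ 0]) auto
  ultimately show ?thesis
    by (intro tendsto_upperbound[where F = "at_left (1::real)"]) auto
qed

section \<open>Local barriers\<close>

lemma outward_unit_normalI:
  assumes "local_defining_function S p U \<psi>" "y \<in> U"
  shows "outward_unit_normal S y (grad \<psi> y /\<^sub>R norm (grad \<psi> y))" "norm (grad \<psi> y /\<^sub>R norm (grad \<psi> y)) = 1"
  using assms by (auto simp: outward_unit_normal_def local_defining_function_def)

abbreviation (input) bdist :: "(real^3) set \<Rightarrow> real^3 \<Rightarrow> real" where
  "bdist S x \<equiv> infdist x (frontier S)"

text \<open>Quantifying over all tame fields makes L depend on the geometry alone, so that one
  barrier serves a solution at all times.\<close>

definition defining_on :: "(real^3) set \<Rightarrow> (real^3) set \<Rightarrow> (real^3 \<Rightarrow> real) \<Rightarrow> real \<Rightarrow> real \<Rightarrow> bool" where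
  "defining_on S W \<psi> c L \<longleftrightarrow> c > 0 \<and> L \<ge> 0 \<and> (\<forall>x\<in>S \<inter> W. \<psi> differentiable (at x)) \<and>
     (\<forall>i. continuous_on (S \<inter> W) (pd i \<psi>)) \<and>
     (\<forall>x\<in>S \<inter> W. c * bdist S x \<le> - \<psi> x \<and> - \<psi> x \<le> L * bdist S x \<and>
        (\<forall>v K. tame_field S v K \<longrightarrow> \<bar>v x \<bullet> grad \<psi> x\<bar> \<le> L * K * bdist S x))"

lemma nearest_frontier_point:
  fixes S :: "(real^3) set"
  assumes "frontier S \<noteq> {}"
  obtains y where "y \<in> frontier S" "dist x y = bdist S x"
  using infdist_attains_inf[OF frontier_closed assms] by metis

lemma tame_field_nonneg: "tame_field S v K \<Longrightarrow> x \<in> S \<Longrightarrow> 0 \<le> K"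
  unfolding tame_field_def by (meson norm_ge_zero order_trans)

text \<open>Upper bound: \<psi> is Lipschitz and vanishes at the nearest boundary point y. Lower
  bound: moving from x along n by a length proportional to -\<psi>(x) leaves S, so the boundary is
  at most that far. Tangency: the gradient at y is normal, where
  \<open>tame_field_normal_component\<close> applies, and the gradient at x differs from it by at
  most L' times the distance.\<close>

lemma defining_on_boundary:
  assumes S: "open S" and p: "p \<in> frontier S" and loc: "local_defining_function S p U \<psi>"
  shows "\<exists>R>0. \<exists>\<psi> c L. defining_on S (ball p R) \<psi> c L"
proof -
  obtain R n where R: "R > 0" "cball p R \<subseteq> U" "n \<noteq> 0"
    "\<And>y. y \<in> cball p R \<Longrightarrow> norm (grad \<psi> y - n) \<le> norm n / 4"
    using boundary_chart[OF loc] by metis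
  have U: "open U" and sm: "\<And>k. C_k_on k \<psi> U" and SU: "S \<inter> U = {x\<in>U. \<psi> x < 0}"
    and fr: "frontier S \<inter> U = {x\<in>U. \<psi> x = 0}"
    using loc by (auto simp: local_defining_function_def smooth_on_def)
  have ne: "frontier S \<noteq> {}" using p by auto
  obtain L where L: "L \<ge> 0" "\<And>x y. x \<in> cball p R \<Longrightarrow> y \<in> cball p R \<Longrightarrow> \<bar>\<psi> x - \<psi> y\<bar> \<le> L * norm (x - y)"
    "\<And>x. x \<in> cball p R \<Longrightarrow> norm (grad \<psi> x) \<le> L"
    using lipschitz_on_cball[OF sm[of "Suc 0"] U R(2)] by metis
  have "\<exists>M\<ge>0. \<forall>x\<in>cball p R. \<forall>y\<in>cball p R. \<bar>pd i \<psi> x - pd i \<psi> y\<bar> \<le> M * norm (x - y)" for i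
    using lipschitz_on_cball[OF C_k_on_pd[OF sm[of "Suc (Suc 0)"]] U R(2), of i] by metis
  then obtain M where M: "\<And>i. M i \<ge> 0"
    "\<And>i x y. x \<in> cball p R \<Longrightarrow> y \<in> cball p R \<Longrightarrow> \<bar>pd i \<psi> x - pd i \<psi> y\<bar> \<le> M i * norm (x - y)"
    by metis
  define L' where "L' = (\<Sum>i\<in>UNIV. M i)"
  have L'0: "L' \<ge> 0" unfolding L'_def by (intro sum_nonneg M)
  have gradL: "norm (grad \<psi> x - grad \<psi> y) \<le> L' * norm (x - y)" if "x \<in> cball p R" "y \<in> cball p R" for x y
  proof -
    have "norm (grad \<psi> x - grad \<psi> y) \<le> (\<Sum>i\<in>UNIV. \<bar>(grad \<psi> x - grad \<psi> y) $ i\<bar>)"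
      by (rule norm_le_l1_cart)
    also have "\<dots> \<le> (\<Sum>i\<in>UNIV. M i * norm (x - y))"
      using M(2)[OF that] by (intro sum_mono) (simp add: pd_eq_grad)
    finally show ?thesis
      by (simp add: L'_def sum_distrib_right)
  qed
  \<comment> \<open>Rate of growth of \<psi> along e, the multiple of n of length R / 4: the main
    term R |n| / 4 less the error R |n| / 16.\<close>
  define \<kappa> where "\<kappa> = 3 * norm n * R / 16"
  have \<kappa>: "\<kappa> > 0" using R by (simp add: \<kappa>_def)
  define e where "e = (R / (4 * norm n)) *\<^sub>R n"
  have ne': "norm e = R / 4"
    using R by (simp add: e_def)
  have up: "e \<bullet> grad \<psi> y \<ge> \<kappa>" if y: "y \<in> cball p R" for y
  proof -
    have "e \<bullet> grad \<psi> y = e \<bullet> n + e \<bullet> (grad \<psi> y - n)"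
      by (simp add: inner_diff_right)
    moreover have "e \<bullet> n = R * norm n / 4"
      using R by (simp add: e_def dot_square_norm power2_eq_square)
    moreover have "\<bar>e \<bullet> (grad \<psi> y - n)\<bar> \<le> norm e * norm (grad \<psi> y - n)"
      by (rule Cauchy_Schwarz_ineq2)
    moreover have "norm e * norm (grad \<psi> y - n) \<le> R / 4 * (norm n / 4)"
      unfolding ne' using R(4)[OF y] R(1) by (intro mult_left_mono) auto
    ultimately show ?thesis
      by (simp add: \<kappa>_def)
  qed
  \<comment> \<open>R / 2 keeps the nearest boundary point, at distance at most 2 r from p, inside
    the chart; L r <= \<kappa> ensures that the exit time s below is at most 1.\<close>
  define r where "r = min (R / 2) (\<kappa> / (L + 1))"
  have r: "r > 0" "r \<le> R / 2" "L * r \<le> \<kappa>"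
  proof -
    show "r > 0" using R \<kappa> L by (simp add: r_def)
    show "r \<le> R / 2" unfolding r_def by (rule min.cobounded1)
    have "L * r \<le> L * (\<kappa> / (L + 1))"
      unfolding r_def using L by (intro mult_left_mono min.cobounded2)
    also have "\<dots> \<le> \<kappa>"
      using L \<kappa> by (simp add: divide_le_eq algebra_simps)
    finally show "L * r \<le> \<kappa>" .
  qed
  have diff: "\<psi> differentiable (at x)" if "x \<in> U" for x
    using C_k_on_differentiable[OF sm[of "Suc 0"] U that] .
  have pU: "p \<in> U" using R by auto
  have \<psi>p: "\<psi> p = 0" using fr p pU by auto
  have main: "4 * \<kappa> / R * bdist S x \<le> - \<psi> x \<and> - \<psi> x \<le> (L + L') * bdist S x \<and>
        (\<forall>v K. tame_field S v K \<longrightarrow> \<bar>v x \<bullet> grad \<psi> x\<bar> \<le> (L + L') * K * bdist S x)"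
    if x: "x \<in> S \<inter> ball p r" for x
  proof -
    have xc: "x \<in> cball p R" "x \<in> U" using x r R by auto
    have neg: "\<psi> x < 0" using SU x xc by auto
    obtain y where y: "y \<in> frontier S" "dist x y = bdist S x"
      using nearest_frontier_point[OF ne] by metis
    have "dist x y \<le> dist x p"
      unfolding y(2) by (rule infdist_le[OF p])
    then have "dist p y \<le> R"
      using x r dist_triangle[of p y x] by (simp add: dist_commute)
    then have yc: "y \<in> cball p R" "y \<in> U" using R(2) by auto
    have \<psi>y: "\<psi> y = 0" using fr y(1) yc by auto
    have d0: "bdist S x \<ge> 0" by (rule infdist_nonneg)
    have upper: "- \<psi> x \<le> L * bdist S x"
      using L(2)[OF xc(1) yc(1)] \<psi>y neg y(2) by (simp add: dist_norm)
    have "- \<psi> x \<le> L * norm (x - p)"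
      using L(2)[OF xc(1), of p] \<psi>p neg R by simp
    also have "\<dots> \<le> L * r"
      using x L by (intro mult_left_mono) (auto simp: dist_norm norm_minus_commute)
    finally have small: "- \<psi> x \<le> \<kappa>" using r by simp
    \<comment> \<open>By this time \<psi> has risen along e from its value at x to at least 0, so
      that x + s e lies outside S.\<close>
    define s where "s = - \<psi> x / \<kappa>"
    have s: "0 \<le> s" "s \<le> 1" using neg small \<kappa> by (auto simp: s_def divide_simps)
    have inb: "x + t *\<^sub>R e \<in> cball p R" if "0 \<le> t" "t \<le> s" for t
    proof -
      have "norm (t *\<^sub>R e) \<le> R / 4"
        using that s R ne' mult_right_mono[of t 1 "norm e"] by simp
      moreover have "norm (x - p) \<le> R / 2"
        using x r by (simp add: dist_norm norm_minus_commute)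
      ultimately have "norm (x + t *\<^sub>R e - p) \<le> R"
        using norm_triangle_ineq[of "x - p" "t *\<^sub>R e"] R by (simp add: algebra_simps)
      then show ?thesis by (simp add: dist_norm norm_minus_commute)
    qed
    have "- \<psi> (x + s *\<^sub>R e) \<le> - \<psi> x + (- \<kappa>) * s"
    proof (rule directional_increment_le[of s "\<lambda>x. - \<psi> x"])
      fix t assume t: "0 \<le> t" "t \<le> s"
      then have d: "\<psi> differentiable (at (x + t *\<^sub>R e))"
        using inb R(2) diff by blast
      then show "(\<lambda>x. - \<psi> x) differentiable (at (x + t *\<^sub>R e))"
        by (rule differentiable_minus)
      have "((\<lambda>x. - \<psi> x) has_derivative (\<lambda>h. h \<bullet> (- grad \<psi> (x + t *\<^sub>R e)))) (at (x + t *\<^sub>R e))"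
        using has_derivative_minus[OF has_derivative_grad[OF d]] by simp
      then have "grad (\<lambda>x. - \<psi> x) (x + t *\<^sub>R e) = - grad \<psi> (x + t *\<^sub>R e)"
        by (rule grad_eqI)
      then show "e \<bullet> grad (\<lambda>x. - \<psi> x) (x + t *\<^sub>R e) \<le> - \<kappa>"
        using up[OF inb[OF t]] by simp
    qed (rule s)
    then have "\<psi> (x + s *\<^sub>R e) \<ge> 0"
      using \<kappa> by (simp add: s_def)
    moreover have "x + s *\<^sub>R e \<in> U"
      using inb[of s] s R(2) by blast
    ultimately have "x + s *\<^sub>R e \<notin> S"
      using SU by force
    then have "closed_segment x (x + s *\<^sub>R e) \<inter> frontier S \<noteq> {}"
      using x by (intro connected_Int_frontier[OF connected_segment]) (auto intro!: exI[of _ x])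
    then obtain z where z: "z \<in> closed_segment x (x + s *\<^sub>R e)" "z \<in> frontier S"
      by blast
    have "bdist S x \<le> dist x z"
      by (rule infdist_le[OF z(2)])
    also have "\<dots> \<le> dist x (x + s *\<^sub>R e)"
      using segment_bound1[OF z(1)] by (simp add: dist_norm norm_minus_commute)
    also have "\<dots> = s * (R / 4)"
      using s ne' by (simp add: dist_norm)
    finally have "bdist S x * \<kappa> \<le> s * (R / 4) * \<kappa>"
      using \<kappa> by (intro mult_right_mono) auto
    also have "\<dots> = - \<psi> x * R / 4"
      using \<kappa> by (simp add: s_def)
    finally have lower: "4 * \<kappa> / R * bdist S x \<le> - \<psi> x"
      using R by (simp add: field_simps)
    have tang: "\<bar>v x \<bullet> grad \<psi> x\<bar> \<le> (L + L') * K * bdist S x" if v: "tame_field S v K" for v K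
    proof -
      define \<nu> where "\<nu> = grad \<psi> y /\<^sub>R norm (grad \<psi> y)"
      have vK: "norm (v x) \<le> K" and K0: "K \<ge> 0"
        using v x tame_field_nonneg[OF v] by (auto simp: tame_field_def)
      have "\<bar>v x \<bullet> \<nu>\<bar> \<le> K * dist x y"
        using x by (intro tame_field_normal_component[OF S v _ y])
          (auto simp: \<nu>_def intro!: outward_unit_normalI[OF loc yc(2)] outward_unit_normalI(2)[OF loc yc(2), simplified])
      then have "norm (grad \<psi> y) * \<bar>v x \<bullet> \<nu>\<bar> \<le> L * (K * dist x y)"
        using L(3)[OF yc(1)] K0 L(1) by (intro mult_mono) auto
      moreover have "grad \<psi> y = norm (grad \<psi> y) *\<^sub>R \<nu>"
        by (cases "grad \<psi> y = 0") (simp_all add: \<nu>_def)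
      then have "\<bar>v x \<bullet> grad \<psi> y\<bar> = norm (grad \<psi> y) * \<bar>v x \<bullet> \<nu>\<bar>"
        by (metis abs_mult abs_norm_cancel inner_scaleR_right)
      moreover have "\<bar>v x \<bullet> (grad \<psi> x - grad \<psi> y)\<bar> \<le> K * (L' * dist x y)"
      proof -
        have "norm (v x) * norm (grad \<psi> x - grad \<psi> y) \<le> K * (L' * dist x y)"
          using gradL[OF xc(1) yc(1)] vK K0 by (intro mult_mono) (auto simp: dist_norm)
        then show ?thesis
          using Cauchy_Schwarz_ineq2 order_trans by blast
      qed
      ultimately have "\<bar>v x \<bullet> grad \<psi> x\<bar> \<le> L * (K * dist x y) + K * (L' * dist x y)"
        by (simp add: inner_diff_right)
      then show ?thesis
        by (simp add: y(2) algebra_simps)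
    qed
    have "- \<psi> x \<le> (L + L') * bdist S x"
      using upper mult_nonneg_nonneg[OF L'0 d0] by (simp add: algebra_simps)
    with lower tang show ?thesis by blast
  qed
  have sub: "S \<inter> ball p r \<subseteq> U" using r R by auto
  have "defining_on S (ball p r) \<psi> (4 * \<kappa> / R) (L + L')"
    unfolding defining_on_def
  proof (intro conjI allI)
    show "0 < 4 * \<kappa> / R" "0 \<le> L + L'"
      using \<kappa> R L L'0 by auto
    show "continuous_on (S \<inter> ball p r) (pd i \<psi>)" for i
      by (rule continuous_on_subset[OF C1_pd_continuous[OF sm[of "Suc 0"]] sub])
    show "\<forall>x\<in>S \<inter> ball p r. \<psi> differentiable (at x)"
      using diff sub by blast
  qed (use main in blast)
  then show ?thesis
    using r(1) by blast
qed

text \<open>Away from the boundary a constant will do: its gradient is 0, and the distance to the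
  boundary lies between R and 2 b.\<close>

lemma defining_on_interior:
  assumes S: "open S" "bounded S" and p: "p \<in> S" and ne: "frontier S \<noteq> {}"
  shows "\<exists>R>0. \<exists>\<psi> c L. defining_on S (ball p R) \<psi> c L"
proof -
  define R where "R = bdist S p / 2"
  have "p \<notin> frontier S"
    using S p by (metis disjoint_iff frontier_disjoint_eq)
  then have R: "R > 0"
    using infdist_pos_not_in_closed[OF frontier_closed ne] by (simp add: R_def)
  obtain b where b: "\<And>x. x \<in> closure S \<Longrightarrow> norm x \<le> b" "b > 0"
    using bounded_closure[OF S(2)] unfolding bounded_pos by metis
  have g0: "grad (\<lambda>_. - 1) x = 0" for x
    by (rule grad_eqI) simp
  have bd: "bdist S x \<le> 2 * b" "R \<le> bdist S x" if x: "x \<in> S \<inter> ball p R" for x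
  proof -
    obtain y where y: "y \<in> frontier S" using ne by blast
    have "bdist S x \<le> dist x y" by (rule infdist_le[OF y])
    also have "\<dots> \<le> norm x + norm y" by (simp add: dist_norm norm_triangle_ineq4)
    also have "\<dots> \<le> 2 * b"
      using b(1)[of x] b(1)[of y] x y closure_subset[of S] by (auto simp: frontier_def)
    finally show "bdist S x \<le> 2 * b" .
    show "R \<le> bdist S x"
      using infdist_triangle[of p "frontier S" x] x R by (simp add: R_def)
  qed
  have "defining_on S (ball p R) (\<lambda>_. - 1) (1 / (2 * b)) (1 / R)"
    unfolding defining_on_def
  proof (intro conjI allI ballI impI)
    fix x assume x: "x \<in> S \<inter> ball p R"
    show "1 / (2 * b) * bdist S x \<le> - (- 1)" "- (- 1) \<le> 1 / R * bdist S x"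
      using bd[OF x] b R by (simp_all add: divide_simps)
    fix v K assume "tame_field S v K"
    then show "\<bar>v x \<bullet> grad (\<lambda>_. - 1) x\<bar> \<le> 1 / R * K * bdist S x"
      using R x tame_field_nonneg[of S v K x] by (simp add: g0 infdist_nonneg)
  qed (use R b in \<open>auto simp: pd_eq_grad[abs_def] g0\<close>)
  then show ?thesis
    using R by blast
qed

lemma frontier_nonempty_bounded_open:
  fixes S :: "(real^3) set"
  assumes "open S" "bounded S" "S \<noteq> {}"
  shows "frontier S \<noteq> {}"
  using assms by (metis frontier_eq_empty not_bounded_UNIV)

lemma defining_on_local:
  assumes "smooth_bounded_domain S" "p \<in> closure S"
  shows "\<exists>R>0. \<exists>\<psi> c L. defining_on S (ball p R) \<psi> c L"
proof (cases "p \<in> S")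
  case False
  then have "p \<in> frontier S"
    using assms by (simp add: frontier_def smooth_bounded_domain_def interior_open)
  then show ?thesis
    using assms(1) defining_on_boundary unfolding smooth_bounded_domain_def by blast
next
  case True
  then show ?thesis
    using assms(1) by (intro defining_on_interior frontier_nonempty_bounded_open) (auto simp: smooth_bounded_domain_def)
qed

text \<open>The lower bound is relaxed to nonnegativity because a localized piece vanishes away from
  its ball. This class is closed under sums, and the lower bound returns for the sum over a
  cover.\<close>

definition barrier_like :: "(real^3) set \<Rightarrow> (real^3 \<Rightarrow> real) \<Rightarrow> real \<Rightarrow> bool" where
  "barrier_like S D L \<longleftrightarrow> L \<ge> 0 \<and> (\<forall>x\<in>S. D differentiable (at x)) \<and> (\<forall>i. continuous_on S (pd i D)) \<and>
     (\<forall>x\<in>S. 0 \<le> D x \<and> D x \<le> L * bdist S x \<and>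
        (\<forall>v K. tame_field S v K \<longrightarrow> \<bar>v x \<bullet> grad D x\<bar> \<le> L * K * bdist S x))"

lemma grad_add:
  assumes "f differentiable (at x)" "g differentiable (at x)"
  shows "grad (\<lambda>x. f x + g x) x = grad f x + grad g x"
  by (rule grad_eqI)
     (use has_derivative_add[OF has_derivative_grad[OF assms(1)] has_derivative_grad[OF assms(2)]] in
      \<open>simp add: inner_add_right\<close>)

lemma barrier_like_add:
  assumes "barrier_like S f L" "barrier_like S g M"
  shows "barrier_like S (\<lambda>x. f x + g x) (L + M)"
proof -
  have d: "f differentiable (at x)" "g differentiable (at x)" if "x \<in> S" for x
    using assms that by (auto simp: barrier_like_def)
  have g: "grad (\<lambda>x. f x + g x) x = grad f x + grad g x" if "x \<in> S" for x
    by (rule grad_add[OF d[OF that]])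
  have "continuous_on S (pd i (\<lambda>x. f x + g x))" for i
  proof (rule continuous_on_eq[of _ "\<lambda>x. pd i f x + pd i g x"])
    show "continuous_on S (\<lambda>x. pd i f x + pd i g x)"
      using assms by (intro continuous_on_add) (auto simp: barrier_like_def)
  qed (simp add: pd_eq_grad g)
  moreover have "\<bar>v x \<bullet> grad (\<lambda>x. f x + g x) x\<bar> \<le> (L + M) * K * bdist S x"
    if x: "x \<in> S" and v: "tame_field S v K" for x v K
  proof -
    have "\<bar>v x \<bullet> grad f x\<bar> \<le> L * K * bdist S x" "\<bar>v x \<bullet> grad g x\<bar> \<le> M * K * bdist S x"
      using assms x v by (auto simp: barrier_like_def)
    then show ?thesis
      using abs_triangle_ineq[of "v x \<bullet> grad f x" "v x \<bullet> grad g x"] by (simp add: g[OF x] inner_add_right algebra_simps)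
  qed
  moreover have "f x + g x \<le> (L + M) * bdist S x" "0 \<le> f x + g x" if "x \<in> S" for x
    using assms that by (auto simp: barrier_like_def distrib_right intro: add_mono)
  ultimately show ?thesis
    using assms d by (auto simp: barrier_like_def intro!: derivative_intros)
qed

lemma grad_zero: "grad (\<lambda>_. 0) x = 0"
  by (rule grad_eqI) simp

lemma barrier_like_0: "barrier_like S (\<lambda>_. 0) 0"
  by (auto simp: barrier_like_def grad_zero pd_eq_grad infdist_nonneg)

lemma barrier_like_sum:
  assumes "finite A" "\<And>a. a \<in> A \<Longrightarrow> \<exists>L. barrier_like S (D a) L"
  shows "\<exists>L. barrier_like S (\<lambda>x. \<Sum>a\<in>A. D a x) L"
  using assms
proof (induction A)
  case empty
  then show ?case using barrier_like_0 by auto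
next
  case (insert a A)
  then show ?case using barrier_like_add by (fastforce simp: insert)
qed

section \<open>Cutting off and gluing\<close>

lemma max0_square_has_derivative: "((\<lambda>t::real. (max 0 t)\<^sup>2) has_real_derivative 2 * max 0 t) (at t)"
proof -
  consider "t > 0" | "t < 0" | "t = 0" by linarith
  then show ?thesis
  proof cases
    case 1
    have "((\<lambda>t::real. t\<^sup>2) has_real_derivative 2 * max 0 t) (at t)"
      using 1 by (auto intro!: derivative_eq_intros)
    then show ?thesis
      by (rule has_field_derivative_transform_within_open[of _ _ _ "{0<..}"]) (use 1 in auto)
  next
    case 2
    have "((\<lambda>t::real. 0) has_real_derivative 2 * max 0 t) (at t)"
      using 2 by (auto intro!: derivative_eq_intros)
    then show ?thesis
      by (rule has_field_derivative_transform_within_open[of _ _ _ "{..<0}"]) (use 2 in auto)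
  next
    case 3
    have "((\<lambda>h::real. (max 0 h)\<^sup>2 / h) \<longlongrightarrow> 0) (at 0)"
    proof (rule tendsto_rabs_zero_cancel, rule tendsto_sandwich[of "\<lambda>_. 0" _ _ "\<lambda>h. \<bar>h\<bar>"])
      show "\<forall>\<^sub>F h in at (0::real). \<bar>(max 0 h)\<^sup>2 / h\<bar> \<le> \<bar>h\<bar>"
        by (intro always_eventually allI) (auto simp: max_def power2_eq_square)
      show "((\<lambda>h::real. \<bar>h\<bar>) \<longlongrightarrow> 0) (at 0)"
        by (rule tendsto_rabs_zero) (rule tendsto_ident_at)
    qed auto
    then show ?thesis
      using 3 by (simp add: DERIV_def)
  qed
qed

text \<open>A C^1 cutoff suffices since the barrier is differentiated once only; the outer square
  smooths the positive part.\<close>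

definition ball_cutoff :: "real^3 \<Rightarrow> real \<Rightarrow> real^3 \<Rightarrow> real" where
  "ball_cutoff p R x = (max 0 (R\<^sup>2 - (x - p) \<bullet> (x - p)))\<^sup>2"

lemma ball_cutoff_has_derivative:
  "(ball_cutoff p R has_derivative (\<lambda>h. h \<bullet> (- (4 * max 0 (R\<^sup>2 - (x - p) \<bullet> (x - p))) *\<^sub>R (x - p)))) (at x)"
proof -
  have "((\<lambda>x. R\<^sup>2 - (x - p) \<bullet> (x - p)) has_derivative (\<lambda>h. - 2 * (h \<bullet> (x - p)))) (at x)"
    by (rule derivative_eq_intros refl)+ (auto simp: inner_commute)
  from has_derivative_compose[OF this max0_square_has_derivative[unfolded has_field_derivative_def]]
  have "(ball_cutoff p R has_derivative
      (\<lambda>h. 2 * max 0 (R\<^sup>2 - (x - p) \<bullet> (x - p)) * (- 2 * (h \<bullet> (x - p))))) (at x)"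
    by (simp add: ball_cutoff_def[abs_def])
  then show ?thesis
    by (rule has_derivative_eq_rhs) (auto simp: fun_eq_iff)
qed

lemma ball_cutoff_eq_0: "R > 0 \<Longrightarrow> x \<notin> ball p R \<Longrightarrow> ball_cutoff p R x = 0"
  by (simp add: ball_cutoff_def dist_norm dot_square_norm norm_minus_commute power_mono max_def)

lemma ball_cutoff_lower:
  assumes "R > 0" "x \<in> ball p (R / 2)"
  shows "R ^ 4 / 4 \<le> ball_cutoff p R x"
proof -
  have "(norm (x - p))\<^sup>2 \<le> (R / 2)\<^sup>2"
    using assms by (intro power_mono) (auto simp: dist_norm norm_minus_commute)
  then have "R\<^sup>2 / 2 \<le> R\<^sup>2 - (x - p) \<bullet> (x - p)"
  proof -
    have "(R / 2)\<^sup>2 = R\<^sup>2 / 4"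
      by (simp add: power_divide)
    moreover assume "(norm (x - p))\<^sup>2 \<le> (R / 2)\<^sup>2"
    ultimately show ?thesis
      unfolding dot_square_norm using zero_le_power2[of R] by linarith
  qed
  then have "R\<^sup>2 / 2 \<le> max 0 (R\<^sup>2 - (x - p) \<bullet> (x - p))"
    by (rule order_trans[OF _ max.cobounded2])
  then have "(R\<^sup>2 / 2)\<^sup>2 \<le> ball_cutoff p R x"
    unfolding ball_cutoff_def by (intro power_mono) auto
  then show ?thesis
    by (simp add: power_divide flip: power_mult)
qed

text \<open>The cutoff vanishes outside the ball of radius R while \<psi> is controlled on radius 2
  R, so the extension by zero is C^1 across the overlap of \<open>W\<close> and \<open>W'\<close>.
  The new term in the product rule carries \<psi> itself as a factor and is therefore again of the
  order of the distance to the boundary.\<close>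

lemma localized_barrier:
  assumes S: "open S" and def: "defining_on S (ball p (2 * R)) \<psi> c L" and R: "R > 0"
  defines "D \<equiv> (\<lambda>x. if x \<in> ball p (2 * R) then ball_cutoff p R x * (- \<psi> x) else 0)"
  shows "\<exists>L. barrier_like S D L"
    and "x \<in> S \<inter> ball p (R / 2) \<Longrightarrow> R ^ 4 / 4 * c * bdist S x \<le> D x"
proof -
  define \<eta> where "\<eta> = ball_cutoff p R"
  have L0: "L \<ge> 0" and c0: "c > 0"
    using def by (auto simp: defining_on_def)
  have \<eta>d: "\<eta> differentiable (at x)" for x
    using ball_cutoff_has_derivative unfolding \<eta>_def differentiable_def by blast
  have g\<eta>: "grad \<eta> x = - (4 * max 0 (R\<^sup>2 - (x - p) \<bullet> (x - p))) *\<^sub>R (x - p)" for x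
    unfolding \<eta>_def by (rule grad_eqI[OF ball_cutoff_has_derivative])
  have \<eta>0: "0 \<le> \<eta> x" "\<eta> x \<le> R ^ 4" for x
  proof -
    show "0 \<le> \<eta> x" by (simp add: \<eta>_def ball_cutoff_def)
    have "max 0 (R\<^sup>2 - (x - p) \<bullet> (x - p)) \<le> R\<^sup>2" by simp
    then have "\<eta> x \<le> (R\<^sup>2)\<^sup>2"
      unfolding \<eta>_def ball_cutoff_def by (intro power_mono) auto
    then show "\<eta> x \<le> R ^ 4" by (simp flip: power_mult)
  qed
  define W where "W = S \<inter> ball p (2 * R)"
  define W' where "W' = S \<inter> - cball p R"
  have W: "open W" "open W'" "W \<union> W' = S"
    using S R by (auto simp: W_def W'_def)
  have D_W: "D x = \<eta> x * (- \<psi> x)" if "x \<in> W" for x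
    using that by (simp add: D_def W_def \<eta>_def)
  have D_W': "D x = 0" if "x \<in> W'" for x
    using that R by (simp add: D_def W'_def ball_cutoff_eq_0)
  have der_W: "D differentiable (at x)" "grad D x = - (\<eta> x *\<^sub>R grad \<psi> x + \<psi> x *\<^sub>R grad \<eta> x)" if x: "x \<in> W" for x
  proof -
    have \<psi>d: "\<psi> differentiable (at x)"
      using def x by (auto simp: defining_on_def W_def)
    have "((\<lambda>x. \<eta> x * (- \<psi> x)) has_derivative (\<lambda>h. h \<bullet> (- (\<eta> x *\<^sub>R grad \<psi> x + \<psi> x *\<^sub>R grad \<eta> x)))) (at x)"
      using has_derivative_mult[OF has_derivative_grad[OF \<eta>d[of x]] has_derivative_minus[OF has_derivative_grad[OF \<psi>d]]]
      by (rule has_derivative_eq_rhs) (auto simp: fun_eq_iff inner_add_right inner_diff_right algebra_simps)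
    then have *: "(D has_derivative (\<lambda>h. h \<bullet> (- (\<eta> x *\<^sub>R grad \<psi> x + \<psi> x *\<^sub>R grad \<eta> x)))) (at x)"
      by (rule has_derivative_transform_within_open[OF _ W(1) x]) (simp add: D_W)
    then show "D differentiable (at x)" using differentiable_def by blast
    show "grad D x = - (\<eta> x *\<^sub>R grad \<psi> x + \<psi> x *\<^sub>R grad \<eta> x)" by (rule grad_eqI[OF *])
  qed
  have der_W': "D differentiable (at x)" "grad D x = 0" if x: "x \<in> W'" for x
  proof -
    have "((\<lambda>_. 0::real) has_derivative (\<lambda>h. h \<bullet> 0)) (at x)" by simp
    then have *: "(D has_derivative (\<lambda>h. h \<bullet> 0)) (at x)"
      by (rule has_derivative_transform_within_open[OF _ W(2) x]) (simp add: D_W')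
    then show "D differentiable (at x)" using differentiable_def by blast
    show "grad D x = 0" by (rule grad_eqI[OF *])
  qed
  have contD: "continuous_on S (pd i D)" for i
  proof -
    have c\<psi>: "continuous_on W (\<lambda>x. grad \<psi> x $ i)" "continuous_on W \<psi>"
      using def by (auto simp: defining_on_def W_def pd_eq_grad[abs_def]
          intro!: continuous_at_imp_continuous_on differentiable_imp_continuous_within)
    have c\<eta>: "continuous_on W \<eta>"
      using \<eta>d by (auto intro!: continuous_at_imp_continuous_on differentiable_imp_continuous_within)
    have "continuous_on W (pd i D)"
      by (rule continuous_on_eq[of _ "\<lambda>x. - (\<eta> x * grad \<psi> x $ i + \<psi> x * grad \<eta> x $ i)"])
         (auto simp: pd_eq_grad der_W g\<eta> intro!: continuous_intros c\<psi> c\<eta>)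
    moreover have "continuous_on W' (pd i D)"
      by (rule continuous_on_eq[of _ "\<lambda>x. 0"]) (auto simp: pd_eq_grad der_W')
    ultimately show ?thesis
      using continuous_on_open_Un[OF W(1,2)] W(3) by metis
  qed
  have g\<eta>b: "norm (grad \<eta> x) \<le> 8 * R ^ 3" if "x \<in> W" for x
  proof -
    have "norm (grad \<eta> x) = 4 * max 0 (R\<^sup>2 - (x - p) \<bullet> (x - p)) * norm (x - p)"
      by (simp add: g\<eta>)
    also have "\<dots> \<le> 4 * R\<^sup>2 * (2 * R)"
      using that R by (intro mult_mono) (auto simp: W_def dist_norm norm_minus_commute)
    finally show ?thesis by (simp add: power2_eq_square power3_eq_cube)
  qed
  \<comment> \<open>R^4 bounds the cutoff \<eta> and 8 R^3 its gradient on \<open>W\<close>, one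
    summand for each term of the product rule.\<close>
  let ?L = "R ^ 4 * L + 8 * R ^ 3 * L"
  have est: "0 \<le> D x \<and> D x \<le> ?L * bdist S x \<and>
      (\<forall>v K. tame_field S v K \<longrightarrow> \<bar>v x \<bullet> grad D x\<bar> \<le> ?L * K * bdist S x)" if x: "x \<in> S" for x
  proof (cases "x \<in> W")
    case True
    have d0: "bdist S x \<ge> 0" by (rule infdist_nonneg)
    have \<psi>: "c * bdist S x \<le> - \<psi> x" "- \<psi> x \<le> L * bdist S x"
      and t\<psi>: "\<And>v K. tame_field S v K \<Longrightarrow> \<bar>v x \<bullet> grad \<psi> x\<bar> \<le> L * K * bdist S x"
      using def True by (auto simp: defining_on_def W_def)
    have \<psi>0: "0 \<le> - \<psi> x" using \<psi>(1) mult_nonneg_nonneg[OF less_imp_le[OF c0] d0] by linarith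
    have "\<eta> x * (- \<psi> x) \<le> R ^ 4 * (L * bdist S x)"
      using \<eta>0 \<psi> \<psi>0 R by (intro mult_mono) auto
    moreover have "0 \<le> 8 * R ^ 3 * L * bdist S x"
      using R L0 d0 by simp
    moreover have "\<bar>v x \<bullet> grad D x\<bar> \<le> ?L * K * bdist S x" if v: "tame_field S v K" for v K
    proof -
      have vK: "norm (v x) \<le> K"
        using v x by (auto simp: tame_field_def)
      have "\<bar>v x \<bullet> grad D x\<bar> \<le> \<eta> x * \<bar>v x \<bullet> grad \<psi> x\<bar> + (- \<psi> x) * \<bar>v x \<bullet> grad \<eta> x\<bar>"
      proof -
        have "v x \<bullet> grad D x = - (\<eta> x * (v x \<bullet> grad \<psi> x) + \<psi> x * (v x \<bullet> grad \<eta> x))"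
          unfolding der_W(2)[OF True] inner_minus_right inner_add_right inner_scaleR_right by (rule refl)
        then show ?thesis
          using \<eta>0[of x] \<psi>0 abs_triangle_ineq[of "\<eta> x * (v x \<bullet> grad \<psi> x)" "\<psi> x * (v x \<bullet> grad \<eta> x)"]
          by (simp only: abs_minus_cancel abs_mult) simp
      qed
      also have "\<dots> \<le> R ^ 4 * (L * K * bdist S x) + (L * bdist S x) * (K * (8 * R ^ 3))"
      proof (intro add_mono mult_mono t\<psi>[OF v] \<eta>0 \<psi>)
        have "norm (v x) * norm (grad \<eta> x) \<le> K * (8 * R ^ 3)"
          using vK g\<eta>b[OF True] tame_field_nonneg[OF v x] by (intro mult_mono) auto
        then show "\<bar>v x \<bullet> grad \<eta> x\<bar> \<le> K * (8 * R ^ 3)"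
          using Cauchy_Schwarz_ineq2 order_trans by blast
      qed (use R L0 d0 in auto)
      also have "\<dots> = ?L * K * bdist S x" by (simp add: algebra_simps)
      finally show ?thesis .
    qed
    ultimately show ?thesis
      using D_W[OF True] mult_nonneg_nonneg[OF \<eta>0(1)[of x] \<psi>0] by (simp add: algebra_simps)
  next
    case False
    then have "x \<in> W'" using W x by blast
    then show ?thesis
      using R L0 infdist_nonneg[of x "frontier S"] tame_field_nonneg[of S _ _ x] x
      by (simp add: D_W' der_W')
  qed
  have "barrier_like S D ?L"
    unfolding barrier_like_def using R L0 der_W(1) der_W'(1) contD est W(3) by auto
  then show "\<exists>L. barrier_like S D L" by blast
  show "R ^ 4 / 4 * c * bdist S x \<le> D x" if x: "x \<in> S \<inter> ball p (R / 2)"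
  proof -
    have xW: "x \<in> W" using x R by (auto simp: W_def)
    have "c * bdist S x \<le> - \<psi> x"
      using def xW by (auto simp: defining_on_def W_def)
    then have "R ^ 4 / 4 * (c * bdist S x) \<le> \<eta> x * (- \<psi> x)"
      using ball_cutoff_lower[OF R] x c0 \<eta>0 by (intro mult_mono) (auto simp: \<eta>_def infdist_nonneg)
    then show ?thesis by (simp add: D_W[OF xW])
  qed
qed

text \<open>A regularised distance to the boundary whose derivative along slip fields is controlled by
  the function itself.\<close>

lemma barrier_exists:
  assumes S: "smooth_bounded_domain S"
  obtains D c L where "c > 0" "barrier_like S D L" "\<And>x. x \<in> S \<Longrightarrow> c * bdist S x \<le> D x"
proof -
  have op: "open S" using S by (simp add: smooth_bounded_domain_def)
  have "\<forall>p\<in>closure S. \<exists>R \<psi> c L. R > 0 \<and> defining_on S (ball p (2 * R)) \<psi> c L"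
  proof
    fix p assume "p \<in> closure S"
    then obtain R \<psi> c L where "R > 0" "defining_on S (ball p R) \<psi> c L"
      using defining_on_local[OF S] by blast
    then show "\<exists>R \<psi> c L. R > 0 \<and> defining_on S (ball p (2 * R)) \<psi> c L"
      by (intro exI[of _ "R / 2"] exI[of _ \<psi>] exI[of _ c] exI[of _ L]) simp
  qed
  then obtain R \<psi> c L where def: "\<And>p. p \<in> closure S \<Longrightarrow> R p > 0"
    "\<And>p. p \<in> closure S \<Longrightarrow> defining_on S (ball p (2 * R p)) (\<psi> p) (c p) (L p)"
    by metis
  define D where "D p = (\<lambda>x. if x \<in> ball p (2 * R p) then ball_cutoff p (R p) x * (- \<psi> p x) else 0)" for p
  have cpt: "compact (closure S)"
    using S by (simp add: smooth_bounded_domain_def)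
  have cov: "closure S \<subseteq> (\<Union>p\<in>closure S. ball p (R p / 2))"
    using def(1) by fastforce
  obtain A where A: "A \<subseteq> closure S" "finite A" "closure S \<subseteq> (\<Union>p\<in>A. ball p (R p / 2))"
    by (rule compactE_image[OF cpt open_ball cov]) (rule that)
  have bl: "\<exists>M. barrier_like S (D p) M" if "p \<in> A" for p
    unfolding D_def using A(1) that def by (intro localized_barrier(1)[OF op]) auto
  obtain M where M: "barrier_like S (\<lambda>x. \<Sum>p\<in>A. D p x) M"
    using barrier_like_sum[of A S D, OF A(2) bl] by blast
  have ne: "A \<noteq> {}"
    using A(3) S by (auto simp: smooth_bounded_domain_def)
  \<comment> \<open>Each point of S lies in one of the half-size balls, where a single summand
    already gives the lower bound; the others are nonnegative.\<close>
  define c0 where "c0 = Min ((\<lambda>p. R p ^ 4 / 4 * c p) ` A)"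
  have "0 < R p ^ 4 / 4 * c p" if "p \<in> A" for p
    using def(1)[of p] def(2)[of p] that A(1) unfolding defining_on_def by (intro mult_pos_pos) auto
  then have "c0 > 0"
    unfolding c0_def using A ne by (subst Min_gr_iff) auto
  moreover have "c0 * bdist S x \<le> (\<Sum>p\<in>A. D p x)" if x: "x \<in> S" for x
  proof -
    obtain p where p: "p \<in> A" "x \<in> ball p (R p / 2)"
      using A(3) x closure_subset[of S] by blast
    have "c0 * bdist S x \<le> R p ^ 4 / 4 * c p * bdist S x"
      unfolding c0_def using A p by (intro mult_right_mono Min_le) (auto simp: infdist_nonneg)
    also have "\<dots> \<le> D p x"
      unfolding D_def using A(1) p x def by (intro localized_barrier(2)[OF op]) auto
    also have "\<dots> \<le> (\<Sum>p\<in>A. D p x)"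
    proof (rule member_le_sum[OF p(1)])
      show "0 \<le> D q x" if "q \<in> A - {p}" for q
        using bl[of q] that x by (auto simp: barrier_like_def)
    qed (rule A(2))
    finally show ?thesis .
  qed
  ultimately show thesis
    using that M by blast
qed

section \<open>Weak derivatives and Sobolev norms\<close>

lemma test_function_C_k: "test_function S \<phi> \<Longrightarrow> C_k_on k \<phi> UNIV"
  by (simp add: test_function_def smooth_on_def)

lemma test_function_eq_0: "y \<notin> closure {x. \<phi> x \<noteq> 0} \<Longrightarrow> \<phi> y = 0"
  using closure_subset[of "{x. \<phi> x \<noteq> 0}"] by blast

lemma test_function_pd:
  fixes \<phi> :: "real^3 \<Rightarrow> real"
  assumes "test_function S \<phi>"
  shows "test_function S (pd i \<phi>)"
proof -
  have "{x. pd i \<phi> x \<noteq> 0} \<subseteq> closure {x. \<phi> x \<noteq> 0}"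
  proof (rule ccontr)
    assume "\<not> ?thesis"
    then obtain y where y: "pd i \<phi> y \<noteq> 0" "y \<in> - closure {x. \<phi> x \<noteq> 0}"
      by blast
    have "pd i \<phi> y = 0"
      by (rule pd_eq_0_open[of "- closure {x. \<phi> x \<noteq> 0}"]) (use y in \<open>auto intro: test_function_eq_0\<close>)
    with y show False by simp
  qed
  then have sub: "closure {x. pd i \<phi> x \<noteq> 0} \<subseteq> closure {x. \<phi> x \<noteq> 0}"
    by (simp add: closure_minimal)
  have "C_k_on k (pd i \<phi>) UNIV" for k
    by (rule C_k_on_pd[OF test_function_C_k[OF assms]])
  then have "smooth_on UNIV (pd i \<phi>)"
    by (simp only: smooth_on_def) simp
  moreover have "compact (closure {x. \<phi> x \<noteq> 0})" "closure {x. \<phi> x \<noteq> 0} \<subseteq> S"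
    using assms by (simp_all add: test_function_def)
  moreover from this have "bounded (closure {x. pd i \<phi> x \<noteq> 0})"
    using bounded_subset[OF compact_imp_bounded sub] by blast
  ultimately show ?thesis
    using sub unfolding test_function_def compact_eq_bounded_closed by blast
qed

lemma test_function_pd_funpow: "test_function S \<phi> \<Longrightarrow> test_function S ((pd i ^^ n) \<phi>)" for \<phi> :: "real^3 \<Rightarrow> real"
  by (induction n) (auto intro: test_function_pd)

lemma test_function_mi_pd: "test_function S \<phi> \<Longrightarrow> test_function S (mi_pd \<alpha> \<phi>)" for \<phi> :: "real^3 \<Rightarrow> real"
  unfolding mi_pd_def by (intro test_function_pd_funpow)

lemma test_function_integrable:
  fixes f :: "real^3 \<Rightarrow> 'b::euclidean_space"
  assumes S: "open S" and \<phi>: "test_function S \<phi>" and f: "loc_integrable S f"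
  shows "integrable (lebesgue_on S) (\<lambda>x. \<phi> x *\<^sub>R f x)"
proof -
  define H where "H = closure {x. \<phi> x \<noteq> 0}"
  have H: "compact H" "H \<subseteq> S"
    using \<phi> by (auto simp: H_def test_function_def)
  have off: "\<phi> y = 0" if "y \<notin> H" for y
    using that unfolding H_def by (rule test_function_eq_0)
  have c: "continuous_on UNIV \<phi>"
    using test_function_C_k[OF \<phi>, of 0] by simp
  have "bounded (\<phi> ` H)"
    by (intro compact_imp_bounded compact_continuous_image continuous_on_subset[OF c] H) auto
  then obtain B where B: "\<forall>v\<in>\<phi> ` H. norm v \<le> B"
    unfolding bounded_iff by (elim exE)
  have bd: "\<bar>\<phi> y\<bar> \<le> max B 0" for y
  proof (cases "y \<in> H")
    case True
    with B have "norm (\<phi> y) \<le> B" by blast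
    then show ?thesis by simp
  qed (simp add: off)
  have "integrable (lebesgue_on H) f"
    using f H unfolding loc_integrable_def by blast
  moreover have "\<phi> \<in> borel_measurable borel"
    by (rule borel_measurable_continuous_onI[OF c])
  then have "\<phi> \<in> borel_measurable (lebesgue_on H)"
    by (intro measurable_restrict_space1) (auto intro: measurable_completion)
  ultimately have "integrable (lebesgue_on H) (\<lambda>x. \<phi> x *\<^sub>R f x)"
    by (rule integrable_bounded_scaleR) (rule bd)
  then have "integrable lebesgue (\<lambda>x. indicator H x *\<^sub>R (\<phi> x *\<^sub>R f x))"
    using H by (subst integrable_restrict_space[symmetric]) (auto simp: compact_imp_closed)
  moreover have "(\<lambda>x. indicator H x *\<^sub>R (\<phi> x *\<^sub>R f x)) = (\<lambda>x. indicator S x *\<^sub>R (\<phi> x *\<^sub>R f x))"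
    using H(2) off by (auto simp: fun_eq_iff indicator_def)
  ultimately show ?thesis
    using S by (subst integrable_restrict_space) auto
qed

lemma loc_integrable_diff:
  "loc_integrable S f \<Longrightarrow> loc_integrable S g \<Longrightarrow> loc_integrable S (\<lambda>x. f x - g x)"
  by (auto simp: loc_integrable_def)

lemma AE_eq_of_tprod_tests:
  fixes f g :: "real^3 \<Rightarrow> 'b::euclidean_space"
  assumes S: "open S" and f: "loc_integrable S f" and g: "loc_integrable S g"
    and eq: "\<And>F. (\<And>i. smooth1 (F i)) \<Longrightarrow> test_function S (tprod F) \<Longrightarrow>
      (LINT x|lebesgue_on S. tprod F x *\<^sub>R f x) = (LINT x|lebesgue_on S. tprod F x *\<^sub>R g x)"
  shows "AE x in lebesgue_on S. f x = g x"
proof -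
  have "AE x in lebesgue_on S. f x - g x = 0"
    by (rule fundamental_lemma[OF S loc_integrable_diff[OF f g]])
       (simp add: scaleR_diff_right test_function_integrable[OF S _ f] test_function_integrable[OF S _ g] eq)
  then show ?thesis
    by simp
qed

lemma is_weak_deriv_diff:
  fixes f g :: "real^3 \<Rightarrow> 'b::euclidean_space"
  assumes S: "open S" and f: "is_weak_deriv S \<alpha> f f'" and g: "is_weak_deriv S \<alpha> g g'"
  shows "is_weak_deriv S \<alpha> (\<lambda>x. f x - g x) (\<lambda>x. f' x - g' x)"
proof -
  have li: "loc_integrable S f" "loc_integrable S g" "loc_integrable S f'" "loc_integrable S g'"
    using f g by (auto simp: is_weak_deriv_def)
  show ?thesis
    unfolding is_weak_deriv_def
  proof (intro conjI allI impI loc_integrable_diff li)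
    fix \<phi> assume \<phi>: "test_function S \<phi>"
    note i = test_function_integrable[OF S test_function_mi_pd[OF \<phi>] li(1)]
      test_function_integrable[OF S test_function_mi_pd[OF \<phi>] li(2)]
      test_function_integrable[OF S \<phi> li(3)] test_function_integrable[OF S \<phi> li(4)]
    show "(LINT x|lebesgue_on S. mi_pd \<alpha> \<phi> x *\<^sub>R (f x - g x)) =
        (- 1) ^ mi_order \<alpha> *\<^sub>R (LINT x|lebesgue_on S. \<phi> x *\<^sub>R (f' x - g' x))"
      using i f g \<phi> by (simp add: scaleR_diff_right is_weak_deriv_def)
  qed
qed

lemma is_weak_deriv_unique:
  fixes f :: "real^3 \<Rightarrow> 'b::euclidean_space"
  assumes S: "open S" and "is_weak_deriv S \<alpha> f g" "is_weak_deriv S \<alpha> f h"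
  shows "AE x in lebesgue_on S. g x = h x"
proof (rule AE_eq_of_tprod_tests[OF S])
  fix F assume t: "test_function S (tprod F)"
  have "(LINT x|lebesgue_on S. mi_pd \<alpha> (tprod F) x *\<^sub>R f x) =
      (- 1) ^ mi_order \<alpha> *\<^sub>R (LINT x|lebesgue_on S. tprod F x *\<^sub>R g x)"
    using assms(2) t unfolding is_weak_deriv_def by blast
  moreover have "(LINT x|lebesgue_on S. mi_pd \<alpha> (tprod F) x *\<^sub>R f x) =
      (- 1) ^ mi_order \<alpha> *\<^sub>R (LINT x|lebesgue_on S. tprod F x *\<^sub>R h x)"
    using assms(3) t unfolding is_weak_deriv_def by blast
  ultimately have "(- 1) ^ mi_order \<alpha> *\<^sub>R (LINT x|lebesgue_on S. tprod F x *\<^sub>R g x) =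
      (- 1 :: real) ^ mi_order \<alpha> *\<^sub>R (LINT x|lebesgue_on S. tprod F x *\<^sub>R h x)"
    by (rule trans[OF sym])
  then show "(LINT x|lebesgue_on S. tprod F x *\<^sub>R g x) = (LINT x|lebesgue_on S. tprod F x *\<^sub>R h x)"
    by simp
qed (use assms in \<open>auto simp: is_weak_deriv_def\<close>)

lemma mi_order_axis: "mi_order (\<alpha> + axis j 1) = Suc (mi_order \<alpha>)"
  by (simp add: mi_order_def sum.distrib axis_def)

lemma is_weak_deriv_0: "loc_integrable S f \<Longrightarrow> is_weak_deriv S 0 f f"
  by (simp add: is_weak_deriv_def mi_pd_def mi_order_def)

text \<open>Testing the definition of g with the j-th derivative of a tensor product produces the
  multi-index \<alpha> + \<open>axis j 1\<close>, on which the definition of h can be used. The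
  orders differ by one, which leaves the sign.\<close>

lemma weak_partial_of_is_weak_deriv:
  fixes f :: "real^3 \<Rightarrow> 'b::euclidean_space"
  assumes g: "is_weak_deriv S \<alpha> f g" and h: "is_weak_deriv S (\<alpha> + axis j 1) f h"
  shows "weak_partial S j g h"
  unfolding weak_partial_def
proof (intro allI impI, elim conjE)
  fix F assume F: "\<forall>i. smooth1 (F i)" and t: "test_function S (tprod F)"
  have "(- 1) ^ mi_order \<alpha> *\<^sub>R (LINT y|lebesgue_on S. pd j (tprod F) y *\<^sub>R g y) =
      (LINT y|lebesgue_on S. mi_pd \<alpha> (pd j (tprod F)) y *\<^sub>R f y)"
    using g test_function_pd[OF t] by (simp add: is_weak_deriv_def)
  also have "\<dots> = (LINT y|lebesgue_on S. mi_pd (\<alpha> + axis j 1) (tprod F) y *\<^sub>R f y)"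
    unfolding mi_pd_add_axis_tprod[of F, OF F[rule_format]] by (rule refl)
  also have "\<dots> = (- 1) ^ mi_order (\<alpha> + axis j 1) *\<^sub>R (LINT y|lebesgue_on S. tprod F y *\<^sub>R h y)"
    using h t unfolding is_weak_deriv_def by blast
  also have "\<dots> = (- 1) ^ mi_order \<alpha> *\<^sub>R (- (LINT y|lebesgue_on S. tprod F y *\<^sub>R h y))"
    unfolding mi_order_axis by simp
  finally show "(LINT y|lebesgue_on S. pd j (tprod F) y *\<^sub>R g y) = - (LINT y|lebesgue_on S. tprod F y *\<^sub>R h y)"
    by (simp only: scaleR_cancel_left) simp
qed

lemma measurable_lebesgue_on_AE:
  fixes f g :: "real^3 \<Rightarrow> 'b::euclidean_space"
  assumes S: "S \<in> sets lebesgue" and f: "f \<in> borel_measurable (lebesgue_on S)"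
    and eq: "AE x in lebesgue_on S. f x = g x"
  shows "g \<in> borel_measurable (lebesgue_on S)"
proof -
  have "(\<lambda>x. indicator S x *\<^sub>R f x) \<in> borel_measurable lebesgue"
    using f S by (subst (asm) borel_measurable_restrict_space_iff) auto
  moreover have "AE x in lebesgue. indicator S x *\<^sub>R f x = indicator S x *\<^sub>R g x"
    using eq S by (auto simp: AE_restrict_space_iff indicator_def elim!: eventually_mono)
  ultimately have "(\<lambda>x. indicator S x *\<^sub>R g x) \<in> borel_measurable lebesgue"
    by (rule borel_measurable_AE)
  then show ?thesis
    using S by (subst borel_measurable_restrict_space_iff) auto
qed

lemma Lp_space_AE:
  fixes f g :: "real^3 \<Rightarrow> 'b::euclidean_space"
  assumes S: "S \<in> sets lebesgue" and f: "f \<in> Lp_space S p" and eq: "AE x in lebesgue_on S. f x = g x"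
  shows "g \<in> Lp_space S p" "Lp_norm S p g = Lp_norm S p f"
proof -
  have gm: "g \<in> borel_measurable (lebesgue_on S)"
    using measurable_lebesgue_on_AE[OF S _ eq] f by (simp add: Lp_space_def)
  have fm: "f \<in> borel_measurable (lebesgue_on S)"
    using f by (simp add: Lp_space_def)
  have eq': "AE x in lebesgue_on S. norm (f x) powr p = norm (g x) powr p"
    using eq by eventually_elim simp
  have m: "(\<lambda>x. norm (f x) powr p) \<in> borel_measurable (lebesgue_on S)"
    "(\<lambda>x. norm (g x) powr p) \<in> borel_measurable (lebesgue_on S)"
    using fm gm by measurable
  show "g \<in> Lp_space S p"
    using f gm integrable_cong_AE[OF m eq'] by (simp add: Lp_space_def)
  show "Lp_norm S p g = Lp_norm S p f"
    using integral_cong_AE[OF m eq'] by (simp add: Lp_norm_def)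
qed

lemma Lp_space_integrable:
  fixes f :: "real^3 \<Rightarrow> 'b::euclidean_space"
  assumes S: "open S" "bounded S" and f: "f \<in> Lp_space S p" and p: "p \<ge> 1"
  shows "integrable (lebesgue_on S) f"
proof -
  have fin: "emeasure (lebesgue_on S) S \<noteq> \<infinity>"
  proof -
    have "S \<in> lmeasurable" using S by (intro lmeasurable_open)
    then show ?thesis
      using S by (simp add: emeasure_restrict_space fmeasurable_def less_top[symmetric])
  qed
  have Sm: "S \<in> sets (lebesgue_on S)" using S by (simp add: sets_restrict_space_iff)
  have "integrable (lebesgue_on S) (\<lambda>y. indicator S y * norm (f y))"
    by (rule holder_finite_measure(1)[OF p _ _ Sm fin, of _ "measure (lebesgue_on S) S + 1"])
       (use f in \<open>auto simp: Lp_space_def intro: add_nonneg_pos\<close>)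
  then have "integrable (lebesgue_on S) (\<lambda>y. norm (f y))"
    by (rule Bochner_Integration.integrable_cong[THEN iffD1, rotated 2]) auto
  then show ?thesis
    using f by (subst (asm) integrable_norm_iff) (auto simp: Lp_space_def)
qed

text \<open>\<open>wD\<close> chooses among all weak derivatives and need not pick the
  square-integrable one provided by membership in \<open>Hk\<close>; uniqueness almost everywhere
  transfers the integrability.\<close>

lemma Hk_wD:
  fixes f :: "real^3 \<Rightarrow> 'b::euclidean_space"
  assumes S: "open S" and f: "f \<in> Hk S k" and \<alpha>: "mi_order \<alpha> \<le> k"
  shows "is_weak_deriv S \<alpha> f (wD S \<alpha> f)" "wD S \<alpha> f \<in> Lp_space S 2"
proof -
  obtain g where g: "g \<in> Lp_space S 2" "is_weak_deriv S \<alpha> f g"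
    using f \<alpha> by (auto simp: Wkp_def)
  show w: "is_weak_deriv S \<alpha> f (wD S \<alpha> f)"
    unfolding wD_def by (rule someI[of _ g]) (rule g)
  show "wD S \<alpha> f \<in> Lp_space S 2"
    using S by (intro Lp_space_AE(1)[OF _ g(1) is_weak_deriv_unique[OF S g(2) w]]) auto
qed

section \<open>The Sobolev norm and its boundedness in time\<close>

lemma finite_mi_order: "finite {\<alpha>. mi_order \<alpha> \<le> k}"
proof -
  have "finite (vec_nth -` (Pi\<^sub>E (UNIV :: 3 set) (\<lambda>_. {..k})))"
    by (intro finite_vimageI finite_PiE) (auto simp: inj_def vec_eq_iff)
  moreover have "{\<alpha>. mi_order \<alpha> \<le> k} \<subseteq> vec_nth -` (Pi\<^sub>E (UNIV :: 3 set) (\<lambda>_. {..k}))"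
  proof
    fix \<alpha> :: "nat^3" assume "\<alpha> \<in> {\<alpha>. mi_order \<alpha> \<le> k}"
    then have "\<alpha> $ i \<le> k" for i
      using member_le_sum[of i UNIV "\<lambda>i. \<alpha> $ i"] by (auto simp: mi_order_def intro: order_trans)
    then show "\<alpha> \<in> vec_nth -` (Pi\<^sub>E (UNIV :: 3 set) (\<lambda>_. {..k}))"
      by auto
  qed
  ultimately show ?thesis
    by (rule rev_finite_subset)
qed

lemma Hk_norm_nonneg: "Hk_norm S k f \<ge> 0"
  by (simp add: Wkp_norm_def)

lemma Lp_norm_wD_le_Hk_norm:
  assumes "mi_order \<alpha> \<le> k"
  shows "Lp_norm S 2 (wD S \<alpha> f) \<le> Hk_norm S k f"
  unfolding Lp_norm_def Wkp_norm_def
proof (rule powr_mono2)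
  show "(LINT x|lebesgue_on S. norm (wD S \<alpha> f x) powr 2) \<le>
      (\<Sum>\<alpha> | mi_order \<alpha> \<le> k. LINT x|lebesgue_on S. norm (wD S \<alpha> f x) powr 2)"
    by (rule member_le_sum[of \<alpha> "{\<alpha>. mi_order \<alpha> \<le> k}"]) (use assms in \<open>auto simp: finite_mi_order\<close>)
qed auto

text \<open>A crude triangle inequality, from |v|^2 <= 2 |v - w|^2 + 2 |w|^2, enough to deduce
  boundedness from continuity. As \<open>wD\<close> is a choice, it respects differences only almost
  everywhere, by uniqueness.\<close>

lemma Hk_norm_add_le:
  fixes f g :: "real^3 \<Rightarrow> 'b::euclidean_space"
  assumes S: "open S" and f: "f \<in> Hk S k" and g: "g \<in> Hk S k"
  shows "(Hk_norm S k f)\<^sup>2 \<le> 2 * (Hk_norm S k (\<lambda>x. f x - g x))\<^sup>2 + 2 * (Hk_norm S k g)\<^sup>2"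
proof -
  have sq: "(Hk_norm S k h)\<^sup>2 = (\<Sum>\<alpha> | mi_order \<alpha> \<le> k. LINT x|lebesgue_on S. norm (wD S \<alpha> h x) powr 2)"
    for h :: "real^3 \<Rightarrow> 'b"
  proof -
    have "(\<Sum>\<alpha> | mi_order \<alpha> \<le> k. LINT x|lebesgue_on S. norm (wD S \<alpha> h x) powr 2) \<ge> 0"
      by (intro sum_nonneg Bochner_Integration.integral_nonneg) auto
    then show ?thesis
      by (simp add: Wkp_norm_def powr_half_sqrt)
  qed
  have "(LINT x|lebesgue_on S. norm (wD S \<alpha> f x) powr 2) \<le>
      2 * (LINT x|lebesgue_on S. norm (wD S \<alpha> (\<lambda>x. f x - g x) x) powr 2) +
      2 * (LINT x|lebesgue_on S. norm (wD S \<alpha> g x) powr 2)" if \<alpha>: "mi_order \<alpha> \<le> k" for \<alpha>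
  proof -
    note F = Hk_wD[OF S f \<alpha>] and G = Hk_wD[OF S g \<alpha>]
    have d: "is_weak_deriv S \<alpha> (\<lambda>x. f x - g x) (\<lambda>x. wD S \<alpha> f x - wD S \<alpha> g x)"
      by (rule is_weak_deriv_diff[OF S F(1) G(1)])
    have "is_weak_deriv S \<alpha> (\<lambda>x. f x - g x) (wD S \<alpha> (\<lambda>x. f x - g x))"
      using someI[of "is_weak_deriv S \<alpha> (\<lambda>x. f x - g x)", OF d] by (simp only: wD_def)
    then have AE: "AE x in lebesgue_on S. wD S \<alpha> (\<lambda>x. f x - g x) x = wD S \<alpha> f x - wD S \<alpha> g x"
      by (rule is_weak_deriv_unique[OF S _ d])
    have AE': "AE x in lebesgue_on S. wD S \<alpha> f x - wD S \<alpha> g x = wD S \<alpha> (\<lambda>x. f x - g x) x"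
      using AE by eventually_elim (rule sym)
    have le: "norm v powr 2 \<le> 2 * norm (v - w) powr 2 + 2 * norm w powr 2" for v w :: 'b
    proof -
      have "(norm v)\<^sup>2 \<le> (norm (v - w) + norm w)\<^sup>2"
        using norm_triangle_sub[of v w] by (intro power_mono) (auto simp: add.commute)
      also have "\<dots> \<le> 2 * (norm (v - w))\<^sup>2 + 2 * (norm w)\<^sup>2"
        using sum_squares_bound[of "norm (v - w)" "norm w"] by (simp add: power2_sum)
      finally show ?thesis by simp
    qed
    have i: "integrable (lebesgue_on S) (\<lambda>x. norm (wD S \<alpha> f x) powr 2)"
      "integrable (lebesgue_on S) (\<lambda>x. norm (wD S \<alpha> g x) powr 2)"
      using F(2) G(2) by (auto simp: Lp_space_def)
    have m: "wD S \<alpha> f \<in> borel_measurable (lebesgue_on S)" "wD S \<alpha> g \<in> borel_measurable (lebesgue_on S)"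
      using F(2) G(2) by (auto simp: Lp_space_def)
    have id: "integrable (lebesgue_on S) (\<lambda>x. norm (wD S \<alpha> f x - wD S \<alpha> g x) powr 2)"
    proof (rule Bochner_Integration.integrable_bound)
      show "integrable (lebesgue_on S) (\<lambda>x. 2 * norm (wD S \<alpha> f x) powr 2 + 2 * norm (wD S \<alpha> g x) powr 2)"
        using i by simp
      show "AE x in lebesgue_on S. norm (norm (wD S \<alpha> f x - wD S \<alpha> g x) powr 2) \<le>
          norm (2 * norm (wD S \<alpha> f x) powr 2 + 2 * norm (wD S \<alpha> g x) powr 2)"
      proof (rule AE_I2)
        fix x
        show "norm (norm (wD S \<alpha> f x - wD S \<alpha> g x) powr 2) \<le>
            norm (2 * norm (wD S \<alpha> f x) powr 2 + 2 * norm (wD S \<alpha> g x) powr 2)"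
          using le[of "wD S \<alpha> f x - wD S \<alpha> g x" "- wD S \<alpha> g x"] by simp
      qed
    qed (use m in measurable)
    have "(LINT x|lebesgue_on S. norm (wD S \<alpha> f x) powr 2) \<le>
        (LINT x|lebesgue_on S. 2 * norm (wD S \<alpha> f x - wD S \<alpha> g x) powr 2 + 2 * norm (wD S \<alpha> g x) powr 2)"
      by (rule integral_mono) (use i id le in auto)
    also have "\<dots> = 2 * (LINT x|lebesgue_on S. norm (wD S \<alpha> f x - wD S \<alpha> g x) powr 2) +
        2 * (LINT x|lebesgue_on S. norm (wD S \<alpha> g x) powr 2)"
      using i id by simp
    also have "(LINT x|lebesgue_on S. norm (wD S \<alpha> f x - wD S \<alpha> g x) powr 2) =
        (LINT x|lebesgue_on S. norm (wD S \<alpha> (\<lambda>x. f x - g x) x) powr 2)"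
    proof (rule integral_cong_AE)
      have "wD S \<alpha> (\<lambda>x. f x - g x) \<in> borel_measurable (lebesgue_on S)"
        using S m by (intro measurable_lebesgue_on_AE[OF _ _ AE'] borel_measurable_diff) auto
      then show "(\<lambda>x. norm (wD S \<alpha> (\<lambda>x. f x - g x) x) powr 2) \<in> borel_measurable (lebesgue_on S)"
        by measurable
      show "(\<lambda>x. norm (wD S \<alpha> f x - wD S \<alpha> g x) powr 2) \<in> borel_measurable (lebesgue_on S)"
        using m by measurable
      show "AE x in lebesgue_on S. norm (wD S \<alpha> f x - wD S \<alpha> g x) powr 2 = norm (wD S \<alpha> (\<lambda>x. f x - g x) x) powr 2"
        using AE' by eventually_elim (simp only:)
    qed
    finally show ?thesis .
  qed
  then show ?thesis
    unfolding sq by (simp add: sum_distrib_left flip: sum.distrib) (rule sum_mono, simp)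
qed

text \<open>Continuity in norm bounds the norm near each time by its value at that time, and
  finitely many such neighbourhoods cover the compact interval.\<close>

lemma C_Hk_bounded:
  fixes v :: "real \<Rightarrow> real^3 \<Rightarrow> 'b::euclidean_space"
  assumes S: "open S" and v: "C_Hk S k {0..T} v"
  obtains B where "\<And>t. t \<in> {0..T} \<Longrightarrow> Hk_norm S k (v t) \<le> B"
proof -
  have "\<exists>d>0. \<forall>s\<in>{0..T} \<inter> ball t d. (Hk_norm S k (v s))\<^sup>2 \<le> 2 + 2 * (Hk_norm S k (v t))\<^sup>2" if t: "t \<in> {0..T}" for t
  proof -
    have "((\<lambda>s. Hk_norm S k (\<lambda>x. v s x - v t x)) \<longlongrightarrow> 0) (at t within {0..T})"
      using v t by (auto simp: C_Hk_def)
    then have "\<forall>\<^sub>F s in at t within {0..T}. Hk_norm S k (\<lambda>x. v s x - v t x) < 1"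
      by (rule order_tendstoD) simp
    then obtain d where d: "d > 0"
      "\<And>s. s \<in> {0..T} \<Longrightarrow> s \<noteq> t \<Longrightarrow> dist s t < d \<Longrightarrow> Hk_norm S k (\<lambda>x. v s x - v t x) < 1"
      unfolding eventually_at by blast
    have "(Hk_norm S k (v s))\<^sup>2 \<le> 2 + 2 * (Hk_norm S k (v t))\<^sup>2" if s: "s \<in> {0..T} \<inter> ball t d" for s
    proof (cases "s = t")
      case False
      then have "Hk_norm S k (\<lambda>x. v s x - v t x) < 1"
        using d(2)[of s] s by (auto simp: dist_commute)
      then have "(Hk_norm S k (\<lambda>x. v s x - v t x))\<^sup>2 \<le> 1"
        using Hk_norm_nonneg by (intro power_le_one) (auto intro: less_imp_le)
      then show ?thesis
        using Hk_norm_add_le[OF S, of "v s" k "v t"] v s t by (auto simp: C_Hk_def)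
    qed simp
    then show ?thesis using d by blast
  qed
  then obtain d where d: "\<And>t. t \<in> {0..T} \<Longrightarrow> d t > 0"
    "\<And>t s. t \<in> {0..T} \<Longrightarrow> s \<in> {0..T} \<inter> ball t (d t) \<Longrightarrow> (Hk_norm S k (v s))\<^sup>2 \<le> 2 + 2 * (Hk_norm S k (v t))\<^sup>2"
    by metis
  have cov: "{0..T} \<subseteq> (\<Union>t\<in>{0..T}. ball t (d t))"
    using d(1) by fastforce
  obtain A where A: "A \<subseteq> {0..T}" "finite A" "{0..T} \<subseteq> (\<Union>t\<in>A. ball t (d t))"
    by (rule compactE_image[OF compact_Icc open_ball cov]) (rule that)
  define B where "B = (\<Sum>t\<in>A. 2 + 2 * (Hk_norm S k (v t))\<^sup>2)"
  have "Hk_norm S k (v s) \<le> sqrt B" if s: "s \<in> {0..T}" for s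
  proof -
    obtain t where t: "t \<in> A" "s \<in> ball t (d t)"
      using A(3) s by blast
    have "(Hk_norm S k (v s))\<^sup>2 \<le> 2 + 2 * (Hk_norm S k (v t))\<^sup>2"
      using d(2)[of t s] t s A(1) by blast
    also have "\<dots> \<le> B"
      unfolding B_def by (rule member_le_sum[OF t(1)]) (use A in auto)
    finally show ?thesis
      by (rule real_le_rsqrt)
  qed
  then show thesis by (rule that)
qed

section \<open>Sup bounds and the Morrey estimate\<close>

lemma bounded_pos_norm:
  assumes "bounded S"
  obtains b where "b > 0" "\<And>y. y \<in> S \<Longrightarrow> norm y \<le> b"
  using assms by (auto simp: bounded_pos)

text \<open>Compactness of the closure leaves finitely many boxes, so the constants of the one-point
  estimates become constants of the domain.\<close>

lemma star_box_cover:
  assumes S: "smooth_bounded_domain S"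
  obtains A :: "(real^3) set" and R lo hi where "finite A" "A \<noteq> {}" "S \<subseteq> (\<Union>p\<in>A. ball p (R p))"
    "\<And>p x. p \<in> A \<Longrightarrow> x \<in> S \<Longrightarrow> x \<in> ball p (R p) \<Longrightarrow> star_box S x (lo p) (hi p)"
    "\<And>p i. p \<in> A \<Longrightarrow> lo p $ i < hi p $ i"
proof -
  have "\<forall>p\<in>closure S. \<exists>R lo hi. R > 0 \<and> (\<forall>x\<in>S \<inter> ball p R. star_box S x lo hi)"
    using star_box_local[OF S] by blast
  then obtain R lo hi where R: "\<And>p. p \<in> closure S \<Longrightarrow> R p > 0"
    "\<And>p x. p \<in> closure S \<Longrightarrow> x \<in> S \<Longrightarrow> x \<in> ball p (R p) \<Longrightarrow> star_box S x (lo p) (hi p)"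
    by (metis IntI)
  have cpt: "compact (closure S)"
    using S by (simp add: smooth_bounded_domain_def)
  have cov: "closure S \<subseteq> (\<Union>p\<in>closure S. ball p (R p))"
    using R(1) by fastforce
  obtain A where A: "A \<subseteq> closure S" "finite A" "closure S \<subseteq> (\<Union>p\<in>A. ball p (R p))"
    by (rule compactE_image[OF cpt open_ball cov]) (rule that)
  have ne: "S \<noteq> {}" using S by (simp add: smooth_bounded_domain_def)
  have lh: "lo p $ i < hi p $ i" if p: "p \<in> A" for p i
  proof -
    have pc: "p \<in> closure S" using p A by blast
    have "S \<inter> ball p (R p) \<noteq> {}"
      using pc R(1)[OF pc] by (metis Int_commute closure_approachable disjoint_iff dist_commute mem_ball)
    then obtain x where "x \<in> S" "x \<in> ball p (R p)" by blast
    from R(2)[OF pc this] show ?thesis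
      by (simp add: star_box_def)
  qed
  show thesis
  proof (rule that[of A R lo hi])
    show "A \<noteq> {}" using A(3) ne closure_subset[of S] by blast
    show "S \<subseteq> (\<Union>p\<in>A. ball p (R p))" using A(3) closure_subset[of S] by blast
    show "star_box S x (lo p) (hi p)" if "p \<in> A" "x \<in> S" "x \<in> ball p (R p)" for p x
      using R(2) A(1) that by blast
  qed (use A lh in auto)
qed

lemma sobolev_star:
  fixes h :: "real^3 \<Rightarrow> 'b::euclidean_space"
  assumes S: "open S" "bounded S" "\<And>y. y \<in> S \<Longrightarrow> norm y \<le> b"
    and star: "star_box S x lo hi" and x: "x \<in> S"
    and h: "h \<in> Lp_space S 2" "\<And>i. h' i \<in> Lp_space S 2" "\<And>i j. h'' i j \<in> Lp_space S 2"
    and w: "\<And>i. weak_partial S i h (h' i)" "\<And>i j. weak_partial S j (h' i) (h'' i j)"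
    and N: "Lp_norm S 2 h \<le> N" "\<And>i. Lp_norm S 2 (h' i) \<le> N" "\<And>i j. Lp_norm S 2 (h'' i j) \<le> N"
    and c: "isCont h x"
  shows "bump_mass lo hi * norm (h x) \<le> sqrt (box_vol lo hi) * (1 + 12 * b * (1 + 12 * b)) * N"
proof -
  have Sm: "S \<in> sets lebesgue" using S(1) by auto
  have int: "integrable (lebesgue_on S) g" if "g \<in> Lp_space S 2" for g :: "real^3 \<Rightarrow> 'b"
    by (rule Lp_space_integrable[OF S(1,2) that]) simp
  have "((\<lambda>s. norm (smear S (bumps lo hi) x s h)) \<longlongrightarrow> norm (bump_mass lo hi *\<^sub>R h x)) (at_right 0)"
    using smear_tendsto[OF bump_family_bumps _ tprod_bumps_nonneg S(1,2) star x int[OF h(1)] c]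
      bump_mass_eq[OF star_box_cbox[OF star] Sm] by (intro tendsto_norm) simp
  moreover have "norm (smear S (bumps lo hi) x s h) \<le> sqrt (box_vol lo hi) * (1 + 12 * b * (1 + 12 * b)) * N"
    if "0 < s" "s \<le> 1" for s
    using sobolev_smear_bound[OF S(1,3) star x bump_family_bumps _ h int[OF h(1)] int[OF h(2)] w N that]
    by (simp add: mult_ac)
  then have "\<forall>\<^sub>F s in at_right 0. norm (smear S (bumps lo hi) x s h) \<le>
      sqrt (box_vol lo hi) * (1 + 12 * b * (1 + 12 * b)) * N"
    unfolding eventually_at_right[OF zero_less_one] by (intro exI[of _ 1]) auto
  ultimately have "norm (bump_mass lo hi *\<^sub>R h x) \<le> sqrt (box_vol lo hi) * (1 + 12 * b * (1 + 12 * b)) * N"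
    by (intro tendsto_upperbound) auto
  moreover have "bump_mass lo hi \<ge> 0"
    using bump_mass_pos[of lo hi] star by (auto simp: star_box_def intro: less_imp_le)
  ultimately show ?thesis
    by simp
qed

text \<open>The derivatives are given as witnesses and not through \<open>wD\<close>, so that the
  notion applies directly to a derivative of an \<open>H^3\<close> function, whose own derivatives
  are weak derivatives of the original one.\<close>

definition H2_bounded :: "(real^3) set \<Rightarrow> (real^3 \<Rightarrow> 'b::euclidean_space) \<Rightarrow> real \<Rightarrow> bool" where
  "H2_bounded S h N \<longleftrightarrow> h \<in> Lp_space S 2 \<and> Lp_norm S 2 h \<le> N \<and>
     (\<exists>h' h''. (\<forall>i. h' i \<in> Lp_space S 2 \<and> Lp_norm S 2 (h' i) \<le> N \<and> weak_partial S i h (h' i)) \<and>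
       (\<forall>i j. h'' i j \<in> Lp_space S 2 \<and> Lp_norm S 2 (h'' i j) \<le> N \<and> weak_partial S j (h' i) (h'' i j)))"

lemma sobolev_sup:
  assumes S: "smooth_bounded_domain S"
  obtains C where "C \<ge> 0"
    "\<And>(h :: real^3 \<Rightarrow> 'b::euclidean_space) N x. H2_bounded S h N \<Longrightarrow> x \<in> S \<Longrightarrow> isCont h x \<Longrightarrow> norm (h x) \<le> C * N"
proof -
  have op: "open S" "bounded S" using S by (auto simp: smooth_bounded_domain_def)
  obtain A R lo hi where A: "finite A" "A \<noteq> {}" "S \<subseteq> (\<Union>p\<in>A. ball p (R p))"
    "\<And>p x. p \<in> A \<Longrightarrow> x \<in> S \<Longrightarrow> x \<in> ball p (R p) \<Longrightarrow> star_box S x (lo p) (hi p)"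
    "\<And>p i. p \<in> A \<Longrightarrow> lo p $ i < hi p $ i"
    by (rule star_box_cover[OF S]) (rule that)
  obtain b where b: "b > 0" "\<And>y. y \<in> S \<Longrightarrow> norm y \<le> b"
    by (rule bounded_pos_norm[OF op(2)]) (rule that)
  define c where "c p = sqrt (box_vol (lo p) (hi p)) * (1 + 12 * b * (1 + 12 * b)) / bump_mass (lo p) (hi p)" for p
  have c0: "c p \<ge> 0" if "p \<in> A" for p
  proof -
    have "box_vol (lo p) (hi p) \<ge> 0"
      unfolding box_vol_def using A(5)[OF that] by (intro prod_nonneg) (auto intro: less_imp_le)
    then show ?thesis
      unfolding c_def using b(1) bump_mass_pos[OF A(5)[OF that]] by (intro divide_nonneg_pos mult_nonneg_nonneg) auto
  qed
  show thesis
  proof (rule that[of "\<Sum>p\<in>A. c p"])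
    show "0 \<le> (\<Sum>p\<in>A. c p)" by (rule sum_nonneg[OF c0])
    fix h :: "real^3 \<Rightarrow> 'b" and N x
    assume H2: "H2_bounded S h N" and x: "x \<in> S" and cont: "isCont h x"
    from H2 obtain h' h'' where h: "h \<in> Lp_space S 2" "\<And>i. h' i \<in> Lp_space S 2" "\<And>i j. h'' i j \<in> Lp_space S 2"
      and w: "\<And>i. weak_partial S i h (h' i)" "\<And>i j. weak_partial S j (h' i) (h'' i j)"
      and N: "Lp_norm S 2 h \<le> N" "\<And>i. Lp_norm S 2 (h' i) \<le> N" "\<And>i j. Lp_norm S 2 (h'' i j) \<le> N"
      unfolding H2_bounded_def by (elim conjE exE) blast
    obtain p where p: "p \<in> A" "x \<in> ball p (R p)" using A(3) x by blast
    have N0: "N \<ge> 0"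
      using N(1) by (rule order_trans[rotated]) (simp add: Lp_norm_def)
    have "bump_mass (lo p) (hi p) * norm (h x) \<le>
        sqrt (box_vol (lo p) (hi p)) * (1 + 12 * b * (1 + 12 * b)) * N"
      by (rule sobolev_star[OF op b(2) A(4)[OF p(1) x p(2)] x h w N cont])
    then have "norm (h x) \<le> c p * N"
      using bump_mass_pos[OF A(5)[OF p(1)]] by (simp add: c_def field_simps)
    also have "\<dots> \<le> (\<Sum>p\<in>A. c p) * N"
      using N0 A(1) p c0 by (intro mult_right_mono member_le_sum) auto
    finally show "norm (h x) \<le> (\<Sum>p\<in>A. c p) * N" .
  qed
qed

lemma weak_partial_AE:
  fixes f g :: "real^3 \<Rightarrow> 'b::euclidean_space"
  assumes S: "open S" and w: "weak_partial S i f k" and m: "f \<in> borel_measurable (lebesgue_on S)"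
    and eq: "AE x in lebesgue_on S. f x = g x"
  shows "weak_partial S i g k"
  unfolding weak_partial_def
proof (intro allI impI, elim conjE)
  fix F assume F: "\<forall>j. smooth1 (F j)" and t: "test_function S (tprod F)"
  have gm: "g \<in> borel_measurable (lebesgue_on S)"
    using S by (intro measurable_lebesgue_on_AE[OF _ m eq]) auto
  have "continuous_on UNIV (pd i (tprod F))"
    using test_function_C_k[OF test_function_pd[OF t], of 0 i] by simp
  then have "pd i (tprod F) \<in> borel_measurable borel"
    by (rule borel_measurable_continuous_onI)
  then have "pd i (tprod F) \<in> borel_measurable (lebesgue_on S)"
    by (intro measurable_restrict_space1) (auto intro: measurable_completion)
  then have "(LINT y|lebesgue_on S. pd i (tprod F) y *\<^sub>R g y) = (LINT y|lebesgue_on S. pd i (tprod F) y *\<^sub>R f y)"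
    using eq m gm by (intro integral_cong_AE borel_measurable_scaleR) (auto elim!: eventually_mono)
  also have "\<dots> = - (LINT y|lebesgue_on S. tprod F y *\<^sub>R k y)"
    using w F t by (simp add: weak_partial_def)
  finally show "(LINT y|lebesgue_on S. pd i (tprod F) y *\<^sub>R g y) = - (LINT y|lebesgue_on S. tprod F y *\<^sub>R k y)" .
qed

lemma continuous_on_loc_integrable:
  fixes f :: "real^3 \<Rightarrow> 'b::euclidean_space"
  assumes "continuous_on S f"
  shows "loc_integrable S f"
  unfolding loc_integrable_def
proof (intro allI impI, elim conjE)
  fix K assume K: "compact K" "K \<subseteq> S"
  have "integrable lborel (\<lambda>y. indicator K y *\<^sub>R f y)"
    by (rule borel_integrable_compact[OF K(1) continuous_on_subset[OF assms K(2)]])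
  then have "integrable lebesgue (\<lambda>y. indicator K y *\<^sub>R f y)"
    by (subst integrable_completion) auto
  then show "integrable (lebesgue_on K) f"
    using K by (subst integrable_restrict_space) (auto simp: compact_imp_closed)
qed

lemma weak_partial_unique:
  fixes f :: "real^3 \<Rightarrow> 'b::euclidean_space"
  assumes S: "open S" and "weak_partial S i f g" "weak_partial S i f h" "loc_integrable S g" "loc_integrable S h"
  shows "AE x in lebesgue_on S. g x = h x"
proof (rule AE_eq_of_tprod_tests[OF S assms(4,5)])
  fix F assume "\<And>i. smooth1 (F i)" and "test_function S (tprod F)"
  then have "- (LINT x|lebesgue_on S. tprod F x *\<^sub>R g x) = - (LINT x|lebesgue_on S. tprod F x *\<^sub>R h x)"
    using assms(2,3) unfolding weak_partial_def by (metis (no_types))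
  then show "(LINT x|lebesgue_on S. tprod F x *\<^sub>R g x) = (LINT x|lebesgue_on S. tprod F x *\<^sub>R h x)"
    by simp
qed

text \<open>A derivative of order at most 1 leaves two further derivatives in L^2, so
  \<open>sobolev_sup\<close> applies to it. Passing to h, equal almost everywhere, gives a
  representative whose pointwise values make sense.\<close>

lemma H3_AE_sup_bound:
  assumes S: "smooth_bounded_domain S"
  obtains C where "C \<ge> 0"
    "\<And>(f :: real^3 \<Rightarrow> 'b::euclidean_space) h \<alpha> x. \<lbrakk>f \<in> Hk S 3; mi_order \<alpha> \<le> 1;
      AE x in lebesgue_on S. wD S \<alpha> f x = h x; x \<in> S; isCont h x\<rbrakk> \<Longrightarrow> norm (h x) \<le> C * Hk_norm S 3 f"
proof -
  have op: "open S" "bounded S" using S by (auto simp: smooth_bounded_domain_def)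
  have Sm: "S \<in> sets lebesgue" using op by auto
  obtain C where C: "C \<ge> 0"
    "\<And>(h :: real^3 \<Rightarrow> 'b::euclidean_space) N x. H2_bounded S h N \<Longrightarrow> x \<in> S \<Longrightarrow> isCont h x \<Longrightarrow> norm (h x) \<le> C * N"
    by (rule sobolev_sup[OF S, where 'b = 'b]) (rule that)
  show thesis
  proof (rule that[OF C(1)])
    fix f h :: "real^3 \<Rightarrow> 'b" and \<alpha> x
    assume f: "f \<in> Hk S 3" and \<alpha>: "mi_order \<alpha> \<le> 1" and eq: "AE x in lebesgue_on S. wD S \<alpha> f x = h x"
      and x: "x \<in> S" "isCont h x"
    let ?h' = "\<lambda>i. wD S (\<alpha> + axis i 1) f"
    let ?h'' = "\<lambda>i j. wD S (\<alpha> + axis i 1 + axis j 1) f"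
    have ord: "mi_order \<alpha> \<le> 3" "mi_order (\<alpha> + axis i 1) \<le> 3" "mi_order (\<alpha> + axis i 1 + axis j 1) \<le> 3" for i j
      using \<alpha> unfolding mi_order_axis by linarith+
    note D = Hk_wD[OF op(1) f]
    show "norm (h x) \<le> C * Hk_norm S 3 f"
    proof (rule C(2)[OF _ x])
      have "weak_partial S i h (?h' i)" for i
        by (rule weak_partial_AE[OF op(1) weak_partial_of_is_weak_deriv[OF D(1)[OF ord(1)] D(1)[OF ord(2)]] _ eq])
           (use D(2)[OF ord(1)] in \<open>simp add: Lp_space_def\<close>)
      moreover have "weak_partial S j (?h' i) (?h'' i j)" for i j
        by (rule weak_partial_of_is_weak_deriv[OF D(1)[OF ord(2)] D(1)[OF ord(3)]])
      ultimately show "H2_bounded S h (Hk_norm S 3 f)"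
        unfolding H2_bounded_def Lp_space_AE(2)[OF Sm D(2)[OF ord(1)] eq]
        by (intro conjI exI[of _ ?h'] exI[of _ ?h''] allI Lp_space_AE(1)[OF Sm D(2)[OF ord(1)] eq] D(2)
            Lp_norm_wD_le_Hk_norm ord)
    qed
  qed
qed

text \<open>Classical partial derivatives agree almost everywhere with the weak ones and are
  continuous, so the bound for weak derivatives becomes a pointwise bound on all of S.\<close>

lemma H3_C1_sup_bound:
  assumes S: "smooth_bounded_domain S"
  obtains C where "C \<ge> 0"
    "\<And>(f :: real^3 \<Rightarrow> 'b::euclidean_space) i x. \<lbrakk>f \<in> Hk S 3; \<And>y. y \<in> S \<Longrightarrow> f differentiable (at y);
      \<And>i. continuous_on S (pd i f); x \<in> S\<rbrakk> \<Longrightarrow>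
      norm (f x) \<le> C * Hk_norm S 3 f \<and> norm (pd i f x) \<le> C * Hk_norm S 3 f"
proof -
  have op: "open S" "bounded S" using S by (auto simp: smooth_bounded_domain_def)
  have Sm: "S \<in> sets lebesgue" using op by auto
  obtain C where C: "C \<ge> 0"
    "\<And>(f :: real^3 \<Rightarrow> 'b::euclidean_space) h \<alpha> x. \<lbrakk>f \<in> Hk S 3; mi_order \<alpha> \<le> 1;
      AE x in lebesgue_on S. wD S \<alpha> f x = h x; x \<in> S; isCont h x\<rbrakk> \<Longrightarrow> norm (h x) \<le> C * Hk_norm S 3 f"
    by (rule H3_AE_sup_bound[OF S, where 'b = 'b]) (rule that)
  show thesis
  proof (rule that[OF C(1)])
    fix f :: "real^3 \<Rightarrow> 'b" and i x
    assume f: "f \<in> Hk S 3" and d: "\<And>y. y \<in> S \<Longrightarrow> f differentiable (at y)"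
      and c: "\<And>i. continuous_on S (pd i f)" and x: "x \<in> S"
    have cf: "continuous_on S f"
      using d by (auto intro!: continuous_at_imp_continuous_on differentiable_imp_continuous_within)
    have ord: "mi_order (0 :: nat^3) = 0" "mi_order (0 + axis i 1) \<le> 1"
      unfolding mi_order_axis by (simp_all add: mi_order_def)
    have w0: "is_weak_deriv S 0 f f"
      by (rule is_weak_deriv_0[OF continuous_on_loc_integrable[OF cf]])
    note D = Hk_wD[OF op(1) f]
    have D0: "is_weak_deriv S 0 f (wD S 0 f)"
      by (rule D(1)) (simp add: ord)
    have Di: "is_weak_deriv S (0 + axis i 1) f (wD S (0 + axis i 1) f)"
      by (rule D(1)) (use ord in linarith)
    have "norm (f x) \<le> C * Hk_norm S 3 f"
    proof (rule C(2)[OF f _ is_weak_deriv_unique[OF op(1) D0 w0] x])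
      show "isCont f x" using d[OF x] by (rule differentiable_imp_continuous_within)
    qed (simp add: ord)
    moreover have "norm (pd i f x) \<le> C * Hk_norm S 3 f"
    proof (rule C(2)[OF f ord(2) _ x])
      show "AE x in lebesgue_on S. wD S (0 + axis i 1) f x = pd i f x"
      proof (rule weak_partial_unique[OF op(1) weak_partial_of_is_weak_deriv[OF w0 Di] weak_partial_C1[OF op(1) d c]])
        show "loc_integrable S (wD S (0 + axis i 1) f)"
          using Di by (simp add: is_weak_deriv_def)
      qed (auto intro: continuous_on_loc_integrable[OF c])
      show "isCont (pd i f) x"
        using c x op(1) continuous_on_eq_continuous_at by blast
    qed
    ultimately show "norm (f x) \<le> C * Hk_norm S 3 f \<and> norm (pd i f x) \<le> C * Hk_norm S 3 f" ..
  qed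
qed

section \<open>Morrey estimates on the whole domain\<close>

definition W1r_C1 :: "(real^3) set \<Rightarrow> real \<Rightarrow> (real^3 \<Rightarrow> real) \<Rightarrow> real \<Rightarrow> bool" where
  "W1r_C1 S r f A \<longleftrightarrow> integrable (lebesgue_on S) f \<and> (\<forall>y\<in>S. f differentiable (at y)) \<and>
     (\<forall>i. continuous_on S (pd i f)) \<and> (\<forall>i. integrable (lebesgue_on S) (\<lambda>y. norm (pd i f y) powr r)) \<and>
     (\<forall>i. Lp_norm S r (pd i f) \<le> A)"

lemma W1r_C1_nonneg: "W1r_C1 S r f A \<Longrightarrow> A \<ge> 0"
  unfolding W1r_C1_def Lp_norm_def by (meson order_trans powr_ge_zero)

lemma morrey_local:
  assumes S: "smooth_bounded_domain S" and r: "r > 3" and lh: "\<And>i. lo $ i < hi $ i"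
  obtains C where "C > 0" and
    "\<And>f A x y. \<lbrakk>W1r_C1 S r f A; x \<in> S; y \<in> S; star_box S x lo hi; star_box S y lo hi\<rbrakk> \<Longrightarrow> \<bar>f x - f y\<bar> \<le> C * A"
    "\<And>f A x s. \<lbrakk>W1r_C1 S r f A; x \<in> S; star_box S x lo hi; 0 < s; s \<le> 1\<rbrakk> \<Longrightarrow>
      \<bar>f x\<bar> \<le> C * (A * s powr (1 - 3 / r) + s powr - 3 * Lp_norm S 1 f)"
proof -
  have op: "open S" "bounded S" using S by (auto simp: smooth_bounded_domain_def)
  have Sm: "S \<in> sets lebesgue" using op by auto
  obtain b where b: "b > 0" "\<And>y. y \<in> S \<Longrightarrow> norm y \<le> b"
    by (rule bounded_pos_norm[OF op(2)]) (rule that)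
  define I where "I = bump_mass lo hi"
  have I: "I > 0" unfolding I_def by (rule bump_mass_pos[OF lh])
  define K where "K = 6 * b * box_vol lo hi powr (1 - 1 / r) / (1 - 3 / r)"
  have K: "K \<ge> 0" using b r by (simp add: K_def)
  have M: "\<bar>smear S (bumps lo hi) x s f - I * f x\<bar> \<le> K * A * s powr (1 - 3 / r)"
    if "W1r_C1 S r f A" "x \<in> S" "star_box S x lo hi" "0 < s" "s \<le> 1" for f A x s
    using morrey_star[OF op(1) b(2) that(3,2) r _ _ _ _ _ that(4,5), of f A] that(1)
    by (simp add: W1r_C1_def K_def I_def)
  \<comment> \<open>Twice K pays for two Morrey errors in the oscillation; the summand 1 pays for
    the L^1 term in the pointwise bound and makes C positive.\<close>
  define C where "C = (2 * K + 1) / I"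
  have C: "C > 0" using K I by (simp add: C_def)
  show thesis
  proof (rule that[OF C])
    fix f A x y assume a: "W1r_C1 S r f A" "x \<in> S" "y \<in> S" "star_box S x lo hi" "star_box S y lo hi"
    have "smear S (bumps lo hi) x 1 f = smear S (bumps lo hi) y 1 f"
      by (simp add: smear_def kern_one)
    then have "\<bar>I * f x - I * f y\<bar> \<le> 2 * K * A"
      using M[OF a(1,2,4), of 1] M[OF a(1,3,5), of 1] by simp
    then have "I * \<bar>f x - f y\<bar> \<le> 2 * K * A"
      using I by (simp add: right_diff_distrib[symmetric] abs_mult)
    also have "\<dots> \<le> (2 * K + 1) * A"
      using W1r_C1_nonneg[OF a(1)] by (simp add: distrib_right)
    finally show "\<bar>f x - f y\<bar> \<le> C * A"
      using I by (simp add: C_def field_simps)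
  next
    fix f A x s assume a: "W1r_C1 S r f A" "x \<in> S" "star_box S x lo hi" "0 < s" "s \<le> (1::real)"
    have f: "integrable (lebesgue_on S) f" using a(1) by (simp add: W1r_C1_def)
    \<comment> \<open>\<open>smear_bound\<close> with exponent 1: the volume enters with exponent 0
      and the scale with exponent -3.\<close>
    have "norm (smear S (bumps lo hi) x s f) \<le> 1 * box_vol lo hi powr (1 - 1 / 1) * s powr (- 3 / 1) * Lp_norm S 1 f"
      using f by (intro smear_bound[OF bump_family_bumps _ _ _ _ Sm a(4,5,3) box_vol_def]) auto
    also have "\<dots> \<le> s powr - 3 * Lp_norm S 1 f"
    proof -
      have "box_vol lo hi powr 0 \<le> 1" by simp
      then have "box_vol lo hi powr 0 * (s powr - 3 * Lp_norm S 1 f) \<le> 1 * (s powr - 3 * Lp_norm S 1 f)"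
        by (intro mult_right_mono) (auto simp: Lp_norm_def)
      then show ?thesis by simp
    qed
    finally have "I * \<bar>f x\<bar> \<le> K * A * s powr (1 - 3 / r) + s powr - 3 * Lp_norm S 1 f"
      using M[OF a] I by (simp add: abs_mult flip: abs_mult_pos')
    also have "\<dots> \<le> (2 * K + 1) * (A * s powr (1 - 3 / r)) + (2 * K + 1) * (s powr - 3 * Lp_norm S 1 f)"
      using K W1r_C1_nonneg[OF a(1)] mult_right_mono[of K "2 * K + 1" "A * s powr (1 - 3 / r)"]
        mult_right_mono[of 1 "2 * K + 1" "s powr - 3 * Lp_norm S 1 f"]
      by (simp add: Lp_norm_def mult.assoc)
    finally show "\<bar>f x\<bar> \<le> C * (A * s powr (1 - 3 / r) + s powr - 3 * Lp_norm S 1 f)"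
      using I by (simp add: C_def field_simps)
  qed
qed

lemma morrey_pointwise:
  assumes S: "smooth_bounded_domain S" and r: "r > 3"
  obtains C where "C > 0"
    "\<And>f A x s. \<lbrakk>W1r_C1 S r f A; x \<in> S; 0 < s; s \<le> 1\<rbrakk> \<Longrightarrow>
      \<bar>f x\<bar> \<le> C * (A * s powr (1 - 3 / r) + s powr - 3 * Lp_norm S 1 f)"
proof -
  obtain P R lo hi where P: "finite P" "P \<noteq> {}" "S \<subseteq> (\<Union>p\<in>P. ball p (R p))"
    "\<And>p x. p \<in> P \<Longrightarrow> x \<in> S \<Longrightarrow> x \<in> ball p (R p) \<Longrightarrow> star_box S x (lo p) (hi p)"
    "\<And>p i. p \<in> P \<Longrightarrow> lo p $ i < hi p $ i"
    by (rule star_box_cover[OF S]) (rule that)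
  have "\<exists>C>0. \<forall>f A x s. W1r_C1 S r f A \<longrightarrow> x \<in> S \<longrightarrow> star_box S x (lo p) (hi p) \<longrightarrow> 0 < s \<longrightarrow> s \<le> 1 \<longrightarrow>
      \<bar>f x\<bar> \<le> C * (A * s powr (1 - 3 / r) + s powr - 3 * Lp_norm S 1 f)" if "p \<in> P" for p
    by (rule morrey_local[OF S r P(5)[OF that]]) blast
  then obtain C where C: "\<And>p. p \<in> P \<Longrightarrow> C p > 0"
    "\<And>p f A x s. p \<in> P \<Longrightarrow> W1r_C1 S r f A \<Longrightarrow> x \<in> S \<Longrightarrow> star_box S x (lo p) (hi p) \<Longrightarrow> 0 < s \<Longrightarrow> s \<le> 1 \<Longrightarrow>
      \<bar>f x\<bar> \<le> C p * (A * s powr (1 - 3 / r) + s powr - 3 * Lp_norm S 1 f)"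
    by metis
  show thesis
  proof (rule that[of "\<Sum>p\<in>P. C p"])
    show "(\<Sum>p\<in>P. C p) > 0" using P C by (intro sum_pos) auto
    fix f A x s assume a: "W1r_C1 S r f A" "x \<in> S" "0 < s" "s \<le> (1::real)"
    obtain p where p: "p \<in> P" "x \<in> ball p (R p)" using P(3) a(2) by blast
    have "\<bar>f x\<bar> \<le> C p * (A * s powr (1 - 3 / r) + s powr - 3 * Lp_norm S 1 f)"
      by (rule C(2)[OF p(1) a(1,2) P(4)[OF p(1) a(2) p(2)] a(3,4)])
    also have "\<dots> \<le> (\<Sum>p\<in>P. C p) * (A * s powr (1 - 3 / r) + s powr - 3 * Lp_norm S 1 f)"
      using P C p W1r_C1_nonneg[OF a(1)]
      by (intro mult_right_mono member_le_sum) (auto simp: Lp_norm_def intro: less_imp_le)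
    finally show "\<bar>f x\<bar> \<le> (\<Sum>p\<in>P. C p) * (A * s powr (1 - 3 / r) + s powr - 3 * Lp_norm S 1 f)" .
  qed
qed

text \<open>Points in the same ball of the cover see a common box and are comparable with a fixed
  constant. Comparability is an equivalence relation with open classes, so connectedness relates any
  two points, but with a constant depending on the pair. Hence this is used only for finitely many
  representatives, one for each ball.\<close>

lemma oscillation_bound:
  assumes S: "smooth_bounded_domain S" and r: "r > 3"
  obtains C where "C > 0" "\<And>f A x y. \<lbrakk>W1r_C1 S r f A; x \<in> S; y \<in> S\<rbrakk> \<Longrightarrow> \<bar>f x - f y\<bar> \<le> C * A"
proof -
  obtain P R lo hi where P: "finite P" "P \<noteq> {}" "S \<subseteq> (\<Union>p\<in>P. ball p (R p))"
    "\<And>p x. p \<in> P \<Longrightarrow> x \<in> S \<Longrightarrow> x \<in> ball p (R p) \<Longrightarrow> star_box S x (lo p) (hi p)"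
    "\<And>p i. p \<in> P \<Longrightarrow> lo p $ i < hi p $ i"
    by (rule star_box_cover[OF S]) (rule that)
  have "\<exists>C>0. \<forall>f A x y. W1r_C1 S r f A \<longrightarrow> x \<in> S \<longrightarrow> y \<in> S \<longrightarrow> star_box S x (lo p) (hi p) \<longrightarrow>
      star_box S y (lo p) (hi p) \<longrightarrow> \<bar>f x - f y\<bar> \<le> C * A" if "p \<in> P" for p
    by (rule morrey_local[OF S r P(5)[OF that]]) blast
  then obtain C where C: "\<And>p. p \<in> P \<Longrightarrow> C p > 0"
    "\<And>p f A x y. p \<in> P \<Longrightarrow> W1r_C1 S r f A \<Longrightarrow> x \<in> S \<Longrightarrow> y \<in> S \<Longrightarrow> star_box S x (lo p) (hi p) \<Longrightarrow>
      star_box S y (lo p) (hi p) \<Longrightarrow> \<bar>f x - f y\<bar> \<le> C p * A"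
    by metis
  have loc: "\<bar>f x - f y\<bar> \<le> C p * A"
    if "p \<in> P" "W1r_C1 S r f A" "x \<in> S" "y \<in> S" "x \<in> ball p (R p)" "y \<in> ball p (R p)" for p f A x y
    using that P(4) C(2) by blast
  define Rel where "Rel x y \<longleftrightarrow> (\<exists>K. \<forall>f A. W1r_C1 S r f A \<longrightarrow> \<bar>f x - f y\<bar> \<le> K * A)" for x y
  have rel: "Rel x y" if "x \<in> S" "y \<in> S" for x y
  proof (rule connected_equivalence_relation[of S x y Rel])
    show "connected S" using S by (simp add: smooth_bounded_domain_def)
    show "Rel y x" if "Rel x y" for x y
      using that unfolding Rel_def by (metis abs_minus_commute)
    show "Rel x z" if "Rel x y" "Rel y z" for x y z
    proof -
      obtain K where K: "\<forall>f A. W1r_C1 S r f A \<longrightarrow> \<bar>f x - f y\<bar> \<le> K * A"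
        using \<open>Rel x y\<close> unfolding Rel_def by (elim exE)
      obtain L where L: "\<forall>f A. W1r_C1 S r f A \<longrightarrow> \<bar>f y - f z\<bar> \<le> L * A"
        using \<open>Rel y z\<close> unfolding Rel_def by (elim exE)
      have "\<bar>f x - f z\<bar> \<le> (K + L) * A" if "W1r_C1 S r f A" for f A
        using K[rule_format, OF that] L[rule_format, OF that] by (simp add: distrib_right)
      then show ?thesis unfolding Rel_def by blast
    qed
    show "\<exists>T. openin (top_of_set S) T \<and> a \<in> T \<and> (\<forall>x\<in>T. Rel a x)" if a: "a \<in> S" for a
    proof -
      obtain p where p: "p \<in> P" "a \<in> ball p (R p)" using P(3) a by blast
      have "Rel a x" if "x \<in> S \<inter> ball p (R p)" for x
        unfolding Rel_def using loc[OF p(1) _ a _ p(2)] that by blast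
      then show ?thesis
        using a p by (intro exI[of _ "S \<inter> ball p (R p)"]) (auto intro: openin_open_Int)
    qed
  qed (use that in auto)
  \<comment> \<open>Only balls that meet S have a representative in S.\<close>
  define P' where "P' = {p\<in>P. S \<inter> ball p (R p) \<noteq> {}}"
  have "\<forall>p\<in>P'. \<exists>x. x \<in> S \<inter> ball p (R p)" by (auto simp: P'_def)
  then obtain c where c: "\<And>p. p \<in> P' \<Longrightarrow> c p \<in> S \<inter> ball p (R p)" by metis
  have "\<forall>p\<in>P'. \<forall>q\<in>P'. \<exists>K. \<forall>f A. W1r_C1 S r f A \<longrightarrow> \<bar>f (c p) - f (c q)\<bar> \<le> K * A"
    using rel c unfolding Rel_def by blast
  then obtain K where K: "\<And>p q f A. p \<in> P' \<Longrightarrow> q \<in> P' \<Longrightarrow> W1r_C1 S r f A \<Longrightarrow> \<bar>f (c p) - f (c q)\<bar> \<le> K p q * A"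
    by metis
  have fin: "finite P'" using P(1) by (simp add: P'_def)
  define M where "M = 1 + (\<Sum>p\<in>P. C p) + (\<Sum>p\<in>P. C p) + (\<Sum>p\<in>P'. \<Sum>q\<in>P'. \<bar>K p q\<bar>)"
  show thesis
  proof (rule that[of M])
    have "(\<Sum>p\<in>P. C p) \<ge> 0" using C(1) by (intro sum_nonneg) (simp add: less_imp_le)
    moreover have "(\<Sum>p\<in>P'. \<Sum>q\<in>P'. \<bar>K p q\<bar>) \<ge> 0" by (intro sum_nonneg) auto
    ultimately show "M > 0" unfolding M_def by linarith
    fix f A x y assume a: "W1r_C1 S r f A" "x \<in> S" "y \<in> S"
    have A0: "A \<ge> 0" by (rule W1r_C1_nonneg[OF a(1)])
    obtain p where p: "p \<in> P" "x \<in> ball p (R p)" using P(3) a(2) by blast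
    obtain q where q: "q \<in> P" "y \<in> ball q (R q)" using P(3) a(3) by blast
    have p': "p \<in> P'" "q \<in> P'" using p q a by (auto simp: P'_def)
    have "\<bar>f x - f (c p)\<bar> \<le> C p * A" "\<bar>f (c q) - f y\<bar> \<le> C q * A"
      using loc[OF p(1) a(1,2) _ p(2)] loc[OF q(1) a(1) _ a(3) _ q(2)] c p' by blast+
    moreover have "C p' * A \<le> (\<Sum>p\<in>P. C p) * A" if "p' \<in> P" for p'
      using C(1) P(1) A0 that by (intro mult_right_mono member_le_sum) (auto simp: less_imp_le)
    note this[OF p(1)] this[OF q(1)]
    moreover have "\<bar>f (c p) - f (c q)\<bar> \<le> (\<Sum>p\<in>P'. \<Sum>q\<in>P'. \<bar>K p q\<bar>) * A"
    proof -
      have "\<bar>K p q\<bar> \<le> (\<Sum>q\<in>P'. \<bar>K p q\<bar>)"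
        by (rule member_le_sum[OF p'(2)]) (use fin in auto)
      also have "\<dots> \<le> (\<Sum>p\<in>P'. \<Sum>q\<in>P'. \<bar>K p q\<bar>)"
        by (rule member_le_sum[OF p'(1), of "\<lambda>p. \<Sum>q\<in>P'. \<bar>K p q\<bar>"]) (use fin in \<open>auto intro: sum_nonneg\<close>)
      finally have "K p q * A \<le> (\<Sum>p\<in>P'. \<Sum>q\<in>P'. \<bar>K p q\<bar>) * A"
        using A0 by (intro mult_right_mono) auto
      then show ?thesis using K[OF p' a(1)] by linarith
    qed
    ultimately have "\<bar>f x - f y\<bar> \<le> (\<Sum>p\<in>P. C p) * A + (\<Sum>p\<in>P. C p) * A + (\<Sum>p\<in>P'. \<Sum>q\<in>P'. \<bar>K p q\<bar>) * A"
      by linarith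
    also have "\<dots> \<le> M * A"
      using A0 by (simp add: M_def distrib_right)
    finally show "\<bar>f x - f y\<bar> \<le> M * A" .
  qed
qed

section \<open>Vacuum persists backward in time\<close>

text \<open>\<open>dt\<close> and \<open>pd\<close> are the values of the joint derivative at (1, 0)
  and (0, e_i), so its continuity passes to both.\<close>

lemma joint_C1:
  fixes f :: "real \<Rightarrow> real^3 \<Rightarrow> 'b::real_normed_vector"
  assumes C1: "C_k_on 1 (\<lambda>(t, x). f t x) ({0<..} \<times> S)" and S: "open S"
  shows "\<And>t x. 0 < t \<Longrightarrow> x \<in> S \<Longrightarrow> f t differentiable (at x)"
    and "\<And>t x. 0 < t \<Longrightarrow> x \<in> S \<Longrightarrow> ((\<lambda>s. f s x) has_vector_derivative dt f t x) (at t)"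
    and "\<And>i. continuous_on ({0<..} \<times> S) (\<lambda>(t, x). pd i (f t) x)"
    and "continuous_on ({0<..} \<times> S) (\<lambda>(t, x). dt f t x)"
proof -
  let ?F = "\<lambda>p. f (fst p) (snd p)"
  let ?U = "{0::real<..} \<times> S"
  have F: "(\<lambda>(t, x). f t x) = ?F" by (auto simp: fun_eq_iff)
  have U: "open ?U" using S by (intro open_Times) auto
  have cont: "continuous_on ?U (\<lambda>p. frechet_derivative ?F (at p) e)" if "e \<in> Basis" for e
    using C1 that by (simp add: F)
  have der: "(?F has_derivative frechet_derivative ?F (at (t, x))) (at (t, x))" if "0 < t" "x \<in> S" for t x
  proof -
    have "?F differentiable_on ?U" using C1 by (simp add: F)
    then have "?F differentiable (at (t, x) within ?U)"
      using that by (simp add: differentiable_on_def)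
    then have "?F differentiable (at (t, x))"
      using at_within_open[of "(t, x)" ?U] U that by simp
    then show ?thesis
      by (simp only: frechet_derivative_works)
  qed
  have dx: "(f t has_derivative (\<lambda>h. frechet_derivative ?F (at (t, x)) (0, h))) (at x)" if "0 < t" "x \<in> S" for t x
  proof -
    have "((\<lambda>y. (t, y)) has_derivative (\<lambda>h. (0, h))) (at x)"
      by (intro has_derivative_Pair has_derivative_const has_derivative_ident)
    from has_derivative_compose[OF this der[OF that]] show ?thesis by simp
  qed
  have dtt: "((\<lambda>s. f s x) has_derivative (\<lambda>h. frechet_derivative ?F (at (t, x)) (h, 0))) (at t)" if "0 < t" "x \<in> S" for t x
  proof -
    have "((\<lambda>s. (s, x)) has_derivative (\<lambda>h. (h, 0))) (at t)"
      by (intro has_derivative_Pair has_derivative_const has_derivative_ident)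
    from has_derivative_compose[OF this der[OF that]] show ?thesis by simp
  qed
  show "f t differentiable (at x)" if "0 < t" "x \<in> S" for t x
    using dx[OF that] differentiable_def by blast
  have vd: "((\<lambda>s. f s x) has_vector_derivative frechet_derivative ?F (at (t, x)) (1, 0)) (at t)" if "0 < t" "x \<in> S" for t x
  proof -
    have "linear (frechet_derivative ?F (at (t, x)))"
      using der[OF that] has_derivative_linear by blast
    then have "frechet_derivative ?F (at (t, x)) (h, 0) = h *\<^sub>R frechet_derivative ?F (at (t, x)) (1, 0)" for h
      using linear_scale[of "frechet_derivative ?F (at (t, x))" h "(1, 0)"] by simp
    then have e: "(\<lambda>h. frechet_derivative ?F (at (t, x)) (h, 0)) = (\<lambda>h. h *\<^sub>R frechet_derivative ?F (at (t, x)) (1, 0))"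
      by (rule ext)
    show ?thesis
      unfolding has_vector_derivative_def e[symmetric] by (rule dtt[OF that])
  qed
  have dt_eq: "dt f t x = frechet_derivative ?F (at (t, x)) (1, 0)" if "0 < t" "x \<in> S" for t x
    unfolding dt_def using vd[OF that] by (rule vector_derivative_at)
  show "((\<lambda>s. f s x) has_vector_derivative dt f t x) (at t)" if "0 < t" "x \<in> S" for t x
    using vd[OF that] dt_eq[OF that] by simp
  have pd_eq: "pd i (f t) x = frechet_derivative ?F (at (t, x)) (0, axis i 1)" if "0 < t" "x \<in> S" for i t x
    unfolding pd_def using frechet_derivative_at[OF dx[OF that]] by metis
  show "continuous_on ?U (\<lambda>(t, x). pd i (f t) x)" for i
    by (rule continuous_on_eq[OF cont[of "(0, axis i 1)"]])
       (auto simp: pd_eq Basis_prod_def axis_in_Basis_iff)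
  show "continuous_on ?U (\<lambda>(t, x). dt f t x)"
    by (rule continuous_on_eq[OF cont[of "(1, 0)"]]) (auto simp: dt_eq Basis_prod_def)
qed

lemma continuous_on_slice:
  assumes "continuous_on (I \<times> S) (\<lambda>(t, x). f t x)" "t \<in> I"
  shows "continuous_on S (f t)"
proof -
  have "continuous_on S (\<lambda>x. (\<lambda>(t, x). f t x) (t, x))"
    by (rule continuous_on_compose2[OF assms(1)]) (use assms(2) in \<open>auto intro!: continuous_intros\<close>)
  then show ?thesis by simp
qed

lemma continuous_on_time_slice:
  assumes "continuous_on (I \<times> S) (\<lambda>(t, x). f t x)" "x \<in> S"
  shows "continuous_on I (\<lambda>t. f t x)"
proof -
  have "continuous_on I (\<lambda>t. (\<lambda>(t, x). f t x) (t, x))"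
    by (rule continuous_on_compose2[OF assms(1)]) (use assms(2) in \<open>auto intro!: continuous_intros\<close>)
  then show ?thesis by simp
qed

lemma bdist_pos:
  fixes S :: "(real^3) set"
  assumes "open S" "x \<in> S" "frontier S \<noteq> {}"
  shows "0 < bdist S x"
  using assms infdist_pos_not_in_closed[OF frontier_closed assms(3)] by (metis disjoint_iff frontier_disjoint_eq)

lemma compact_inner_region:
  fixes S :: "(real^3) set"
  assumes S: "open S" "bounded S" "frontier S \<noteq> {}" and e: "e > 0"
  shows "compact {x \<in> S. e \<le> bdist S x}"
proof -
  have "{x \<in> S. e \<le> bdist S x} = closure S \<inter> {x. e \<le> bdist S x}"
  proof (intro equalityI subsetI)
    fix x assume x: "x \<in> closure S \<inter> {x. e \<le> bdist S x}"
    then have "x \<notin> frontier S" using e by (auto simp: infdist_zero)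
    then show "x \<in> {x \<in> S. e \<le> bdist S x}"
      using x S(1) by (auto simp: frontier_def interior_open)
  qed (use closure_subset[of S] in auto)
  moreover have "closed {x. e \<le> bdist S x}"
    by (intro closed_Collect_le continuous_intros)
  ultimately show ?thesis
    using S(2) by (auto intro!: compact_Int_closed)
qed

text \<open>Minimum principle for the transport equation, run backwards in time: the logarithm of the
  barrier keeps the minimum away from the boundary.\<close>

lemma density_positive_backward:
  fixes \<rho> :: "real \<Rightarrow> real^3 \<Rightarrow> real" and u :: "real \<Rightarrow> real^3 \<Rightarrow> real^3"
  assumes S: "smooth_bounded_domain S" and T: "T > 0"
    and \<rho>C1: "C_k_on 1 (\<lambda>(t, x). \<rho> t x) ({0<..} \<times> S)"
    and \<rho>c: "continuous_on ({0..} \<times> S) (\<lambda>(t, x). \<rho> t x)"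
    and tame: "\<And>t. 0 < t \<Longrightarrow> t \<le> T \<Longrightarrow> tame_field S (u t) K"
    and div: "\<And>t x. 0 < t \<Longrightarrow> t \<le> T \<Longrightarrow> x \<in> S \<Longrightarrow> \<bar>dvg (u t) x\<bar> \<le> K"
    and eq: "\<And>t x. 0 < t \<Longrightarrow> t \<le> T \<Longrightarrow> x \<in> S \<Longrightarrow> dt \<rho> t x + u t x \<bullet> grad (\<rho> t) x + \<rho> t x * dvg (u t) x = 0"
    and nonneg: "\<And>t x. 0 \<le> t \<Longrightarrow> x \<in> S \<Longrightarrow> 0 \<le> \<rho> t x"
    and \<delta>: "\<delta> > 0" "\<And>x. x \<in> S \<Longrightarrow> \<delta> \<le> \<rho> T x"
    and x: "x \<in> S"
  shows "0 < \<rho> 0 x"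
proof -
  have op: "open S" "bounded S" "S \<noteq> {}" using S by (auto simp: smooth_bounded_domain_def)
  have ne: "frontier S \<noteq> {}" by (rule frontier_nonempty_bounded_open[OF op])
  obtain D c L where c: "c > 0" and D: "barrier_like S D L" and Dc: "\<And>x. x \<in> S \<Longrightarrow> c * bdist S x \<le> D x"
    by (rule barrier_exists[OF S]) (rule that)
  have L0: "L \<ge> 0" using D by (simp add: barrier_like_def)
  have dpos: "0 < bdist S y" if "y \<in> S" for y by (rule bdist_pos[OF op(1) that ne])
  have Dpos: "0 < D y" if "y \<in> S" for y
    using Dc[OF that] mult_pos_pos[OF c dpos[OF that]] by linarith
  have Dle: "D y \<le> L * bdist S y" if "y \<in> S" for y using D that by (simp add: barrier_like_def)
  have Dd: "D differentiable (at y)" if "y \<in> S" for y using D that by (simp add: barrier_like_def)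
  obtain b where b: "b > 0" "\<And>y. y \<in> closure S \<Longrightarrow> norm y \<le> b"
    by (rule bounded_pos_norm[OF bounded_closure[OF op(2)]]) (rule that)
  have dle: "bdist S y \<le> 2 * b" if "y \<in> S" for y
  proof -
    obtain z where z: "z \<in> frontier S" using ne by blast
    have "bdist S y \<le> dist y z" by (rule infdist_le[OF z])
    also have "\<dots> \<le> norm y + norm z" by (simp add: dist_norm norm_triangle_ineq4)
    also have "\<dots> \<le> 2 * b"
      using b(2)[of y] b(2)[of z] that z closure_subset[of S] by (auto simp: frontier_def)
    finally show ?thesis .
  qed
  define Dm where "Dm = L * (2 * b) + 1"
  have Dm: "D y \<le> Dm" if "y \<in> S" for y
    using Dle[OF that] mult_left_mono[OF dle[OF that] L0] by (simp add: Dm_def)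
  have K0: "K \<ge> 0" using tame[of T] T x tame_field_nonneg by blast
  \<comment> \<open>Bound for the derivative of ln D along the velocity, uniform in time; passing
    from the distance back to D costs 1 / c.\<close>
  define \<Lambda> where "\<Lambda> = L * K / c"
  have \<Lambda>: "\<bar>u t y \<bullet> grad D y\<bar> \<le> \<Lambda> * D y" if "0 < t" "t \<le> T" "y \<in> S" for t y
  proof -
    have "\<bar>u t y \<bullet> grad D y\<bar> \<le> L * K * bdist S y"
      using D tame[OF that(1,2)] that(3) by (auto simp: barrier_like_def)
    also have "\<dots> = \<Lambda> * (c * bdist S y)" using c by (simp add: \<Lambda>_def)
    also have "\<dots> \<le> \<Lambda> * D y"
      using L0 K0 c by (intro mult_left_mono Dc that) (simp add: \<Lambda>_def)
    finally show ?thesis .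
  qed
  have \<Lambda>0: "\<Lambda> \<ge> 0" using L0 K0 c by (simp add: \<Lambda>_def)
  note jC = joint_C1[OF \<rho>C1 op(1)]
  have est: "exp (- K * \<tau>) * \<rho> \<tau> x \<ge> \<delta> * exp (- K * T) + \<epsilon> * ((\<Lambda> + 1) * (\<tau> - T) + ln (D x) - ln Dm)"
    if \<tau>: "0 < \<tau>" "\<tau> < T" and \<epsilon>: "\<epsilon> > 0" for \<tau> \<epsilon>
  proof -
    \<comment> \<open>The factor exp(-K t) absorbs the divergence of the velocity. The term
      -\<epsilon> ln D is large near the boundary and forces the minimum into the interior, while
      the slope \<Lambda> + 1 in time makes w strictly decreasing in t at spatial critical
      points.\<close>
    define w where "w t y = exp (- K * t) * \<rho> t y - \<epsilon> * ((\<Lambda> + 1) * t + ln (D y))" for t y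
    \<comment> \<open>Solved from the requirement that ln D < M implies w t y >= w \<tau> x for all
      t up to T. By D <= L \<open>bdist\<close>, the number e below guarantees ln D < M at distances
      less than e.\<close>
    define M where "M = - w \<tau> x / \<epsilon> - (\<Lambda> + 1) * T"
    define e where "e = min (bdist S x) (exp M / (L + 1))"
    have e: "e > 0" using dpos[OF x] L0 by (simp add: e_def)
    define Z where "Z = {y \<in> S. e \<le> bdist S y}"
    have Z: "compact Z" "Z \<subseteq> S" "x \<in> Z"
      using compact_inner_region[OF op(1,2) ne e] x by (auto simp: Z_def e_def)
    have contw: "continuous_on ({\<tau>..T} \<times> Z) (\<lambda>p. w (fst p) (snd p))"
    proof -
      have "continuous_on ({\<tau>..T} \<times> Z) (\<lambda>p. \<rho> (fst p) (snd p))"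
        using \<tau> Z(2) by (intro continuous_on_subset[OF \<rho>c[unfolded case_prod_beta]]) auto
      moreover have "continuous_on ({\<tau>..T} \<times> Z) (\<lambda>p. D (snd p))"
      proof (rule continuous_on_compose2[of Z D])
        show "continuous_on Z D"
          using Dd Z(2) by (intro continuous_at_imp_continuous_on ballI differentiable_imp_continuous_within) auto
      qed (auto intro!: continuous_intros)
      ultimately show ?thesis
        unfolding w_def using Dpos Z(2) by (intro continuous_intros) (auto simp: less_le)
    qed
    have "{\<tau>..T} \<times> Z \<noteq> {}" using \<tau> Z(3) by auto
    from continuous_attains_inf[OF compact_Times[OF compact_Icc Z(1)] this contw]
    obtain t0 x0 where m: "t0 \<in> {\<tau>..T}" "x0 \<in> Z"
      and le: "\<And>t y. t \<in> {\<tau>..T} \<Longrightarrow> y \<in> Z \<Longrightarrow> w t0 x0 \<le> w t y"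
      by auto
    have x0: "x0 \<in> S" using m Z by auto
    have min: "w t0 x0 \<le> w t y" if t: "t \<in> {\<tau>..T}" and y: "y \<in> S" for t y
    proof (cases "y \<in> Z")
      case False
      then have "bdist S y < exp M / (L + 1)"
        using y le[of \<tau> x] by (auto simp: Z_def e_def min_def split: if_splits)
      then have "(L + 1) * bdist S y < exp M" using L0 by (simp add: field_simps)
      then have "D y < exp M"
        using Dle[OF y] dpos[OF y] by (simp add: algebra_simps)
      then have "ln (D y) < M" using Dpos[OF y] by (metis exp_gt_zero ln_exp ln_less_cancel_iff)
      moreover have "(\<Lambda> + 1) * t \<le> (\<Lambda> + 1) * T" using t \<Lambda>0 by (intro mult_left_mono) auto
      ultimately have "\<epsilon> * ((\<Lambda> + 1) * t + ln (D y)) \<le> \<epsilon> * (M + (\<Lambda> + 1) * T)"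
        using \<epsilon> by (intro mult_left_mono) auto
      also have "\<dots> = - w \<tau> x" using \<epsilon> by (simp add: M_def)
      finally have "\<epsilon> * ((\<Lambda> + 1) * t + ln (D y)) \<le> - w \<tau> x" .
      moreover have "0 \<le> exp (- K * t) * \<rho> t y"
        using nonneg[of t y] t \<tau> y by simp
      ultimately have "w \<tau> x \<le> w t y"
        unfolding w_def[of t y] by linarith
      then show ?thesis using le[of \<tau> x] \<tau> Z by auto
    qed (use le t in auto)
    \<comment> \<open>At a minimum before T the right derivative in time is nonnegative, as later
      times compete too. But the spatial gradient of w vanishes there, and the transport equation
      then makes the time derivative at most -\<epsilon>.\<close>
    have "t0 = T"
    proof (rule ccontr)
      assume "t0 \<noteq> T"
      then have t0: "0 < t0" "t0 < T" "\<tau> \<le> t0" using m \<tau> by auto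
      define W where "W = exp (- K * t0) * (dt \<rho> t0 x0 - K * \<rho> t0 x0) - \<epsilon> * (\<Lambda> + 1)"
      have "((\<lambda>s. \<rho> s x0) has_real_derivative dt \<rho> t0 x0) (at t0)"
        using jC(2)[OF t0(1) x0] by (simp add: has_real_derivative_iff_has_vector_derivative)
      then have W: "((\<lambda>s. w s x0) has_real_derivative W) (at t0)"
        unfolding w_def W_def by (auto intro!: derivative_eq_intros simp: algebra_simps)
      have W0: "W \<ge> 0"
      proof (rule ccontr)
        assume "\<not> W \<ge> 0"
        then obtain d where d: "d > 0" "\<And>h. 0 < h \<Longrightarrow> h < d \<Longrightarrow> w (t0 + h) x0 < w t0 x0"
          using DERIV_neg_dec_right[OF W] by auto
        define h where "h = min (d / 2) (T - t0)"
        have h: "0 < h" "h < d" "t0 + h \<le> T" using d t0 by (auto simp: h_def min_def)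
        show False using d(2)[OF h(1,2)] min[of "t0 + h" x0] h t0 x0 by auto
      qed
      define G where "G = exp (- K * t0) *\<^sub>R grad (\<rho> t0) x0 - (\<epsilon> / D x0) *\<^sub>R grad D x0"
      have "(w t0 has_derivative (\<lambda>h. h \<bullet> G)) (at x0)"
      proof -
        have 1: "(\<rho> t0 has_derivative (\<lambda>h. h \<bullet> grad (\<rho> t0) x0)) (at x0)"
          by (rule has_derivative_grad[OF jC(1)[OF t0(1) x0]])
        have 2: "((\<lambda>y. ln (D y)) has_derivative (\<lambda>h. (h \<bullet> grad D x0) * inverse (D x0))) (at x0)"
          using has_derivative_ln[OF Dpos[OF x0] has_derivative_grad[OF Dd[OF x0]]] by (simp add: divide_inverse)
        have "((\<lambda>y. exp (- K * t0) * \<rho> t0 y - \<epsilon> * ((\<Lambda> + 1) * t0 + ln (D y))) has_derivative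
            (\<lambda>h. exp (- K * t0) * (h \<bullet> grad (\<rho> t0) x0) - \<epsilon> * (0 + (h \<bullet> grad D x0) * inverse (D x0)))) (at x0)"
          by (intro has_derivative_diff has_derivative_mult_right has_derivative_add has_derivative_const 1 2)
        then show ?thesis
          unfolding w_def[abs_def]
          by (rule has_derivative_eq_rhs) (auto simp: G_def fun_eq_iff inner_diff_right divide_inverse)
      qed
      then have "(\<lambda>h. h \<bullet> G) = (\<lambda>h. 0)"
        by (rule differential_zero_maxmin[OF x0 op(1)]) (use min t0 m in auto)
      then have "u t0 x0 \<bullet> G = 0" by metis
      then have "exp (- K * t0) * (u t0 x0 \<bullet> grad (\<rho> t0) x0) = \<epsilon> * (u t0 x0 \<bullet> grad D x0) / D x0"
        by (simp add: G_def inner_diff_right)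
      moreover have "dt \<rho> t0 x0 = - (u t0 x0 \<bullet> grad (\<rho> t0) x0) - \<rho> t0 x0 * dvg (u t0) x0"
        using eq[OF t0(1) _ x0] t0 by simp
      moreover have "exp (- K * t0) * ((- p - \<rho> t0 x0 * q) - K * \<rho> t0 x0) - \<epsilon> * (\<Lambda> + 1) =
          - (exp (- K * t0) * p) - exp (- K * t0) * (\<rho> t0 x0 * (q + K)) - \<epsilon> * (\<Lambda> + 1)" for p q
        by (simp add: algebra_simps)
      ultimately have "W = - (\<epsilon> * (u t0 x0 \<bullet> grad D x0) / D x0) -
          exp (- K * t0) * (\<rho> t0 x0 * (dvg (u t0) x0 + K)) - \<epsilon> * (\<Lambda> + 1)"
        by (simp only: W_def)
      then have "W = - (exp (- K * t0) * (\<rho> t0 x0 * (dvg (u t0) x0 + K))) -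
          \<epsilon> * (\<Lambda> + 1 + (u t0 x0 \<bullet> grad D x0) / D x0)"
        by (simp add: distrib_left)
      moreover have "0 \<le> exp (- K * t0) * (\<rho> t0 x0 * (dvg (u t0) x0 + K))"
        using div[of t0 x0] nonneg[of t0 x0] t0 x0 by (intro mult_nonneg_nonneg) auto
      moreover have "- \<Lambda> \<le> (u t0 x0 \<bullet> grad D x0) / D x0"
        using \<Lambda>[of t0 x0] t0 x0 Dpos[OF x0] by (auto simp: le_divide_eq abs_le_iff)
      then have "\<epsilon> * 1 \<le> \<epsilon> * (\<Lambda> + 1 + (u t0 x0 \<bullet> grad D x0) / D x0)"
        using \<epsilon> by (intro mult_left_mono) auto
      ultimately show False using W0 \<epsilon> by linarith
    qed
    then have "w T x0 \<le> w \<tau> x" using min[of \<tau> x] \<tau> x by auto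
    moreover have "\<delta> * exp (- K * T) \<le> exp (- K * T) * \<rho> T x0"
      using \<delta>(2)[OF x0] by (simp add: mult.commute)
    moreover have "\<epsilon> * ln (D x0) \<le> \<epsilon> * ln Dm"
      using \<epsilon> Dm[OF x0] Dpos[OF x0] by (intro mult_left_mono) auto
    ultimately show ?thesis
      unfolding w_def distrib_left right_diff_distrib by linarith
  qed
  \<comment> \<open>Letting \<epsilon> tend to 0 removes the barrier, and with it the point x, from
    the lower bound.\<close>
  have est2: "\<delta> * exp (- K * T) \<le> exp (- K * \<tau>) * \<rho> \<tau> x" if \<tau>: "0 < \<tau>" "\<tau> < T" for \<tau>
  proof (rule tendsto_upperbound[where F = "at_right (0::real)"])
    show "((\<lambda>\<epsilon>. \<delta> * exp (- K * T) + \<epsilon> * ((\<Lambda> + 1) * (\<tau> - T) + ln (D x) - ln Dm)) \<longlongrightarrow> \<delta> * exp (- K * T)) (at_right 0)"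
      by (auto intro!: tendsto_eq_intros)
    show "\<forall>\<^sub>F \<epsilon> in at_right 0. \<delta> * exp (- K * T) + \<epsilon> * ((\<Lambda> + 1) * (\<tau> - T) + ln (D x) - ln Dm) \<le> exp (- K * \<tau>) * \<rho> \<tau> x"
      using eventually_at_right_less[of 0] by eventually_elim (rule est[OF \<tau>])
  qed auto
  \<comment> \<open>The equation is available for positive times only; continuity of the density
    carries the bound to time 0.\<close>
  have "\<delta> * exp (- K * T) \<le> exp (- K * 0) * \<rho> 0 x"
  proof (rule tendsto_lowerbound[where F = "at_right (0::real)"])
    have "continuous_on {0..} (\<lambda>s. \<rho> s x)"
      by (rule continuous_on_time_slice[OF \<rho>c x])
    then have "((\<lambda>s. \<rho> s x) \<longlongrightarrow> \<rho> 0 x) (at 0 within {0..})"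
      by (auto simp: continuous_on_def)
    then have "((\<lambda>s. \<rho> s x) \<longlongrightarrow> \<rho> 0 x) (at_right 0)"
      by (rule tendsto_within_subset) auto
    then show "((\<lambda>\<tau>. exp (- K * \<tau>) * \<rho> \<tau> x) \<longlongrightarrow> exp (- K * 0) * \<rho> 0 x) (at_right 0)"
      by (intro tendsto_intros)
    show "\<forall>\<^sub>F \<tau> in at_right 0. \<delta> * exp (- K * T) \<le> exp (- K * \<tau>) * \<rho> \<tau> x"
      unfolding eventually_at_right[OF T] using est2 T by (intro exI[of _ T]) auto
  qed auto
  then show ?thesis
    using less_le_trans[OF mult_pos_pos[OF \<delta>(1) exp_gt_zero[of "- K * T"]]] by simp
qed

section \<open>Conservation of mass\<close>

text \<open>A C^1 step rising between 1 and 2, built from squares of positive parts.\<close>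

definition smoothstep :: "real \<Rightarrow> real" where
  "smoothstep s = 1 - (max 0 (1 - (max 0 (s - 1))\<^sup>2))\<^sup>2"

definition smoothstep' :: "real \<Rightarrow> real" where
  "smoothstep' s = 4 * max 0 (s - 1) * max 0 (1 - (max 0 (s - 1))\<^sup>2)"

lemma smoothstep_has_derivative: "(smoothstep has_real_derivative smoothstep' s) (at s)"
proof -
  have 1: "((\<lambda>s. (max 0 (s - 1))\<^sup>2) has_real_derivative 2 * max 0 (s - 1) * 1) (at s)"
    by (rule DERIV_chain2[OF max0_square_has_derivative]) (auto intro!: derivative_eq_intros)
  have "((\<lambda>s. 1 - (max 0 (s - 1))\<^sup>2) has_real_derivative 0 - 2 * max 0 (s - 1) * 1) (at s)"
    by (intro DERIV_diff DERIV_const 1)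
  from DERIV_chain2[OF max0_square_has_derivative this]
  have "((\<lambda>s. 1 - (max 0 (1 - (max 0 (s - 1))\<^sup>2))\<^sup>2) has_real_derivative
      0 - 2 * max 0 (1 - (max 0 (s - 1))\<^sup>2) * (0 - 2 * max 0 (s - 1) * 1)) (at s)"
    by (intro DERIV_diff DERIV_const)
  then show ?thesis
    by (simp add: smoothstep_def[abs_def] smoothstep'_def mult_ac)
qed

lemma smoothstep_bounds: "0 \<le> smoothstep s" "smoothstep s \<le> 1"
  by (auto simp: smoothstep_def intro!: power_le_one)

lemma smoothstep_eq_0: "s \<le> 1 \<Longrightarrow> smoothstep s = 0"
  by (simp add: smoothstep_def max_def)

lemma smoothstep_inner_eq_0:
  fixes s :: real
  assumes "s \<ge> 2"
  shows "max 0 (1 - (max 0 (s - 1))\<^sup>2) = 0"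
proof (rule max_absorb1)
  have "1 \<le> (max 0 (s - 1))\<^sup>2"
    using assms by (intro one_le_power) simp
  then show "1 - (max 0 (s - 1))\<^sup>2 \<le> 0"
    by linarith
qed

lemma smoothstep_eq_1: "s \<ge> 2 \<Longrightarrow> smoothstep s = 1"
  unfolding smoothstep_def by (subst smoothstep_inner_eq_0) simp_all

lemma smoothstep'_eq_0: "s \<ge> 2 \<Longrightarrow> smoothstep' s = 0"
  unfolding smoothstep'_def by (subst smoothstep_inner_eq_0) simp_all

lemma smoothstep'_abs_le: "\<bar>smoothstep' s\<bar> \<le> 4"
proof (cases "s \<ge> 2")
  case False
  have "max 0 (s - 1) * max 0 (1 - (max 0 (s - 1))\<^sup>2) \<le> 1 * 1"
    using False by (intro mult_mono) auto
  then show ?thesis by (simp add: smoothstep'_def abs_mult)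
qed (simp add: smoothstep'_eq_0)

lemma continuous_on_smoothstep': "continuous_on S smoothstep'"
  unfolding smoothstep'_def[abs_def] by (intro continuous_intros)

section \<open>Integration by parts for the divergence\<close>

lemma pd_vec_nth:
  fixes v :: "real^3 \<Rightarrow> real^3"
  assumes "v differentiable (at x)"
  shows "(\<lambda>y. v y $ j) differentiable (at x)" "pd i (\<lambda>y. v y $ j) x = pd i v x $ j"
proof -
  have "((\<lambda>y. v y $ j) has_derivative (\<lambda>h. frechet_derivative v (at x) h $ j)) (at x)"
    by (rule has_derivative_compose[of v _ x UNIV "\<lambda>z. z $ j" "\<lambda>h. h $ j"])
       (use assms in \<open>auto simp: frechet_derivative_works intro: bounded_linear_imp_has_derivative bounded_linear_vec_nth\<close>)
  from frechet_derivative_at[OF this] this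
  show "(\<lambda>y. v y $ j) differentiable (at x)" "pd i (\<lambda>y. v y $ j) x = pd i v x $ j"
    by (auto simp: pd_def differentiable_def dest: fun_cong[where x = "axis i 1"])
qed

lemma integral_dvg_compact_support:
  fixes v :: "real^3 \<Rightarrow> real^3"
  assumes S: "open S" and v: "\<And>y. y \<in> S \<Longrightarrow> v differentiable (at y)" "\<And>i. continuous_on S (pd i v)"
    and \<phi>: "\<And>y. y \<in> S \<Longrightarrow> \<phi> differentiable (at y)" "\<And>i. continuous_on S (pd i \<phi>)"
    and H: "compact H" "H \<subseteq> S" "\<And>y. y \<in> S \<Longrightarrow> y \<notin> H \<Longrightarrow> \<phi> y = 0"
  shows "(LINT y|lebesgue_on S. \<phi> y * dvg v y) = - (LINT y|lebesgue_on S. v y \<bullet> grad \<phi> y)"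
proof -
  have cv: "continuous_on S (\<lambda>y. v y $ i)" for i
    using v(1) by (intro continuous_at_imp_continuous_on ballI differentiable_imp_continuous_within pd_vec_nth) auto
  have c\<phi>: "continuous_on S \<phi>"
    using \<phi>(1) by (intro continuous_at_imp_continuous_on ballI differentiable_imp_continuous_within) auto
  have pdz: "pd i \<phi> y = 0" if "y \<in> S" "y \<notin> H" for i y
    using that H S by (intro pd_eq_0_open[of "S - H"]) (auto intro!: open_Diff compact_imp_closed)
  have pdc: "continuous_on S (pd i (\<lambda>y. v y $ i))" for i
    by (rule continuous_on_eq[of _ "\<lambda>y. pd i v y $ i"]) (use v pd_vec_nth in \<open>auto intro!: continuous_intros\<close>)
  have i1: "integrable (lebesgue_on S) (\<lambda>y. \<phi> y * pd i (\<lambda>y. v y $ i) y)" for i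
    by (rule integrable_continuous_compact_support[OF S _ H(1,2)])
       (use H in \<open>auto intro!: continuous_intros c\<phi> pdc\<close>)
  have i2: "integrable (lebesgue_on S) (\<lambda>y. pd i \<phi> y * v y $ i)" for i
    by (rule integrable_continuous_compact_support[OF S _ H(1,2)])
       (auto intro!: continuous_intros \<phi> cv simp: pdz)
  have "(LINT y|lebesgue_on S. \<phi> y * dvg v y) = (LINT y|lebesgue_on S. (\<Sum>i\<in>UNIV. \<phi> y * pd i (\<lambda>y. v y $ i) y))"
    using v(1) by (intro Bochner_Integration.integral_cong) (auto simp: dvg_def sum_distrib_left pd_vec_nth)
  also have "\<dots> = (\<Sum>i\<in>UNIV. LINT y|lebesgue_on S. \<phi> y * pd i (\<lambda>y. v y $ i) y)"
    using i1 by (intro Bochner_Integration.integral_sum)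
  also have "\<dots> = (\<Sum>i\<in>UNIV. - (LINT y|lebesgue_on S. pd i \<phi> y * v y $ i))"
  proof (rule sum.cong[OF refl])
    fix i :: 3
    have "(LINT y|lebesgue_on S. pd i \<phi> y *\<^sub>R (v y $ i)) = - (LINT y|lebesgue_on S. \<phi> y *\<^sub>R pd i (\<lambda>y. v y $ i) y)"
      using v(1) pd_vec_nth(1) by (intro integral_pd_scaleR_compact_support[OF S _ pdc \<phi>(1,2) H]) auto
    then show "(LINT y|lebesgue_on S. \<phi> y * pd i (\<lambda>y. v y $ i) y) = - (LINT y|lebesgue_on S. pd i \<phi> y * v y $ i)"
      by simp
  qed
  also have "\<dots> = - (LINT y|lebesgue_on S. (\<Sum>i\<in>UNIV. pd i \<phi> y * v y $ i))"
    using i2 by (subst Bochner_Integration.integral_sum) (auto simp: sum_negf)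
  also have "(LINT y|lebesgue_on S. (\<Sum>i\<in>UNIV. pd i \<phi> y * v y $ i)) = (LINT y|lebesgue_on S. v y \<bullet> grad \<phi> y)"
    by (simp add: inner_vec_def grad_def mult.commute)
  finally show ?thesis .
qed

lemma bounded_on_inner:
  fixes f :: "real \<times> (real^3) \<Rightarrow> real"
  assumes "continuous_on ({0<..} \<times> S) f" "compact H" "H \<subseteq> S" "0 < a"
  obtains B where "B \<ge> 0" "\<And>s y. s \<in> {a<..<b} \<Longrightarrow> y \<in> H \<Longrightarrow> \<bar>f (s, y)\<bar> \<le> B"
proof -
  have "compact (f ` ({a..b} \<times> H))"
    using assms by (intro compact_continuous_image continuous_on_subset[OF assms(1)] compact_Times) auto
  then obtain B where B: "\<forall>v\<in>f ` ({a..b} \<times> H). norm v \<le> B" "B > 0"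
    using compact_imp_bounded by (metis bounded_pos)
  have "\<bar>f (s, y)\<bar> \<le> B" if "s \<in> {a<..<b}" "y \<in> H" for s y
  proof -
    have "f (s, y) \<in> f ` ({a..b} \<times> H)" using that by auto
    with B(1) have "norm (f (s, y)) \<le> B" by blast
    then show ?thesis by simp
  qed
  then show thesis using that[of B] B(2) by simp
qed

text \<open>The equation is tested with \<theta> n, the step applied to (n + 1) D, which cuts away a
  boundary layer. Its gradient is of order n, but the derivative of D along the velocity is at most
  \<Lambda> D, hence of order 1 / n in the layer. So the flux is bounded by a multiple of the volume
  of the layer, which tends to 0.\<close>

lemma mass_conserved:
  fixes \<rho> :: "real \<Rightarrow> real^3 \<Rightarrow> real" and u :: "real \<Rightarrow> real^3 \<Rightarrow> real^3"
  assumes S: "smooth_bounded_domain S" and T: "T > 0"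
    and \<rho>C1: "C_k_on 1 (\<lambda>(t, x). \<rho> t x) ({0<..} \<times> S)" and uC1: "C_k_on 1 (\<lambda>(t, x). u t x) ({0<..} \<times> S)"
    and \<rho>c: "continuous_on ({0..} \<times> S) (\<lambda>(t, x). \<rho> t x)"
    and tame: "\<And>t. 0 < t \<Longrightarrow> t \<le> T \<Longrightarrow> tame_field S (u t) K"
    and eq: "\<And>t x. 0 < t \<Longrightarrow> t \<le> T \<Longrightarrow> x \<in> S \<Longrightarrow> dt \<rho> t x + dvg (\<lambda>y. \<rho> t y *\<^sub>R u t y) x = 0"
    and bd: "\<And>t x. 0 \<le> t \<Longrightarrow> t \<le> T \<Longrightarrow> x \<in> S \<Longrightarrow> \<bar>\<rho> t x\<bar> \<le> B"
  shows "(LINT x|lebesgue_on S. \<rho> T x) = (LINT x|lebesgue_on S. \<rho> 0 x)"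
proof -
  have op: "open S" "bounded S" "S \<noteq> {}" using S by (auto simp: smooth_bounded_domain_def)
  have Sm: "S \<in> sets lebesgue" using op by auto
  have ne: "frontier S \<noteq> {}" by (rule frontier_nonempty_bounded_open[OF op])
  obtain z where z: "z \<in> S" using op by blast
  have K0: "K \<ge> 0" using tame[of T] T z tame_field_nonneg by blast
  have B0: "B \<ge> 0" using bd[of 0 z] T z by simp
  obtain D c L where c: "c > 0" and D: "barrier_like S D L" and Dc: "\<And>x. x \<in> S \<Longrightarrow> c * bdist S x \<le> D x"
    by (rule barrier_exists[OF S]) (rule that)
  have L0: "L \<ge> 0" using D by (simp add: barrier_like_def)
  have Dpos: "0 < D y" if "y \<in> S" for y
    using Dc[OF that] mult_pos_pos[OF c bdist_pos[OF op(1) that ne]] by linarith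
  have Dle: "D y \<le> L * bdist S y" if "y \<in> S" for y using D that by (simp add: barrier_like_def)
  have Dd: "D differentiable (at y)" if "y \<in> S" for y using D that by (simp add: barrier_like_def)
  have cD: "continuous_on S D"
    using Dd by (intro continuous_at_imp_continuous_on ballI differentiable_imp_continuous_within)
  define \<Lambda> where "\<Lambda> = L * K / c"
  have \<Lambda>0: "\<Lambda> \<ge> 0" using L0 K0 c by (simp add: \<Lambda>_def)
  have \<Lambda>: "\<bar>u t y \<bullet> grad D y\<bar> \<le> \<Lambda> * D y" if "0 < t" "t \<le> T" "y \<in> S" for t y
  proof -
    have "\<bar>u t y \<bullet> grad D y\<bar> \<le> L * K * bdist S y"
      using D tame[OF that(1,2)] that(3) by (auto simp: barrier_like_def)
    also have "\<dots> = \<Lambda> * (c * bdist S y)" using c by (simp add: \<Lambda>_def)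
    also have "\<dots> \<le> \<Lambda> * D y" using \<Lambda>0 by (intro mult_left_mono Dc that)
    finally show ?thesis .
  qed
  have \<rho>c': "continuous_on ({0<..} \<times> S) (\<lambda>(t, x). \<rho> t x)"
    by (rule continuous_on_subset[OF \<rho>c]) auto
  note jR = joint_C1[OF \<rho>C1 op(1)] and jU = joint_C1[OF uC1 op(1)]
  have one: "integrable (lebesgue_on S) (\<lambda>_. c :: real)" for c
    by (rule integrable_const_bounded[OF op(1,2)])
  define \<theta> where "\<theta> n x = smoothstep (real (Suc n) * D x)" for n x
  \<comment> \<open>Contains every point of S with (n + 1) D > 1, since D <= (L + 1)
    \<open>bdist\<close>, and hence all points where \<theta> n is nonzero. L + 1 excludes division
    by zero.\<close>
  define H where "H n = {x \<in> S. 1 / (real (Suc n) * (L + 1)) \<le> bdist S x}" for n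
  define layer where "layer n = (LINT x|lebesgue_on S. indicat_real {x \<in> S. real (Suc n) * D x \<le> 2} x)" for n
  have H: "compact (H n)" "H n \<subseteq> S" for n
    unfolding H_def using L0 by (auto intro!: compact_inner_region[OF op(1,2) ne] mult_pos_pos)
  have \<theta>0: "\<theta> n x = 0" if "x \<in> S" "x \<notin> H n" for n x
  proof -
    have p: "0 < real (Suc n) * (L + 1)" using L0 by (intro mult_pos_pos) auto
    have "bdist S x < 1 / (real (Suc n) * (L + 1))"
      using that unfolding H_def mem_Collect_eq by (meson not_le)
    then have "bdist S x * (real (Suc n) * (L + 1)) < 1"
      by (simp only: pos_less_divide_eq[OF p])
    moreover have "D x \<le> (L + 1) * bdist S x"
      using Dle[OF that(1)] infdist_nonneg[of x "frontier S"] by (simp add: algebra_simps)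
    then have "real (Suc n) * D x \<le> real (Suc n) * ((L + 1) * bdist S x)"
      by (rule mult_left_mono) simp
    ultimately have "real (Suc n) * D x \<le> 1" by (simp only: mult_ac)
    then show ?thesis by (simp add: \<theta>_def smoothstep_eq_0)
  qed
  have \<theta>der: "(\<theta> n has_derivative (\<lambda>h. h \<bullet> ((smoothstep' (real (Suc n) * D x) * real (Suc n)) *\<^sub>R grad D x))) (at x)"
    if "x \<in> S" for n x
  proof -
    have "((\<lambda>x. real (Suc n) * D x) has_derivative (\<lambda>h. real (Suc n) * (h \<bullet> grad D x))) (at x)"
      by (intro has_derivative_mult_right has_derivative_grad Dd that)
    from has_derivative_compose[OF this smoothstep_has_derivative[unfolded has_field_derivative_def]]
    show ?thesis
      unfolding \<theta>_def[abs_def] by (rule has_derivative_eq_rhs) (auto simp: fun_eq_iff)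
  qed
  have g\<theta>: "grad (\<theta> n) x = (smoothstep' (real (Suc n) * D x) * real (Suc n)) *\<^sub>R grad D x" if "x \<in> S" for n x
    by (rule grad_eqI[OF \<theta>der[OF that]])
  have \<theta>d: "\<theta> n differentiable (at x)" if "x \<in> S" for n x
    using \<theta>der[OF that] differentiable_def by blast
  have c\<theta>: "continuous_on S (\<theta> n)" for n
    using \<theta>d by (intro continuous_at_imp_continuous_on ballI differentiable_imp_continuous_within)
  have cp\<theta>: "continuous_on S (pd i (\<theta> n))" for n i
  proof (rule continuous_on_eq)
    show "continuous_on S (\<lambda>x. smoothstep' (real (Suc n) * D x) * real (Suc n) * pd i D x)"
      using D by (intro continuous_intros continuous_on_compose2[OF continuous_on_smoothstep'[of UNIV]] cD)
        (auto simp: barrier_like_def)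
  qed (simp add: pd_eq_grad g\<theta> del: of_nat_Suc)
  have \<rho>cont: "continuous_on S (\<rho> t)" if "t \<ge> 0" for t
    by (rule continuous_on_slice[OF \<rho>c]) (use that in auto)
  have \<rho>m: "\<rho> t \<in> borel_measurable (lebesgue_on S)" if "t \<ge> 0" for t
    by (rule continuous_imp_measurable_on_sets_lebesgue[OF \<rho>cont[OF that] Sm])
  have \<theta>m: "\<theta> n \<in> borel_measurable (lebesgue_on S)" for n
    by (rule continuous_imp_measurable_on_sets_lebesgue[OF c\<theta> Sm])
  define m where "m n t = (LINT x|lebesgue_on S. \<theta> n x * \<rho> t x)" for n t
  have m_der: "((\<lambda>t. m n t) has_vector_derivative (LINT x|lebesgue_on S. \<theta> n x * dt \<rho> t x)) (at t)" if t: "0 < t" for n t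
  proof -
    \<comment> \<open>Zero outside S because the lemma on differentiation under the integral asks
      for derivatives and bounds at every point.\<close>
    define f where "f s y = (if y \<in> S then \<theta> n y * \<rho> s y else 0)" for s y
    define f' where "f' s y = (if y \<in> S then \<theta> n y * dt \<rho> s y else 0)" for s y
    have cdt: "continuous_on S (dt \<rho> s)" if "0 < s" for s
      by (rule continuous_on_slice[OF jR(4)]) (use that in auto)
    obtain B1 where B1: "B1 \<ge> 0" "\<And>s y. s \<in> {t / 2<..<t + 1} \<Longrightarrow> y \<in> H n \<Longrightarrow> \<bar>dt \<rho> s y\<bar> \<le> B1"
      using bounded_on_inner[OF jR(4) H(1)[of n] H(2)[of n], where a = "t / 2" and b = "t + 1"] t by auto
    obtain B2 where B2: "B2 \<ge> 0" "\<And>s y. s \<in> {t / 2<..<t + 1} \<Longrightarrow> y \<in> H n \<Longrightarrow> \<bar>\<rho> s y\<bar> \<le> B2"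
      using bounded_on_inner[OF \<rho>c' H(1)[of n] H(2)[of n], where a = "t / 2" and b = "t + 1"] t by auto
    have bnd: "\<bar>\<theta> n y * v\<bar> \<le> C" if "y \<in> S" "C \<ge> 0" "y \<in> H n \<Longrightarrow> \<bar>v\<bar> \<le> C" for y v C
    proof (cases "y \<in> H n")
      case True
      have "\<bar>\<theta> n y\<bar> * \<bar>v\<bar> \<le> 1 * C"
        using that(3)[OF True] smoothstep_bounds by (intro mult_mono) (auto simp: \<theta>_def)
      then show ?thesis by (simp add: abs_mult)
    qed (use that \<theta>0 in auto)
    have "((\<lambda>s. LINT y|lebesgue_on S. f s y *\<^sub>R (1::real)) has_vector_derivative
        (LINT y|lebesgue_on S. f' t y *\<^sub>R 1)) (at t)"
    proof (rule has_vector_derivative_integral_scaleR[where a = "t / 2" and b = "t + 1" and L = B1 and L' = B2, OF one])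
      fix s y assume s: "s \<in> {t / 2<..<t + 1}"
      then have s0: "0 < s" using t by simp
      show "f s \<in> borel_measurable (lebesgue_on S)"
        unfolding f_def by (rule measurable_cong[THEN iffD1, OF _ borel_measurable_times[OF \<theta>m[of n] \<rho>m[OF less_imp_le[OF s0]]]]) simp
      show "((\<lambda>s. f s y) has_real_derivative f' s y) (at s)"
        using jR(2)[OF s0, of y] unfolding f_def f'_def
        by (cases "y \<in> S") (auto intro!: DERIV_cmult simp: has_real_derivative_iff_has_vector_derivative[symmetric])
      show "\<bar>f' s y\<bar> \<le> B1" "\<bar>f s y\<bar> \<le> B2"
        unfolding f_def f'_def using B1(1) B2(1) B1(2)[OF s] B2(2)[OF s] by (auto intro!: bnd)
    next
      show "f' t \<in> borel_measurable (lebesgue_on S)"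
        unfolding f'_def
        by (rule measurable_cong[THEN iffD1, OF _ borel_measurable_times[OF \<theta>m[of n]
              continuous_imp_measurable_on_sets_lebesgue[OF cdt[OF t] Sm]]]) simp
    qed (use t in auto)
    moreover have "(LINT y|lebesgue_on S. f s y *\<^sub>R (1::real)) = m n s" for s
      unfolding m_def f_def by (intro Bochner_Integration.integral_cong) auto
    moreover have "(LINT y|lebesgue_on S. f' t y *\<^sub>R (1::real)) = (LINT x|lebesgue_on S. \<theta> n x * dt \<rho> t x)"
      unfolding f'_def by (intro Bochner_Integration.integral_cong) auto
    ultimately show ?thesis by simp
  qed
  have layer_m: "(\<lambda>x. indicator {x \<in> S. real (Suc n) * D x \<le> 2} x :: real) \<in> borel_measurable (lebesgue_on S)" for n
  proof -
    have "D \<in> borel_measurable (lebesgue_on S)"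
      by (rule continuous_imp_measurable_on_sets_lebesgue[OF cD Sm])
    then have "{x \<in> space (lebesgue_on S). real (Suc n) * D x \<le> 2} \<in> sets (lebesgue_on S)"
      by measurable
    then show ?thesis by (intro borel_measurable_indicator) simp
  qed
  have layer_i: "integrable (lebesgue_on S) (\<lambda>x. indicator {x \<in> S. real (Suc n) * D x \<le> 2} x :: real)" for n
    by (rule Bochner_Integration.integrable_bound[OF one[of 1] layer_m]) (auto simp: indicator_def)
  \<comment> \<open>8 = 4 * 2: the step has slope at most 4, and (n + 1) D <= 2 where the slope is
    nonzero.\<close>
  have m_der_le: "norm (LINT x|lebesgue_on S. \<theta> n x * dt \<rho> t x) \<le> 8 * \<Lambda> * B * layer n" if t: "0 < t" "t \<le> T" for n t
  proof -
    let ?v = "\<lambda>y. \<rho> t y *\<^sub>R u t y"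
    have vd: "?v differentiable (at y)" if "y \<in> S" for y
      by (rule pd_scaleR(2)[OF jR(1)[OF t(1) that] jU(1)[OF t(1) that]])
    have cu: "continuous_on S (u t)"
      using jU(1)[OF t(1)] by (intro continuous_at_imp_continuous_on ballI differentiable_imp_continuous_within)
    have pR: "continuous_on S (pd i (\<rho> t))" and pU: "continuous_on S (pd i (u t))" for i
      using continuous_on_slice[OF jR(3)[of i], of t] continuous_on_slice[OF jU(3)[of i], of t] t by simp_all
    have vc: "continuous_on S (pd i ?v)" for i
    proof (rule continuous_on_eq)
      show "continuous_on S (\<lambda>y. pd i (\<rho> t) y *\<^sub>R u t y + \<rho> t y *\<^sub>R pd i (u t) y)"
        using t by (intro continuous_intros pR pU cu \<rho>cont) simp
    qed (simp add: pd_scaleR(1)[OF jR(1)[OF t(1)] jU(1)[OF t(1)]])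
    have "(LINT x|lebesgue_on S. \<theta> n x * dt \<rho> t x) = (LINT x|lebesgue_on S. - (\<theta> n x * dvg ?v x))"
    proof (rule Bochner_Integration.integral_cong[OF refl])
      fix x assume "x \<in> space (lebesgue_on S)"
      then have "dt \<rho> t x = - dvg ?v x" using eq[OF t, of x] by (simp add: eq_neg_iff_add_eq_0)
      then show "\<theta> n x * dt \<rho> t x = - (\<theta> n x * dvg ?v x)" by simp
    qed
    also have "\<dots> = (LINT y|lebesgue_on S. ?v y \<bullet> grad (\<theta> n) y)"
      using integral_dvg_compact_support[OF op(1) vd vc \<theta>d cp\<theta> H \<theta>0] by simp
    also have "norm \<dots> \<le> (LINT x|lebesgue_on S. 8 * \<Lambda> * B * indicator {x \<in> S. real (Suc n) * D x \<le> 2} x)"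
    proof (rule Bochner_Integration.integral_norm_bound_integral)
      show "integrable (lebesgue_on S) (\<lambda>y. ?v y \<bullet> grad (\<theta> n) y)"
      proof (rule integrable_continuous_compact_support[OF op(1) _ H[of n]])
        show "continuous_on S (\<lambda>y. ?v y \<bullet> grad (\<theta> n) y)"
          using t by (intro continuous_intros \<rho>cont cu continuous_on_grad cp\<theta>) simp
        fix y assume y: "y \<in> S" "y \<notin> H n"
        have "pd i (\<theta> n) y = 0" for i
          using y H \<theta>0 op(1) by (intro pd_eq_0_open[of "S - H n"]) (auto intro!: open_Diff compact_imp_closed)
        then show "?v y \<bullet> grad (\<theta> n) y = 0" by (simp add: grad_def inner_vec_def)
      qed
      show "integrable (lebesgue_on S) (\<lambda>x. 8 * \<Lambda> * B * indicator {x \<in> S. real (Suc n) * D x \<le> 2} x)"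
        using layer_i[of n] by simp
      fix x assume "x \<in> space (lebesgue_on S)"
      then have x: "x \<in> S" by simp
      let ?s = "real (Suc n) * D x"
      have e: "?v x \<bullet> grad (\<theta> n) x = \<rho> t x * (smoothstep' ?s * real (Suc n) * (u t x \<bullet> grad D x))"
        by (simp add: g\<theta>[OF x] del: of_nat_Suc)
      show "norm (?v x \<bullet> grad (\<theta> n) x) \<le> 8 * \<Lambda> * B * indicator {x \<in> S. real (Suc n) * D x \<le> 2} x"
      proof (cases "?s \<le> 2")
        case True
        have "\<bar>smoothstep' ?s\<bar> * (real (Suc n) * \<bar>u t x \<bullet> grad D x\<bar>) \<le> 4 * (real (Suc n) * (\<Lambda> * D x))"
          by (intro mult_mono mult_left_mono \<Lambda> t x smoothstep'_abs_le) auto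
        also have "\<dots> = 4 * \<Lambda> * ?s" by simp
        also have "\<dots> \<le> 4 * \<Lambda> * 2" using True \<Lambda>0 by (intro mult_left_mono) auto
        finally have h: "\<bar>smoothstep' ?s\<bar> * (real (Suc n) * \<bar>u t x \<bullet> grad D x\<bar>) \<le> 4 * \<Lambda> * 2" .
        have "\<bar>\<rho> t x\<bar> * (\<bar>smoothstep' ?s\<bar> * (real (Suc n) * \<bar>u t x \<bullet> grad D x\<bar>)) \<le> B * (4 * \<Lambda> * 2)"
          by (rule mult_mono[OF bd[OF less_imp_le[OF t(1)] t(2) x] h B0]) simp
        then show ?thesis
          using True x unfolding e by (simp add: abs_mult mult_ac del: of_nat_Suc)
      next
        case False
        then show ?thesis unfolding e by (simp add: smoothstep'_eq_0 del: of_nat_Suc)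
      qed
    qed
    also have "\<dots> = 8 * \<Lambda> * B * layer n" by (simp add: layer_def)
    finally show ?thesis .
  qed
  have m_diff: "\<bar>m n T - m n \<tau>\<bar> \<le> 8 * \<Lambda> * B * layer n * T" if \<tau>: "0 < \<tau>" "\<tau> < T" for n \<tau>
  proof -
    let ?b = "8 * \<Lambda> * B * layer n"
    have "norm (m n T - m n \<tau>) \<le> ?b * T - ?b * \<tau>"
    proof (rule differentiable_bound_general[OF \<tau>(2)])
      show "continuous_on {\<tau>..T} (m n)"
      proof (intro continuous_at_imp_continuous_on ballI)
        fix s assume "s \<in> {\<tau>..T}"
        then have "0 < s" using \<tau> by auto
        from m_der[OF this, of n] show "isCont (m n) s" by (rule has_vector_derivative_continuous)
      qed
      fix s assume s: "\<tau> < s" "s < T"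
      show "(m n has_vector_derivative (LINT x|lebesgue_on S. \<theta> n x * dt \<rho> s x)) (at s)"
        using m_der[of s n] s \<tau> by simp
      show "((\<lambda>s. ?b * s) has_vector_derivative ?b) (at s)"
        by (auto intro!: derivative_eq_intros simp: has_vector_derivative_def)
      show "norm (LINT x|lebesgue_on S. \<theta> n x * dt \<rho> s x) \<le> ?b"
        using m_der_le[of s n] s \<tau> by simp
    qed (intro continuous_intros)
    moreover have "layer n \<ge> 0" unfolding layer_def by simp
    then have "0 \<le> ?b * \<tau>" using \<tau> \<Lambda>0 B0 by simp
    ultimately show ?thesis unfolding real_norm_def by linarith
  qed
  have layer0: "layer \<longlonglongrightarrow> 0"
  proof -
    have "(\<lambda>n. LINT x|lebesgue_on S. indicat_real {x \<in> S. real (Suc n) * D x \<le> 2} x) \<longlonglongrightarrow>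
        (LINT x|lebesgue_on S. 0)"
    proof (rule integral_dominated_convergence[where w = "\<lambda>_. 1"])
      show "AE x in lebesgue_on S. (\<lambda>n. indicator {x \<in> S. real (Suc n) * D x \<le> 2} x :: real) \<longlonglongrightarrow> 0"
      proof (rule AE_I2)
        fix x assume "x \<in> space (lebesgue_on S)"
        then have x: "x \<in> S" by simp
        obtain N :: nat where N: "2 / D x < real N" using reals_Archimedean2 by blast
        have "\<forall>\<^sub>F n in sequentially. (indicator {x \<in> S. real (Suc n) * D x \<le> 2} x :: real) = 0"
          using eventually_ge_at_top[of N]
        proof eventually_elim
          case (elim n)
          have "2 < real N * D x" using N Dpos[OF x] by (simp add: divide_less_eq)
          also have "\<dots> \<le> real (Suc n) * D x" using elim Dpos[OF x] by (intro mult_right_mono) auto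
          finally show ?case by simp
        qed
        then show "(\<lambda>n. indicator {x \<in> S. real (Suc n) * D x \<le> 2} x :: real) \<longlonglongrightarrow> 0"
          by (rule tendsto_eventually)
      qed
    qed (use layer_m one in \<open>auto simp: indicator_def\<close>)
    then show ?thesis by (simp add: layer_def[abs_def])
  qed
  have m_lim: "(\<lambda>n. m n t) \<longlonglongrightarrow> (LINT x|lebesgue_on S. \<rho> t x)" if t: "0 \<le> t" "t \<le> T" for t
    unfolding m_def
  proof (rule integral_dominated_convergence[where w = "\<lambda>_. B"])
    show "\<rho> t \<in> borel_measurable (lebesgue_on S)" by (rule \<rho>m[OF t(1)])
    show "(\<lambda>x. \<theta> n x * \<rho> t x) \<in> borel_measurable (lebesgue_on S)" for n
      by (intro borel_measurable_times \<theta>m \<rho>m t)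
    show "AE x in lebesgue_on S. (\<lambda>n. \<theta> n x * \<rho> t x) \<longlonglongrightarrow> \<rho> t x"
    proof (rule AE_I2)
      fix x assume "x \<in> space (lebesgue_on S)"
      then have x: "x \<in> S" by simp
      obtain N :: nat where N: "2 / D x < real N" using reals_Archimedean2 by blast
      have "\<forall>\<^sub>F n in sequentially. \<theta> n x * \<rho> t x = \<rho> t x"
        using eventually_ge_at_top[of N]
      proof eventually_elim
        case (elim n)
        have "2 < real N * D x" using N Dpos[OF x] by (simp add: divide_less_eq)
        also have "\<dots> \<le> real (Suc n) * D x" using elim Dpos[OF x] by (intro mult_right_mono) auto
        finally show ?case by (simp add: \<theta>_def smoothstep_eq_1 del: of_nat_Suc)
      qed
      then show "(\<lambda>n. \<theta> n x * \<rho> t x) \<longlonglongrightarrow> \<rho> t x" by (rule tendsto_eventually)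
    qed
    show "AE x in lebesgue_on S. norm (\<theta> n x * \<rho> t x) \<le> B" for n
    proof (rule AE_I2)
      fix x assume "x \<in> space (lebesgue_on S)"
      then have "\<bar>\<theta> n x\<bar> * \<bar>\<rho> t x\<bar> \<le> 1 * B"
        using bd[OF t, of x] smoothstep_bounds by (intro mult_mono) (auto simp: \<theta>_def)
      then show "norm (\<theta> n x * \<rho> t x) \<le> B" by (simp add: abs_mult)
    qed
  qed (rule one)
  have const: "(LINT x|lebesgue_on S. \<rho> T x) = (LINT x|lebesgue_on S. \<rho> \<tau> x)" if \<tau>: "0 < \<tau>" "\<tau> < T" for \<tau>
  proof -
    have "(\<lambda>n. \<bar>m n T - m n \<tau>\<bar>) \<longlonglongrightarrow> \<bar>(LINT x|lebesgue_on S. \<rho> T x) - (LINT x|lebesgue_on S. \<rho> \<tau> x)\<bar>"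
      using \<tau> T by (intro tendsto_intros m_lim) auto
    moreover have "(\<lambda>n. 8 * \<Lambda> * B * layer n * T) \<longlonglongrightarrow> 8 * \<Lambda> * B * 0 * T"
      by (intro tendsto_intros layer0)
    ultimately have "\<bar>(LINT x|lebesgue_on S. \<rho> T x) - (LINT x|lebesgue_on S. \<rho> \<tau> x)\<bar> \<le> 8 * \<Lambda> * B * 0 * T"
      by (rule LIMSEQ_le) (use m_diff[OF \<tau>] in auto)
    then show ?thesis by simp
  qed
  \<comment> \<open>k + 2 keeps these times strictly between 0 and T, where the mass is already
    known to be constant.\<close>
  have "(\<lambda>k. LINT x|lebesgue_on S. \<rho> (T / real (k + 2)) x) \<longlonglongrightarrow> (LINT x|lebesgue_on S. \<rho> 0 x)"
  proof (rule integral_dominated_convergence[where w = "\<lambda>_. B"])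
    have r: "0 < T / real (k + 2)" "T / real (k + 2) < T" for k
      using T by (auto simp: divide_less_eq)
    show "\<rho> 0 \<in> borel_measurable (lebesgue_on S)" "\<rho> (T / real (k + 2)) \<in> borel_measurable (lebesgue_on S)" for k
      using r[of k] by (intro \<rho>m; simp)+
    show "AE x in lebesgue_on S. norm (\<rho> (T / real (k + 2)) x) \<le> B" for k
      using bd[of "T / real (k + 2)"] r[of k] by (intro AE_I2) auto
    show "AE x in lebesgue_on S. (\<lambda>k. \<rho> (T / real (k + 2)) x) \<longlonglongrightarrow> \<rho> 0 x"
    proof (rule AE_I2)
      fix x assume "x \<in> space (lebesgue_on S)"
      then have c: "continuous_on {0..} (\<lambda>s. \<rho> s x)"
        by (intro continuous_on_time_slice[OF \<rho>c]) simp
      have "(\<lambda>k. T * inverse (real (k + 2))) \<longlonglongrightarrow> T * 0"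
        by (intro tendsto_intros LIMSEQ_ignore_initial_segment[OF lim_inverse_n])
      then have "(\<lambda>k. T / real (k + 2)) \<longlonglongrightarrow> 0" by (simp add: divide_inverse)
      from continuous_on_tendsto_compose[OF c this] T
      show "(\<lambda>k. \<rho> (T / real (k + 2)) x) \<longlonglongrightarrow> \<rho> 0 x" by auto
    qed
  qed (rule one)
  moreover have "(LINT x|lebesgue_on S. \<rho> (T / real (k + 2)) x) = (LINT x|lebesgue_on S. \<rho> T x)" for k
    using const[of "T / real (k + 2)"] T by (simp add: divide_less_eq)
  ultimately show ?thesis
    by (simp add: LIMSEQ_const_iff)
qed

section \<open>Growth of the density gradient\<close>

text \<open>Continuity in \<open>H^3\<close> on the closed interval bounds the norms, and the
  Sobolev bound turns this into bounds for the velocity and its gradient uniform in space and time.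
  The factor 3 sums over the directions.\<close>

lemma tame_field_uniform:
  fixes u :: "real \<Rightarrow> real^3 \<Rightarrow> real^3"
  assumes S: "smooth_bounded_domain S"
    and u: "C_Hk S 3 {0..T} u" "\<And>t. 0 < t \<Longrightarrow> t \<le> T \<Longrightarrow> C_k_on 1 (u t) S"
    and slip: "\<And>t. 0 < t \<Longrightarrow> t \<le> T \<Longrightarrow> slip_boundary S (u t)"
  obtains K where "\<And>t. 0 < t \<Longrightarrow> t \<le> T \<Longrightarrow> tame_field S (u t) K"
    "\<And>t x. 0 < t \<Longrightarrow> t \<le> T \<Longrightarrow> x \<in> S \<Longrightarrow> \<bar>dvg (u t) x\<bar> \<le> K"
proof -
  have op: "open S" using S by (auto simp: smooth_bounded_domain_def)
  obtain C where C: "C \<ge> 0"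
    "\<And>(f :: real^3 \<Rightarrow> real^3) i x. \<lbrakk>f \<in> Hk S 3; \<And>y. y \<in> S \<Longrightarrow> f differentiable (at y);
      \<And>i. continuous_on S (pd i f); x \<in> S\<rbrakk> \<Longrightarrow>
      norm (f x) \<le> C * Hk_norm S 3 f \<and> norm (pd i f x) \<le> C * Hk_norm S 3 f"
    by (rule H3_C1_sup_bound[OF S, where 'b = "real^3"]) blast
  obtain B where B: "\<And>t. t \<in> {0..T} \<Longrightarrow> Hk_norm S 3 (u t) \<le> B"
    by (rule C_Hk_bounded[OF op u(1)]) (rule that)
  define N where "N = C * max B 0"
  have N0: "N \<ge> 0" using C(1) by (simp add: N_def)
  have d: "u t differentiable (at y)" if "0 < t" "t \<le> T" "y \<in> S" for t y
    using C_k_on_differentiable[of 0 "u t" S y] u(2)[OF that(1,2)] op that(3) by simp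
  have N: "norm (u t x) \<le> N" "norm (pd i (u t) x) \<le> N" if t: "0 < t" "t \<le> T" and x: "x \<in> S" for t i x
  proof -
    have "u t \<in> Hk S 3" using u(1) t by (simp add: C_Hk_def)
    moreover have "continuous_on S (pd i (u t))" for i
      by (rule C1_pd_continuous[of 0]) (use u(2)[OF t] in simp)
    ultimately have "norm (u t x) \<le> C * Hk_norm S 3 (u t) \<and> norm (pd i (u t) x) \<le> C * Hk_norm S 3 (u t)"
      using C(2)[of "u t" x i] d[OF t] x by blast
    moreover have "C * Hk_norm S 3 (u t) \<le> N"
      unfolding N_def using B[of t] t C(1) by (intro mult_left_mono) auto
    ultimately show "norm (u t x) \<le> N" "norm (pd i (u t) x) \<le> N" by auto
  qed
  show thesis
  proof (rule that[of "3 * N"])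
    fix t assume t: "0 < t" "t \<le> T"
    show "tame_field S (u t) (3 * N)"
      unfolding tame_field_def
    proof (intro conjI ballI allI impI)
      fix y assume y: "y \<in> S"
      show "u t differentiable (at y)" by (rule d[OF t y])
      show "norm (u t y) \<le> 3 * N" using N(1)[OF t y] N0 by simp
      fix h
      have "norm (frechet_derivative (u t) (at y) h) \<le> (\<Sum>i\<in>UNIV. norm (h $ i *\<^sub>R pd i (u t) y))"
        unfolding frechet_derivative_cart[OF d[OF t y]] by (rule norm_sum)
      also have "\<dots> \<le> (\<Sum>i\<in>(UNIV::3 set). norm h * N)"
        using N(2)[OF t y] component_le_norm_cart[of h] N0 by (intro sum_mono) (simp add: mult_mono)
      finally show "norm (frechet_derivative (u t) (at y) h) \<le> 3 * N * norm h" by (simp add: mult_ac)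
    next
      fix q \<nu> assume "q \<in> frontier S" "outward_unit_normal S q \<nu>"
      then show "((\<lambda>y. u t y \<bullet> \<nu>) \<longlongrightarrow> 0) (at q within S)"
        using slip[OF t] by (simp add: slip_boundary_def)
    qed
    fix x assume x: "x \<in> S"
    have "\<bar>pd i (u t) x $ i\<bar> \<le> N" for i
      by (rule order_trans[OF component_le_norm_cart N(2)[OF t x]])
    then have "\<bar>dvg (u t) x\<bar> \<le> (\<Sum>i\<in>(UNIV::3 set). N)"
      unfolding dvg_def by (intro order_trans[OF sum_abs] sum_mono)
    then show "\<bar>dvg (u t) x\<bar> \<le> 3 * N" by simp
  qed
qed

lemma dvg_scaleR:
  assumes "\<rho> differentiable (at x)" "u differentiable (at x)"
  shows "dvg (\<lambda>y. \<rho> y *\<^sub>R u y) x = u x \<bullet> grad \<rho> x + \<rho> x * dvg u x"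
  using pd_scaleR(1)[OF assms]
  by (simp add: dvg_def inner_vec_def grad_def sum.distrib sum_distrib_left mult.commute)

text \<open>The \<open>H^3\<close> bound makes f and its gradient bounded, hence integrable to every
  power on the bounded domain. Subtracting m leaves the gradient alone, so the estimate applies to
  the deviation from the mean.\<close>

lemma W1r_C1_of_H3:
  fixes f :: "real^3 \<Rightarrow> real"
  assumes S: "smooth_bounded_domain S" and f: "f \<in> Hk S 3" and d: "\<And>y. y \<in> S \<Longrightarrow> f differentiable (at y)"
    and c: "\<And>i. continuous_on S (pd i f)" and r: "r \<ge> 0"
  shows "W1r_C1 S r (\<lambda>x. f x - m) (Lp_norm S r (grad f))"
proof -
  have op: "open S" "bounded S" using S by (auto simp: smooth_bounded_domain_def)
  have Sm: "S \<in> sets lebesgue" using op by auto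
  obtain C where C: "C \<ge> 0"
    "\<And>(f :: real^3 \<Rightarrow> real) i x. \<lbrakk>f \<in> Hk S 3; \<And>y. y \<in> S \<Longrightarrow> f differentiable (at y);
      \<And>i. continuous_on S (pd i f); x \<in> S\<rbrakk> \<Longrightarrow>
      norm (f x) \<le> C * Hk_norm S 3 f \<and> norm (pd i f x) \<le> C * Hk_norm S 3 f"
    by (rule H3_C1_sup_bound[OF S, where 'b = real]) blast
  define N where "N = C * Hk_norm S 3 f"
  have N: "norm (f x) \<le> N" "norm (pd i f x) \<le> N" if "x \<in> S" for i x
    using C(2)[of f x i] f d c that unfolding N_def by blast+
  have bint: "integrable (lebesgue_on S) g"
    if "g \<in> borel_measurable (lebesgue_on S)" "\<And>x. x \<in> S \<Longrightarrow> \<bar>g x\<bar> \<le> B" for g :: "real^3 \<Rightarrow> real" and B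
  proof (rule Bochner_Integration.integrable_bound[OF integrable_const_bounded[OF op, of B] that(1)])
    show "AE x in lebesgue_on S. norm (g x) \<le> norm B"
    proof (rule AE_I2)
      fix x assume "x \<in> space (lebesgue_on S)"
      then have "\<bar>g x\<bar> \<le> B" using that(2) by simp
      then show "norm (g x) \<le> norm B" by simp
    qed
  qed
  have cf: "continuous_on S f"
    using d by (intro continuous_at_imp_continuous_on ballI differentiable_imp_continuous_within)
  have pdm: "pd i (\<lambda>x. f x - m) y = pd i f y" "(\<lambda>x. f x - m) differentiable (at y)" if "y \<in> S" for i y
  proof -
    have "((\<lambda>x. f x - m) has_derivative (\<lambda>h. h \<bullet> grad f y)) (at y)"
      using has_derivative_diff[OF has_derivative_grad[OF d[OF that]] has_derivative_const[of m]] by simp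
    from grad_eqI[OF this] this show "pd i (\<lambda>x. f x - m) y = pd i f y" "(\<lambda>x. f x - m) differentiable (at y)"
      by (auto simp: pd_eq_grad differentiable_def)
  qed
  have gradN: "norm (grad f y) \<le> 3 * N" if "y \<in> S" for y
    by (rule norm_le_cube) (use N(2)[OF that] in \<open>simp add: pd_eq_grad\<close>)
  have m: "f \<in> borel_measurable (lebesgue_on S)" "pd i f \<in> borel_measurable (lebesgue_on S)"
    "grad f \<in> borel_measurable (lebesgue_on S)" for i
    by (rule continuous_imp_measurable_on_sets_lebesgue[OF _ Sm], intro cf c continuous_on_grad)+
  have r_pd: "integrable (lebesgue_on S) (\<lambda>y. norm (pd i f y) powr r)" for i
  proof (rule bint)
    show "(\<lambda>y. norm (pd i f y) powr r) \<in> borel_measurable (lebesgue_on S)"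
      using m(2) by measurable
    show "\<bar>norm (pd i f x) powr r\<bar> \<le> N powr r" if "x \<in> S" for x
      using N(2)[OF that] r by (simp add: powr_mono2)
  qed
  have r_grad: "integrable (lebesgue_on S) (\<lambda>y. norm (grad f y) powr r)"
  proof (rule bint)
    show "(\<lambda>y. norm (grad f y) powr r) \<in> borel_measurable (lebesgue_on S)"
      using m(3) by measurable
    show "\<bar>norm (grad f x) powr r\<bar> \<le> (3 * N) powr r" if "x \<in> S" for x
      using gradN[OF that] r by (simp add: powr_mono2)
  qed
  have cong: "(LINT y|lebesgue_on S. norm (pd i (\<lambda>x. f x - m) y) powr r) = (LINT y|lebesgue_on S. norm (pd i f y) powr r)"
    "integrable (lebesgue_on S) (\<lambda>y. norm (pd i (\<lambda>x. f x - m) y) powr r) \<longleftrightarrow>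
     integrable (lebesgue_on S) (\<lambda>y. norm (pd i f y) powr r)" for i
    by (rule Bochner_Integration.integral_cong Bochner_Integration.integrable_cong, simp, simp add: pdm(1))+
  show ?thesis
    unfolding W1r_C1_def
  proof (intro conjI ballI allI)
    show "integrable (lebesgue_on S) (\<lambda>x. f x - m)"
    proof (rule bint)
      show "(\<lambda>x. f x - m) \<in> borel_measurable (lebesgue_on S)" using m(1) by measurable
      show "\<bar>f x - m\<bar> \<le> N + \<bar>m\<bar>" if "x \<in> S" for x using N(1)[OF that] by simp
    qed
    show "(\<lambda>x. f x - m) differentiable (at y)" if "y \<in> S" for y by (rule pdm(2)[OF that])
    show "continuous_on S (pd i (\<lambda>x. f x - m))" for i
      by (rule continuous_on_eq[OF c[of i]]) (simp add: pdm(1))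
    show "integrable (lebesgue_on S) (\<lambda>y. norm (pd i (\<lambda>x. f x - m) y) powr r)" for i
      unfolding cong(2) by (rule r_pd)
    show "Lp_norm S r (pd i (\<lambda>x. f x - m)) \<le> Lp_norm S r (grad f)" for i
      unfolding Lp_norm_def cong(1)
    proof (rule powr_mono2)
      show "(LINT x|lebesgue_on S. norm (pd i f x) powr r) \<le> (LINT x|lebesgue_on S. norm (grad f x) powr r)"
      proof (rule integral_mono[OF r_pd r_grad])
        show "norm (pd i f x) powr r \<le> norm (grad f x) powr r" for x
          using r component_le_norm_cart[of "grad f x" i] by (intro powr_mono2) (simp_all add: pd_eq_grad)
      qed
    qed (use r in auto)
  qed
qed

lemma exp_neg_le_inverse: "y > 0 \<Longrightarrow> exp (- y) \<le> 1 / y" for y :: real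
proof -
  assume y: "y > 0"
  have "y \<le> exp y" using exp_ge_add_one_self[of y] by linarith
  then show "exp (- y) \<le> 1 / y" using y by (simp add: exp_minus divide_simps)
qed

theorem theorem1p2:
  fixes \<Omega> :: "(real^3) set"
    and \<mu> a \<gamma> b \<beta> rhohat M \<epsilon> :: real
  assumes "smooth_bounded_domain \<Omega>"
    and "simply_connected \<Omega>"
    and "finite (components (frontier \<Omega>))"
    and "\<mu> > 0" and "a > 0" and "\<gamma> > 1" and "b > 0" and "1 \<le> \<beta>" and "\<beta> \<le> \<gamma> + 1"
    and "M > 0" and "rhohat > 0"
    and "smallness_constant \<Omega> \<mu> (viscosity b \<beta>) (pressure a \<gamma>) rhohat M \<epsilon>"
  shows "\<forall>rbar>0. \<forall>r>3. \<exists>C1>0. \<exists>C2>0. \<forall>\<rho>0 u0.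
      admissible_data \<Omega> \<mu> (viscosity b \<beta>) (pressure a \<gamma>) rhohat M \<rho>0 u0 \<and>
      mean \<Omega> \<rho>0 = rbar \<and>
      initial_energy \<Omega> (pressure a \<gamma>) \<rho>0 u0 \<le> \<epsilon> \<and>
      (\<exists>x0\<in>\<Omega>. \<rho>0 x0 = 0) \<longrightarrow>
      (\<forall>\<rho> u. unique_global_classical_solution \<Omega> \<mu> (viscosity b \<beta>) (pressure a \<gamma>) \<rho>0 u0 \<rho> u \<longrightarrow>
        (\<forall>t>0. Lp_norm \<Omega> r (grad (\<rho> t)) \<ge> C1 * exp (C2 * t)))"
proof (intro allI impI)
  fix rbar r :: real
  assume rbar: "rbar > 0" and r: "r > 3"
  note S = assms(1)
  have op: "open \<Omega>" "bounded \<Omega>" "\<Omega> \<noteq> {}" using S by (auto simp: smooth_bounded_domain_def)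
  have Sm: "\<Omega> \<in> sets lebesgue" using op by auto
  define vol where "vol = measure lebesgue \<Omega>"
  have lm: "\<Omega> \<in> lmeasurable" by (rule lmeasurable_open[OF op(2,1)])
  have vol: "vol > 0"
    using open_not_negligible[OF op(1,3)] lm negligible_iff_measure[of \<Omega>] zero_less_measure_iff
    unfolding vol_def by blast
  obtain CM where CM: "CM > 0"
    "\<And>f A x s. \<lbrakk>W1r_C1 \<Omega> r f A; x \<in> \<Omega>; 0 < s; s \<le> 1\<rbrakk> \<Longrightarrow>
      \<bar>f x\<bar> \<le> CM * (A * s powr (1 - 3 / r) + s powr - 3 * Lp_norm \<Omega> 1 f)"
    by (rule morrey_pointwise[OF S r]) blast
  obtain CO where CO: "CO > 0" "\<And>f A x y. \<lbrakk>W1r_C1 \<Omega> r f A; x \<in> \<Omega>; y \<in> \<Omega>\<rbrakk> \<Longrightarrow> \<bar>f x - f y\<bar> \<le> CO * A"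
    by (rule oscillation_bound[OF S r]) blast
  let ?lam = "viscosity b \<beta>" and ?P = "pressure a \<gamma>"
  \<comment> \<open>The decay statement at r = p = 1, which controls the L^1 deviation from the
    mean.\<close>
  have "\<exists>C>0. \<exists>\<eta>>0. \<forall>\<rho>0 u0 \<rho> u.
        admissible_data \<Omega> \<mu> ?lam ?P rhohat M \<rho>0 u0 \<and> initial_energy \<Omega> ?P \<rho>0 u0 \<le> \<epsilon> \<and>
        mean \<Omega> \<rho>0 = rbar \<and>
        unique_global_classical_solution \<Omega> \<mu> ?lam ?P \<rho>0 u0 \<rho> u \<longrightarrow>
        (\<forall>t\<ge>1. Lp_norm \<Omega> 1 (\<lambda>x. \<rho> t x - rbar) + Wkp_norm \<Omega> 1 1 (u t)
           + (Lp_norm \<Omega> 2 (\<lambda>x. sqrt (\<rho> t x) *\<^sub>R material_derivative u t x))\<^sup>2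
           \<le> C * exp (- \<eta> * t))"
    using assms(12) unfolding smallness_constant_def
    by (elim conjE) (drule spec[of _ rbar], drule spec[of _ 1], simp)
  then obtain C \<eta> where C: "C > 0" "\<eta> > 0"
    and decay0: "\<forall>\<rho>0 u0 \<rho> u.
        admissible_data \<Omega> \<mu> ?lam ?P rhohat M \<rho>0 u0 \<and> initial_energy \<Omega> ?P \<rho>0 u0 \<le> \<epsilon> \<and>
        mean \<Omega> \<rho>0 = rbar \<and>
        unique_global_classical_solution \<Omega> \<mu> ?lam ?P \<rho>0 u0 \<rho> u \<longrightarrow>
        (\<forall>t\<ge>1. Lp_norm \<Omega> 1 (\<lambda>x. \<rho> t x - rbar) + Wkp_norm \<Omega> 1 1 (u t)
           + (Lp_norm \<Omega> 2 (\<lambda>x. sqrt (\<rho> t x) *\<^sub>R material_derivative u t x))\<^sup>2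
           \<le> C * exp (- \<eta> * t))"
    by (elim exE conjE)
  define \<kappa> where "\<kappa> = 1 - 3 / r"
  have \<kappa>: "\<kappa> > 0" using r by (simp add: \<kappa>_def)
  \<comment> \<open>After T1 the term CM C exp(-\<eta> t / 2) is below rbar / 4, by exp(-y) <= 1 / y
    at y = \<eta> t / 2. T1 is at least 1 because the decay is assumed from time 1 on.\<close>
  define T1 where "T1 = max 1 (8 * CM * C / (rbar * \<eta>))"
  \<comment> \<open>C2 is the decay rate of s^\<kappa> for the scale s = exp(-\<eta> t / 6) used at
    late times. C1 covers both time ranges: up to T1 its factor exp(-C2 T1) offsets the exponential
    growth.\<close>
  define C2 where "C2 = \<kappa> * \<eta> / 6"
  define C1 where "C1 = min (rbar / (2 * CM)) (rbar / (2 * CO) * exp (- C2 * T1))"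
  have C2: "C2 > 0" using \<kappa> C by (simp add: C2_def)
  have C1: "C1 > 0" using rbar CM CO by (simp add: C1_def)
  have T1: "T1 > 0" "T1 \<ge> 1" by (auto simp: T1_def)
  show "\<exists>C1>0. \<exists>C2>0. \<forall>\<rho>0 u0.
      admissible_data \<Omega> \<mu> ?lam ?P rhohat M \<rho>0 u0 \<and>
      mean \<Omega> \<rho>0 = rbar \<and>
      initial_energy \<Omega> ?P \<rho>0 u0 \<le> \<epsilon> \<and>
      (\<exists>x0\<in>\<Omega>. \<rho>0 x0 = 0) \<longrightarrow>
      (\<forall>\<rho> u. unique_global_classical_solution \<Omega> \<mu> ?lam ?P \<rho>0 u0 \<rho> u \<longrightarrow>
        (\<forall>t>0. Lp_norm \<Omega> r (grad (\<rho> t)) \<ge> C1 * exp (C2 * t)))"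
  proof (rule exI[of _ C1], rule conjI[OF C1], rule exI[of _ C2], rule conjI[OF C2], intro allI impI, elim conjE bexE)
    fix \<rho>0 u0 \<rho> u x0 and t :: real
    assume adm: "admissible_data \<Omega> \<mu> ?lam ?P rhohat M \<rho>0 u0" and mean: "mean \<Omega> \<rho>0 = rbar"
      and en: "initial_energy \<Omega> ?P \<rho>0 u0 \<le> \<epsilon>"
      and sol: "unique_global_classical_solution \<Omega> \<mu> ?lam ?P \<rho>0 u0 \<rho> u"
      and t: "0 < t" and x0: "x0 \<in> \<Omega>" "\<rho>0 x0 = 0"
    have gs: "global_classical_solution \<Omega> \<mu> ?lam ?P \<rho>0 u0 \<rho> u"
      using sol by (simp add: unique_global_classical_solution_def)
    have cr: "classical_regularity \<Omega> \<rho> u" and sr: "solution_regularity \<Omega> ?P \<rho> u"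
      and nonneg: "\<And>t x. 0 \<le> t \<Longrightarrow> x \<in> \<Omega> \<Longrightarrow> 0 \<le> \<rho> t x"
      and ns: "\<And>t x. 0 < t \<Longrightarrow> x \<in> \<Omega> \<Longrightarrow> dt \<rho> t x + dvg (\<lambda>y. \<rho> t y *\<^sub>R u t y) x = 0"
      and init: "\<And>x. x \<in> \<Omega> \<Longrightarrow> \<rho> 0 x = \<rho>0 x"
      and slip: "\<And>t. 0 < t \<Longrightarrow> slip_boundary \<Omega> (u t)"
      using gs by (auto simp: global_classical_solution_def NS_equations_def)
    have \<rho>C1: "C_k_on 1 (\<lambda>(t, x). \<rho> t x) ({0<..} \<times> \<Omega>)" and uC1: "C_k_on 1 (\<lambda>(t, x). u t x) ({0<..} \<times> \<Omega>)"
      and \<rho>c: "continuous_on ({0..} \<times> \<Omega>) (\<lambda>(t, x). \<rho> t x)"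
      and uC2: "\<And>t. 0 < t \<Longrightarrow> C_k_on 2 (u t) \<Omega>"
      using cr by (simp_all only: classical_regularity_def)
    have uC1': "C_k_on 1 (u s) \<Omega>" if "0 < s" for s
      using C_k_on_mono[of 1 "u s" \<Omega>] uC2[OF that] by (simp only: numeral_2_eq_2 One_nat_def)
    have CH: "C_Hk \<Omega> 3 {0..t} \<rho>" "C_Hk \<Omega> 3 {0..t} u"
      using sr[unfolded solution_regularity_def, rule_format, of "t / 2" t] t by simp_all
    obtain K where K: "\<And>s. 0 < s \<Longrightarrow> s \<le> t \<Longrightarrow> tame_field \<Omega> (u s) K"
      "\<And>s x. 0 < s \<Longrightarrow> s \<le> t \<Longrightarrow> x \<in> \<Omega> \<Longrightarrow> \<bar>dvg (u s) x\<bar> \<le> K"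
      by (rule tame_field_uniform[OF S CH(2) uC1' slip]) (assumption | rule that)+
    note jR = joint_C1[OF \<rho>C1 op(1)] and jU = joint_C1[OF uC1 op(1)]
    \<comment> \<open>A bound on the density up to the boundary, which dominates the integrals in
      \<open>mass_conserved\<close>; it comes with the smallness constant.\<close>
    have upper: "\<rho> s x \<le> 2 * rhohat" if "0 \<le> s" "s \<le> t" "x \<in> \<Omega>" for s x
    proof -
      obtain Ct where "\<forall>\<rho>0 u0 \<rho> u.
        admissible_data \<Omega> \<mu> ?lam ?P rhohat M \<rho>0 u0 \<and> initial_energy \<Omega> ?P \<rho>0 u0 \<le> \<epsilon> \<and>
        unique_global_classical_solution \<Omega> \<mu> ?lam ?P \<rho>0 u0 \<rho> u \<longrightarrow>
        (\<forall>s\<in>{0..t}. \<forall>x\<in>\<Omega>. Ct * (INF y\<in>\<Omega>. \<rho>0 y) \<le> \<rho> s x \<and> \<rho> s x \<le> 2 * rhohat)"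
        using assms(12) t unfolding smallness_constant_def by blast
      then have "\<forall>s\<in>{0..t}. \<forall>x\<in>\<Omega>. Ct * (INF y\<in>\<Omega>. \<rho>0 y) \<le> \<rho> s x \<and> \<rho> s x \<le> 2 * rhohat"
        using adm en sol by blast
      then show ?thesis using that by auto
    qed
    have "(LINT x|lebesgue_on \<Omega>. \<rho> t x) = (LINT x|lebesgue_on \<Omega>. \<rho> 0 x)"
    proof (rule mass_conserved[OF S t \<rho>C1 uC1 \<rho>c K(1)])
      show "\<bar>\<rho> s x\<bar> \<le> 2 * rhohat" if "0 \<le> s" "s \<le> t" "x \<in> \<Omega>" for s x
        using upper[OF that] nonneg[of s x] that by simp
    qed (use ns in auto)
    also have "\<dots> = (LINT x|lebesgue_on \<Omega>. \<rho>0 x)"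
      by (rule Bochner_Integration.integral_cong) (auto simp: init)
    also have "\<dots> = rbar * vol"
      using mean vol by (simp add: mean_def vol_def field_simps)
    finally have mass: "(LINT x|lebesgue_on \<Omega>. \<rho> t x) = rbar * vol" .
    define A where "A = Lp_norm \<Omega> r (grad (\<rho> t))"
    have W: "W1r_C1 \<Omega> r (\<lambda>x. \<rho> t x - m) A" for m
      unfolding A_def
    proof (rule W1r_C1_of_H3[OF S])
      show "\<rho> t \<in> Hk \<Omega> 3" using CH(1) t by (simp add: C_Hk_def)
      show "\<rho> t differentiable (at y)" if "y \<in> \<Omega>" for y by (rule jR(1)[OF t that])
      show "continuous_on \<Omega> (pd i (\<rho> t))" for i
        using continuous_on_slice[OF jR(3)[of i], of t] t by simp
    qed (use r in simp)
    \<comment> \<open>Every positive lower bound for the density is contradictory. The choice rbar /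
      4 leaves a margin of rbar / 2 both in the oscillation at early times and, after the loss of
      rbar / 4, at late times.\<close>
    have "\<exists>x\<in>\<Omega>. \<rho> t x < rbar / 4"
    proof (rule ccontr)
      assume "\<not> ?thesis"
      then have ge: "rbar / 4 \<le> \<rho> t x" if "x \<in> \<Omega>" for x using that by force
      have "0 < \<rho> 0 x0"
      proof (rule density_positive_backward[OF S t \<rho>C1 \<rho>c K(1,2) _ nonneg _ ge x0(1)])
        fix s x assume s: "0 < s" "s \<le> t" and x: "x \<in> \<Omega>"
        show "dt \<rho> s x + u s x \<bullet> grad (\<rho> s) x + \<rho> s x * dvg (u s) x = 0"
          using ns[OF s(1) x] dvg_scaleR[OF jR(1)[OF s(1) x] jU(1)[OF s(1) x]] by simp
      qed (use rbar in auto)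
      then show False using init[OF x0(1)] x0(2) by simp
    qed
    then obtain x where x: "x \<in> \<Omega>" "\<rho> t x < rbar / 4" by blast
    have "\<exists>y\<in>\<Omega>. 3 / 4 * rbar \<le> \<rho> t y"
    proof (rule ccontr)
      assume "\<not> ?thesis"
      then have lt: "\<rho> t y \<le> 3 / 4 * rbar" if "y \<in> \<Omega>" for y using that by force
      have i: "integrable (lebesgue_on \<Omega>) (\<rho> t)"
        using W[of 0] by (simp add: W1r_C1_def)
      have "(LINT x|lebesgue_on \<Omega>. \<rho> t x) \<le> (LINT x|lebesgue_on \<Omega>. 3 / 4 * rbar)"
        by (rule integral_mono[OF i integrable_const_bounded[OF op(1,2)]]) (use lt in auto)
      also have "\<dots> = 3 / 4 * rbar * vol"
        using Sm by (simp add: vol_def measure_restrict_space)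
      finally show False using mass rbar vol by (simp add: mult_less_cancel_right)
    qed
    then obtain y where y: "y \<in> \<Omega>" "3 / 4 * rbar \<le> \<rho> t y" by blast
    have A0: "A \<ge> 0" by (rule W1r_C1_nonneg[OF W])
    have "C1 * exp (C2 * t) \<le> A"
    proof (cases "t \<le> T1")
      case True
      have "rbar / 2 \<le> \<bar>\<rho> t y - \<rho> t x\<bar>" using x(2) y(2) by linarith
      also have "\<dots> \<le> CO * A"
        using CO(2)[OF W[of 0] y(1) x(1)] by simp
      finally have "rbar / (2 * CO) \<le> A" using CO(1) by (simp add: field_simps)
      have "C1 * exp (C2 * t) \<le> rbar / (2 * CO) * exp (- C2 * T1) * exp (C2 * T1)"
        using True C2 rbar CO by (intro mult_mono) (auto simp: C1_def)
      also have "\<dots> = rbar / (2 * CO)" by (simp add: mult.assoc flip: exp_add)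
      also note \<open>rbar / (2 * CO) \<le> A\<close>
      finally show ?thesis .
    next
      case False
      then have t1: "t \<ge> 1" "t > 0" using T1 by auto
      \<comment> \<open>With this scale s^(-3) = exp(\<eta> t / 2) uses up half of the exponential
        decay, and the L^1 term still tends to 0.\<close>
      define s where "s = exp (- \<eta> * t / 6)"
      have s: "0 < s" "s \<le> 1" using C t by (auto simp: s_def)
      have "Lp_norm \<Omega> 1 (\<lambda>x. \<rho> t x - rbar) + Wkp_norm \<Omega> 1 1 (u t)
           + (Lp_norm \<Omega> 2 (\<lambda>x. sqrt (\<rho> t x) *\<^sub>R material_derivative u t x))\<^sup>2 \<le> C * exp (- \<eta> * t)"
        using decay0 adm en mean sol t1(1) by blast
      moreover have "Wkp_norm \<Omega> 1 1 (u t) \<ge> 0" by (simp add: Wkp_norm_def)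
      ultimately have dec: "Lp_norm \<Omega> 1 (\<lambda>x. \<rho> t x - rbar) \<le> C * exp (- \<eta> * t)"
        using zero_le_power2[of "Lp_norm \<Omega> 2 (\<lambda>x. sqrt (\<rho> t x) *\<^sub>R material_derivative u t x)"] by linarith
      have s\<kappa>: "s powr \<kappa> = exp (- C2 * t)" and s3: "s powr - 3 = exp (\<eta> * t / 2)"
        by (simp_all add: s_def powr_def C2_def)
      have "3 / 4 * rbar \<le> \<bar>\<rho> t x - rbar\<bar>" using x rbar by simp
      also have "\<dots> \<le> CM * (A * s powr \<kappa> + s powr - 3 * Lp_norm \<Omega> 1 (\<lambda>x. \<rho> t x - rbar))"
        unfolding \<kappa>_def by (rule CM(2)[OF W x(1) s])
      also have "\<dots> \<le> CM * (A * exp (- C2 * t) + exp (\<eta> * t / 2) * (C * exp (- \<eta> * t)))"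
        unfolding s\<kappa> s3 using CM(1) dec by (intro mult_left_mono add_left_mono) auto
      also have "exp (\<eta> * t / 2) * (C * exp (- \<eta> * t)) = C * exp (- (\<eta> * t / 2))"
        by (simp flip: exp_add)
      also have "CM * (A * exp (- C2 * t) + C * exp (- (\<eta> * t / 2))) \<le> CM * A * exp (- C2 * t) + rbar / 4"
      proof -
        have "8 * CM * C / (rbar * \<eta>) \<le> t" using False by (simp add: T1_def)
        then have "8 * CM * C \<le> t * (rbar * \<eta>)" using rbar C by (simp add: divide_le_eq)
        then have "CM * C * (1 / (\<eta> * t / 2)) \<le> rbar / 4"
          using C t by (simp add: field_simps)
        moreover have "CM * C * exp (- (\<eta> * t / 2)) \<le> CM * C * (1 / (\<eta> * t / 2))"
          using C CM t by (intro mult_left_mono exp_neg_le_inverse) auto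
        ultimately have "CM * C * exp (- (\<eta> * t / 2)) \<le> rbar / 4" by (rule order_trans[rotated])
        then show ?thesis unfolding distrib_left mult.assoc by (rule add_left_mono)
      qed
      finally have "rbar / 2 \<le> CM * A * exp (- C2 * t)" by (simp add: mult_ac)
      then have "rbar / 2 * exp (C2 * t) \<le> CM * A * exp (- C2 * t) * exp (C2 * t)"
        by (rule mult_right_mono) simp
      also have "\<dots> = CM * A" by (simp add: mult.assoc flip: exp_add)
      finally have "rbar / (2 * CM) * exp (C2 * t) \<le> A" using CM(1) by (simp add: field_simps)
      moreover have "C1 * exp (C2 * t) \<le> rbar / (2 * CM) * exp (C2 * t)"
        by (intro mult_right_mono) (auto simp: C1_def)
      ultimately show ?thesis by linarith
    qed
    then show "C1 * exp (C2 * t) \<le> Lp_norm \<Omega> r (grad (\<rho> t))"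
      by (simp add: A_def)
  qed
qed

end
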